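(* Let $T$ be a complete $\omega$-categorical theory in a countable language, let $\mathcal{M}\models T$ be $\kappa$-saturated (with $\kappa$ as in the context), and let $n<\omega$. Suppose that the exchange property with respect to $n$ holds. Then $n$-independence $\mathop{\smile\!\!\!\!\!\!|}^{n}$ is an independence relation restricted to $M_n$.
   Context: Standing setting: $T$ is a complete $\omega$-categorical theory in a countable language; $\mathcal{M}\models T$ is $\kappa$-saturated for some infinite cardinal $\kappa$ (as large as desired), with universe $M$; $\mathcal{M}^{\mathrm{eq}}$ is the usual expansion by imaginaries, with universe $M^{\mathrm{eq}}$; $\mathrm{acl}^{\mathrm{eq}}$ is algebraic closure computed in $\mathcal{M}^{\mathrm{eq}}$, $\mathrm{tp}$ denotes types computed in $\mathcal{M}^{\mathrm{eq}}$, and all subsets of $M^{\mathrm{eq}}$ considered have cardinality $<\kappa$. $AB$ means $A\cup B$, and $aB$ means $\{a\}\cup B$. Levels: $M_0=M$ and $M_{k+1}=M_k\cup X_{k+1}$, where $X_{k+1}$ is the set of imaginary elements of $M^{\mathrm{eq}}$ that are equivalence classes of $\emptyset$-definable equivalence relations on $M^{k+1}$. For $A\subseteq M^{\mathrm{eq}}$, $\mathrm{acl}^n(A)=\mathrm{acl}^{\mathrm{eq}}(A)\cap M_n$. $n$-rank: for $A,B\subseteq M^{\mathrm{eq}}$, $\mathrm{rk}^n(A/B)\ge 0$ always; $\mathrm{rk}^n(A/B)\ge\alpha+1$ iff there is $a\in\mathrm{acl}^n(A)\setminus\mathrm{acl}^n(B)$ with $\mathrm{rk}^n(A/\{a\}\cup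 B)\ge\alpha$; for limit $\alpha$, $\mathrm{rk}^n(A/B)\ge\alpha$ iff $\mathrm{rk}^n(A/B)\ge\beta$ for all $\beta<\alpha$; $\mathrm{rk}^n(A/B)=\alpha$ iff $\ge\alpha$ and not $\ge\alpha+1$. For tuples, $\mathrm{rk}^n(\bar a/\bar b)$ means $\mathrm{rk}^n(\mathrm{rng}(\bar a)/\mathrm{rng}(\bar b))$. $n$-independence: for $A,B,C\subseteq M^{\mathrm{eq}}$, $A\mathop{\smile\!\!\!\!\!\!|}^{n}_C B$ iff for every finite $A'\subseteq A$, $\mathrm{rk}^n(A'/BC)=\mathrm{rk}^n(A'/C)$. Exchange property with respect to $n$: whenever $C\subseteq M^{\mathrm{eq}}$, $2\le k<\omega$, $a_1,\dots,a_k\in M_n$, $\mathrm{rk}^n(a_i/C)=1$ for all $i$, and $a_k\in\mathrm{acl}^{\mathrm{eq}}(\{a_1,\dots,a_{k-1}\}\cup C)\setminus\mathrm{acl}^{\mathrm{eq}}(\{a_2,\dots,a_{k-1}\}\cup C)$, then $a_1\in\mathrm{acl}^{\mathrm{eq}}(\{a_2,\dots,a_k\}\cup C)$. A bijection $\sigma$ from a subset of $M^{\mathrm{eq}}$ onto a subset of $M^{\mathrm{eq}}$ is elementary if $\mathrm{tp}(a_1,\dots,a_m)=\mathrm{tp}(\sigma(a_1),\dots,\sigma(a_m))$ for all $a_1,\dots,a_m$ in its domain. Independence relation restricted to $M_n$: a relation $A\mathop{\smile\!\!\!\!\!\!|}_C B$ on triples $(A,B,C)$ of subsets of $M^{\mathrm{eq}}$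 with $A$ finite, such that the following hold whenever $A,B,C,D\subseteq M_n$: (1) invariance: for every elementary $\sigma$ whose domain includes $ABC$, $A\mathop{\smile\!\!\!\!\!\!|}_C B$ iff $\sigma(A)\mathop{\smile\!\!\!\!\!\!|}_{\sigma(C)}\sigma(B)$; (2) local character: for all $A$ (finite) and $B$ there is a countable $C\subseteq B$ with $A\mathop{\smile\!\!\!\!\!\!|}_C B$; (3) finite character: $A\mathop{\smile\!\!\!\!\!\!|}_C B$ iff $A\mathop{\smile\!\!\!\!\!\!|}_C B'$ for all finite $B'\subseteq B$; (4) extension: for all $A=\{a_1,\dots,a_m\}$ and $C\subseteq B$ there is $A'=\{a_1',\dots,a_m'\}$ with $\mathrm{tp}(a_1',\dots,a_m'/C)=\mathrm{tp}(a_1,\dots,a_m/C)$ and $A'\mathop{\smile\!\!\!\!\!\!|}_C B$; (5) monotonicity: if $B\subseteq C\subseteq D$ and $A\mathop{\smile\!\!\!\!\!\!|}_B D$ then $A\mathop{\smile\!\!\!\!\!\!|}_B C$ and $A\mathop{\smile\!\!\!\!\!\!|}_C D$; (6) transitivity: if $B\subseteq C\subseteq D$, $A\mathop{\smile\!\!\!\!\!\!|}_B C$ and $A\mathop{\smile\!\!\!\!\!\!|}_C D$ then $A\mathop{\smile\!\!\!\!\!\!|}_B D$; (7) symmetry: for finite $A,B$ and any $C$, $A\mathop{\smile\!\!\!\!\!\!|}_C B$ iff $B\mathop{\smile\!\!\!\!\!\!|}_C A$. *)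

theory Defs
  imports "HOL-Library.Countable_Set"
begin

section \<open>First-order logic\<close>

record ('f, 'r) lang =
  funs :: "'f set"
  rels :: "'r set"
  farity :: "'f \<Rightarrow> nat"
  rarity :: "'r \<Rightarrow> nat"

definition countable_lang :: "('f, 'r) lang \<Rightarrow> bool" where
  "countable_lang L \<longleftrightarrow> countable (funs L) \<and> countable (rels L)"

datatype 'f tm = Var nat | App 'f "'f tm list"

datatype ('f, 'r) fm =
    Eq "'f tm" "'f tm"
  | Rel 'r "'f tm list"
  | Neg "('f, 'r) fm"
  | Conj "('f, 'r) fm" "('f, 'r) fm"
  | Exi nat "('f, 'r) fm"

primrec fv_tm :: "'f tm \<Rightarrow> nat set" where
  "fv_tm (Var i) = {i}"
| "fv_tm (App f ts) = \<Union> (set (map fv_tm ts))"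

primrec fv :: "('f, 'r) fm \<Rightarrow> nat set" where
  "fv (Eq s t) = fv_tm s \<union> fv_tm t"
| "fv (Rel r ts) = \<Union> (set (map fv_tm ts))"
| "fv (Neg \<phi>) = fv \<phi>"
| "fv (Conj \<phi> \<psi>) = fv \<phi> \<union> fv \<psi>"
| "fv (Exi i \<phi>) = fv \<phi> - {i}"

primrec wf_tm :: "('f, 'r) lang \<Rightarrow> 'f tm \<Rightarrow> bool" where
  "wf_tm L (Var i) \<longleftrightarrow> True"
| "wf_tm L (App f ts) \<longleftrightarrow>
     f \<in> funs L \<and> length ts = farity L f \<and> list_all id (map (wf_tm L) ts)"

primrec wf_fm :: "('f, 'r) lang \<Rightarrow> ('f, 'r) fm \<Rightarrow> bool" where
  "wf_fm L (Eq s t) \<longleftrightarrow> wf_tm L s \<and> wf_tm L t"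
| "wf_fm L (Rel r ts) \<longleftrightarrow> r \<in> rels L \<and> length ts = rarity L r \<and> list_all (wf_tm L) ts"
| "wf_fm L (Neg \<phi>) \<longleftrightarrow> wf_fm L \<phi>"
| "wf_fm L (Conj \<phi> \<psi>) \<longleftrightarrow> wf_fm L \<phi> \<and> wf_fm L \<psi>"
| "wf_fm L (Exi i \<phi>) \<longleftrightarrow> wf_fm L \<phi>"

definition sentences :: "('f, 'r) lang \<Rightarrow> ('f, 'r) fm set" where
  "sentences L = {\<phi>. wf_fm L \<phi> \<and> fv \<phi> = {}}"

record ('f, 'r, 'm) struct =
  univ :: "'m set"
  fint :: "'f \<Rightarrow> 'm list \<Rightarrow> 'm"
  rint :: "'r \<Rightarrow> 'm list \<Rightarrow> bool"

definition tuples :: "'m set \<Rightarrow> nat \<Rightarrow> 'm list set" where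
  "tuples U k = {xs. length xs = k \<and> set xs \<subseteq> U}"

definition is_struct :: "('f, 'r) lang \<Rightarrow> ('f, 'r, 'm) struct \<Rightarrow> bool" where
  "is_struct L M \<longleftrightarrow> univ M \<noteq> {} \<and>
     (\<forall>f \<in> funs L. \<forall>xs \<in> tuples (univ M) (farity L f). fint M f xs \<in> univ M)"

primrec eval :: "('f, 'r, 'm) struct \<Rightarrow> (nat \<Rightarrow> 'm) \<Rightarrow> 'f tm \<Rightarrow> 'm" where
  "eval M e (Var i) = e i"
| "eval M e (App f ts) = fint M f (map (eval M e) ts)"

primrec sat :: "('f, 'r, 'm) struct \<Rightarrow> (nat \<Rightarrow> 'm) \<Rightarrow> ('f, 'r) fm \<Rightarrow> bool" where
  "sat M e (Eq s t) \<longleftrightarrow> eval M e s = eval M e t"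
| "sat M e (Rel r ts) \<longleftrightarrow> rint M r (map (eval M e) ts)"
| "sat M e (Neg \<phi>) \<longleftrightarrow> \<not> sat M e \<phi>"
| "sat M e (Conj \<phi> \<psi>) \<longleftrightarrow> sat M e \<phi> \<and> sat M e \<psi>"
| "sat M e (Exi i \<phi>) \<longleftrightarrow> (\<exists>x \<in> univ M. sat M (e(i := x)) \<phi>)"

definition is_model :: "('f, 'r) lang \<Rightarrow> ('f, 'r, 'm) struct \<Rightarrow> ('f, 'r) fm set \<Rightarrow> bool" where
  "is_model L M T \<longleftrightarrow> is_struct L M \<and> (\<forall>\<phi> \<in> T. \<forall>e. range e \<subseteq> univ M \<longrightarrow> sat M e \<phi>)"

definition isomorphic ::
  "('f, 'r) lang \<Rightarrow> ('f, 'r, 'm) struct \<Rightarrow> ('f, 'r, 'n) struct \<Rightarrow> bool" where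
  "isomorphic L M N \<longleftrightarrow> (\<exists>h. bij_betw h (univ M) (univ N) \<and>
     (\<forall>f \<in> funs L. \<forall>xs \<in> tuples (univ M) (farity L f). h (fint M f xs) = fint N f (map h xs)) \<and>
     (\<forall>r \<in> rels L. \<forall>xs \<in> tuples (univ M) (rarity L r). rint M r xs \<longleftrightarrow> rint N r (map h xs)))"

text \<open>HOL cannot quantify over models on all types. Models whose universe is a set of natural
  numbers are, up to isomorphism, all the countable ones; by the downward Loewenheim-Skolem
  theorem they suffice to determine logical consequence in a countable language.\<close>

definition entails :: "('f, 'r) lang \<Rightarrow> ('f, 'r) fm set \<Rightarrow> ('f, 'r) fm \<Rightarrow> bool" where
  "entails L T \<phi> \<longleftrightarrow> (\<forall>S :: ('f, 'r, nat) struct. is_model L S T \<longrightarrow> is_model L S {\<phi>})"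

definition complete_theory :: "('f, 'r) lang \<Rightarrow> ('f, 'r) fm set \<Rightarrow> bool" where
  "complete_theory L T \<longleftrightarrow> T \<subseteq> sentences L \<and>
     (\<exists>S :: ('f, 'r, nat) struct. is_model L S T) \<and>
     (\<forall>\<phi> \<in> sentences L. entails L T \<phi> \<or> entails L T (Neg \<phi>))"

definition omega_categorical :: "('f, 'r) lang \<Rightarrow> ('f, 'r) fm set \<Rightarrow> bool" where
  "omega_categorical L T \<longleftrightarrow>
     (\<exists>S :: ('f, 'r, nat) struct. is_model L S T \<and> infinite (univ S)) \<and>
     (\<forall>(S :: ('f, 'r, nat) struct) (S' :: ('f, 'r, nat) struct).
        is_model L S T \<and> infinite (univ S) \<and> is_model L S' T \<and> infinite (univ S') \<longrightarrow>
        isomorphic L S S')"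

definition small :: "'k rel \<Rightarrow> 'a set \<Rightarrow> bool" where
  "small \<kappa> A \<longleftrightarrow> (card_of A, \<kappa>) \<in> ordLess"

text \<open>A pair of a formula and an assignment stands for a formula in the single free variable 0
  with parameters; the parameters are the values of the assignment at the other free variables.\<close>

definition param_formulas ::
  "('f, 'r) lang \<Rightarrow> 'm set \<Rightarrow> (('f, 'r) fm \<times> (nat \<Rightarrow> 'm)) set" where
  "param_formulas L A = {(\<phi>, e). wf_fm L \<phi> \<and> e ` (fv \<phi> - {0}) \<subseteq> A}"

definition realizes ::
  "('f, 'r, 'm) struct \<Rightarrow> 'm \<Rightarrow> (('f, 'r) fm \<times> (nat \<Rightarrow> 'm)) set \<Rightarrow> bool" where
  "realizes M b \<Gamma> \<longleftrightarrow> (\<forall>(\<phi>, e) \<in> \<Gamma>. sat M (e(0 := b)) \<phi>)"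

definition saturated :: "('f, 'r) lang \<Rightarrow> 'k rel \<Rightarrow> ('f, 'r, 'm) struct \<Rightarrow> bool" where
  "saturated L \<kappa> M \<longleftrightarrow>
     (\<forall>A \<Gamma>. A \<subseteq> univ M \<and> small \<kappa> A \<and> \<Gamma> \<subseteq> param_formulas L A \<and>
        (\<forall>\<Gamma>\<^sub>0. finite \<Gamma>\<^sub>0 \<and> \<Gamma>\<^sub>0 \<subseteq> \<Gamma> \<longrightarrow> (\<exists>b \<in> univ M. realizes M b \<Gamma>\<^sub>0)) \<longrightarrow>
        (\<exists>b \<in> univ M. realizes M b \<Gamma>))"

text \<open>In a type over \<open>B\<close> the first \<open>length as\<close> variables stand for the tuple and the
  following ones for the parameters \<open>bs\<close>.\<close>

definition tp ::
  "('f, 'r) lang \<Rightarrow> ('f, 'r, 'm) struct \<Rightarrow> 'm list \<Rightarrow> 'm set \<Rightarrow> (('f, 'r) fm \<times> 'm list) set" where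
  "tp L M as B = {(\<phi>, bs). wf_fm L \<phi> \<and> set bs \<subseteq> B \<and> fv \<phi> \<subseteq> {..<length as + length bs} \<and>
     sat M ((!) (as @ bs)) \<phi>}"

definition acl :: "('f, 'r) lang \<Rightarrow> ('f, 'r, 'm) struct \<Rightarrow> 'm set \<Rightarrow> 'm set" where
  "acl L M B = {a \<in> univ M. \<exists>\<phi> bs. wf_fm L \<phi> \<and> set bs \<subseteq> B \<and> fv \<phi> \<subseteq> {..<Suc (length bs)} \<and>
     sat M ((!) (a # bs)) \<phi> \<and> finite {x \<in> univ M. sat M ((!) (x # bs)) \<phi>}}"

definition elementary_map ::
  "('f, 'r) lang \<Rightarrow> ('f, 'r, 'm) struct \<Rightarrow> 'm set \<Rightarrow> ('m \<Rightarrow> 'm) \<Rightarrow> bool" where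
  "elementary_map L M S \<sigma> \<longleftrightarrow> S \<subseteq> univ M \<and> inj_on \<sigma> S \<and> \<sigma> ` S \<subseteq> univ M \<and>
     (\<forall>as. set as \<subseteq> S \<longrightarrow> tp L M as {} = tp L M (map \<sigma> as) {})"


section \<open>Imaginaries\<close>

definition def_equivs :: "('f, 'r) lang \<Rightarrow> ('f, 'r, 'm) struct \<Rightarrow> nat \<Rightarrow> 'm list rel set" where
  "def_equivs L M k = {E. equiv (tuples (univ M) k) E \<and>
     (\<exists>\<phi>. wf_fm L \<phi> \<and> fv \<phi> \<subseteq> {..<k + k} \<and>
        E = {(xs, ys). xs \<in> tuples (univ M) k \<and> ys \<in> tuples (univ M) k \<and>
             sat M ((!) (xs @ ys)) \<phi>})}"

text \<open>An imaginary carries its equivalence relation, so that different relations give disjoint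
  sorts.\<close>

datatype 'm imag = Home 'm | Class "'m list rel" "'m list set"

definition imaginaries :: "('f, 'r) lang \<Rightarrow> ('f, 'r, 'm) struct \<Rightarrow> nat \<Rightarrow> 'm imag set" where
  "imaginaries L M k = {Class E C | E C. E \<in> def_equivs L M k \<and> C \<in> tuples (univ M) k // E}"

primrec level :: "('f, 'r) lang \<Rightarrow> ('f, 'r, 'm) struct \<Rightarrow> nat \<Rightarrow> 'm imag set" where
  "level L M 0 = Home ` univ M"
| "level L M (Suc k) = level L M k \<union> imaginaries L M (Suc k)"

text \<open>The imaginary expansion is one-sorted and relational: the symbols of the original language
  live on the home sort (function symbols through their graphs), and each definable equivalence
  relation contributes a predicate for its sort and the graph of the projection onto it.\<close>

datatype ('f, 'r, 'm) eq_sym =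
    FunGraph 'f
  | OldRel 'r
  | SortOf "'m list rel"
  | Proj nat "'m list rel"

definition eq_lang ::
  "('f, 'r) lang \<Rightarrow> ('f, 'r, 'm) struct \<Rightarrow> (unit, ('f, 'r, 'm) eq_sym) lang" where
  "eq_lang L M = \<lparr>
     funs = {},
     rels = FunGraph ` funs L \<union> OldRel ` rels L \<union>
       (\<Union>k \<in> {1..}. \<Union>E \<in> def_equivs L M k. {SortOf E, Proj k E}),
     farity = (\<lambda>_. 0),
     rarity = (\<lambda>s. case s of FunGraph f \<Rightarrow> Suc (farity L f) | OldRel r \<Rightarrow> rarity L r
       | SortOf E \<Rightarrow> 1 | Proj k E \<Rightarrow> Suc k)\<rparr>"

definition eq_struct ::
  "('f, 'r) lang \<Rightarrow> ('f, 'r, 'm) struct \<Rightarrow> (unit, ('f, 'r, 'm) eq_sym, 'm imag) struct" where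
  "eq_struct L M = \<lparr>
     univ = Home ` univ M \<union> (\<Union>k \<in> {1..}. imaginaries L M k),
     fint = (\<lambda>_ _. undefined),
     rint = (\<lambda>s xs. case s of
         FunGraph f \<Rightarrow> \<exists>as \<in> tuples (univ M) (farity L f). xs = map Home (as @ [fint M f as])
       | OldRel r \<Rightarrow> \<exists>as \<in> tuples (univ M) (rarity L r). rint M r as \<and> xs = map Home as
       | SortOf E \<Rightarrow> \<exists>C. xs = [Class E C]
       | Proj k E \<Rightarrow> \<exists>as \<in> tuples (univ M) k. xs = map Home as @ [Class E (E `` {as})])\<rparr>"

abbreviation univ_eq :: "('f, 'r) lang \<Rightarrow> ('f, 'r, 'm) struct \<Rightarrow> 'm imag set" where
  "univ_eq L M \<equiv> univ (eq_struct L M)"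

abbreviation tp_eq where
  "tp_eq L M \<equiv> tp (eq_lang L M) (eq_struct L M)"

abbreviation acl_eq :: "('f, 'r) lang \<Rightarrow> ('f, 'r, 'm) struct \<Rightarrow> 'm imag set \<Rightarrow> 'm imag set" where
  "acl_eq L M \<equiv> acl (eq_lang L M) (eq_struct L M)"

definition acl_level ::
  "('f, 'r) lang \<Rightarrow> ('f, 'r, 'm) struct \<Rightarrow> nat \<Rightarrow> 'm imag set \<Rightarrow> 'm imag set" where
  "acl_level L M n A = acl_eq L M A \<inter> level L M n"


section \<open>Ordinals and rank\<close>

text \<open>\<open>'a ordinal\<close> is the initial segment of the ordinals below the cardinal of the power set of
  \<open>'a + nat\<close>. As \<open>rank_ge\<close> below adds elements of \<open>'a\<close> one at a time to the base set, the ordinal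
  ranks that occur are all smaller than the successor cardinal of \<open>'a + nat\<close>.\<close>

typedef 'a ordinal = "UNIV :: ('a + nat) set set" ..

instantiation ordinal :: (type) wellorder
begin

definition less_eq_ordinal :: "'a ordinal \<Rightarrow> 'a ordinal \<Rightarrow> bool" where
  "\<alpha> \<le> \<beta> \<longleftrightarrow> (Rep_ordinal \<alpha>, Rep_ordinal \<beta>) \<in> card_of UNIV"

definition less_ordinal :: "'a ordinal \<Rightarrow> 'a ordinal \<Rightarrow> bool" where
  "\<alpha> < \<beta> \<longleftrightarrow> \<alpha> \<le> \<beta> \<and> \<not> \<beta> \<le> (\<alpha> :: 'a ordinal)"

instance
proof
  let ?r = "card_of (UNIV :: ('a + nat) set set)"
  have wo: "wo_rel ?r"
    using card_of_Well_order by (simp add: wo_rel_def)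
  have fld: "Field ?r = UNIV" by (simp add: Field_card_of)
  fix \<alpha> \<beta> \<gamma> :: "'a ordinal"
  show "\<alpha> < \<beta> \<longleftrightarrow> \<alpha> \<le> \<beta> \<and> \<not> \<beta> \<le> \<alpha>" by (rule less_ordinal_def)
  show "\<alpha> \<le> \<alpha>"
    using wo_rel.REFL[OF wo] fld by (simp add: less_eq_ordinal_def refl_on_def)
  show "\<alpha> \<le> \<beta> \<Longrightarrow> \<beta> \<le> \<gamma> \<Longrightarrow> \<alpha> \<le> \<gamma>"
    unfolding less_eq_ordinal_def using wo_rel.TRANS[OF wo] by (rule transD)
  show antisym: "\<alpha> \<le> \<beta> \<Longrightarrow> \<beta> \<le> \<alpha> \<Longrightarrow> \<alpha> = \<beta>" for \<alpha> \<beta> :: "'a ordinal"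
    unfolding less_eq_ordinal_def using wo_rel.ANTISYM[OF wo]
    by (meson Rep_ordinal_inject antisymD)
  show "\<alpha> \<le> \<beta> \<or> \<beta> \<le> \<alpha>"
    unfolding less_eq_ordinal_def using wo_rel.TOTALS[OF wo] fld by simp
  fix P :: "'a ordinal \<Rightarrow> bool" and \<delta> :: "'a ordinal"
  assume step: "\<And>\<alpha>. (\<And>\<beta>. \<beta> < \<alpha> \<Longrightarrow> P \<beta>) \<Longrightarrow> P \<alpha>"
  have "P (Abs_ordinal X)" for X
  proof (induction X rule: wo_rel.well_order_induct[OF wo])
    case (1 X)
    show ?case
    proof (rule step)
      fix \<beta> assume lt: "\<beta> < Abs_ordinal X"
      then have "(Rep_ordinal \<beta>, X) \<in> ?r" "Rep_ordinal \<beta> \<noteq> X"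
        by (auto simp: less_ordinal_def less_eq_ordinal_def Abs_ordinal_inverse)
      then show "P \<beta>" using 1[rule_format, of "Rep_ordinal \<beta>"] by (simp add: Rep_ordinal_inverse)
    qed
  qed
  from this[of "Rep_ordinal \<delta>"] show "P \<delta>" by (simp add: Rep_ordinal_inverse)
qed

end

instance ordinal :: (type) no_top
proof
  fix \<alpha> :: "'a ordinal"
  have "infinite (UNIV :: ('a + nat) set set)" by (simp add: Finite_Set.finite_set)
  then obtain X where "Rep_ordinal \<alpha> \<noteq> X" "(Rep_ordinal \<alpha>, X) \<in> card_of UNIV"
    using infinite_Card_order_limit[OF card_of_Card_order, of UNIV "Rep_ordinal \<alpha>"]
    by (auto simp: Field_card_of)
  then have "\<alpha> \<le> Abs_ordinal X" "\<alpha> \<noteq> Abs_ordinal X"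
    by (auto simp: less_eq_ordinal_def Abs_ordinal_inverse)
  then show "\<exists>\<beta>. \<alpha> < \<beta>" by (meson order.not_eq_order_implies_strict)
qed

definition ord_zero :: "'o::wellorder" where
  "ord_zero = (LEAST \<alpha>. True)"

definition ord_succ :: "'o::wellorder \<Rightarrow> 'o" where
  "ord_succ \<alpha> = (LEAST \<beta>. \<alpha> < \<beta>)"

definition ord_limit :: "'o::wellorder \<Rightarrow> bool" where
  "ord_limit \<alpha> \<longleftrightarrow> \<alpha> \<noteq> ord_zero \<and> (\<forall>\<beta> < \<alpha>. ord_succ \<beta> < \<alpha>)"

inductive rank_ge ::
  "('a set \<Rightarrow> 'a set) \<Rightarrow> 'a set \<Rightarrow> 'a set \<Rightarrow> 'o::wellorder \<Rightarrow> bool" for cl A where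
  zero: "rank_ge cl A B ord_zero"
| succ: "a \<in> cl A - cl B \<Longrightarrow> rank_ge cl A ({a} \<union> B) \<alpha> \<Longrightarrow> rank_ge cl A B (ord_succ \<alpha>)"
| limit: "ord_limit \<alpha> \<Longrightarrow> (\<And>\<beta>. \<beta> < \<alpha> \<Longrightarrow> rank_ge cl A B \<beta>) \<Longrightarrow> rank_ge cl A B \<alpha>"

lemma less_ord_succ: "(\<alpha> :: 'o::{wellorder, no_top}) < ord_succ \<alpha>"
  unfolding ord_succ_def using gt_ex by (rule LeastI_ex)

lemma ord_zero_le: "ord_zero \<le> \<alpha>"
  unfolding ord_zero_def by (simp add: Least_le)

lemma ord_succ_eq_iff: "ord_succ \<alpha> = ord_succ \<beta> \<longleftrightarrow> (\<alpha> :: 'o::{wellorder, no_top}) = \<beta>"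
proof -
  have "\<alpha> < \<beta> \<Longrightarrow> ord_succ \<alpha> < ord_succ \<beta>" for \<alpha> \<beta> :: 'o
    using Least_le[of "(<) \<alpha>" \<beta>] less_ord_succ[of \<beta>] unfolding ord_succ_def by simp
  then show ?thesis by (metis less_irrefl linorder_less_linear)
qed

lemma ord_succ_neq_zero: "ord_succ (\<alpha> :: 'o::{wellorder, no_top}) \<noteq> ord_zero"
  using less_ord_succ[of \<alpha>] ord_zero_le[of \<alpha>] by auto

lemma not_ord_limit_succ: "\<not> ord_limit (ord_succ (\<alpha> :: 'o::{wellorder, no_top}))"
  using less_ord_succ[of \<alpha>] unfolding ord_limit_def by blast

lemma rank_ge_succ_iff:
  "rank_ge cl A B (ord_succ (\<alpha> :: 'o::{wellorder, no_top})) \<longleftrightarrow>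
     (\<exists>a \<in> cl A - cl B. rank_ge cl A ({a} \<union> B) \<alpha>)"
  by (subst rank_ge.simps)
    (auto simp: ord_succ_neq_zero ord_succ_eq_iff not_ord_limit_succ)

lemma rank_ge_limit_iff:
  "ord_limit (\<alpha> :: 'o::{wellorder, no_top}) \<Longrightarrow>
     rank_ge cl A B \<alpha> \<longleftrightarrow> (\<forall>\<beta> < \<alpha>. rank_ge cl A B \<beta>)"
  by (subst rank_ge.simps) (use not_ord_limit_succ in \<open>auto simp: ord_limit_def[of ord_zero]\<close>)

definition has_rank ::
  "('f, 'r) lang \<Rightarrow> ('f, 'r, 'm) struct \<Rightarrow> nat \<Rightarrow> 'm imag set \<Rightarrow> 'm imag set \<Rightarrow>
    'm imag ordinal \<Rightarrow> bool" where
  "has_rank L M n A B \<alpha> \<longleftrightarrow>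
     rank_ge (acl_level L M n) A B \<alpha> \<and> \<not> rank_ge (acl_level L M n) A B (ord_succ \<alpha>)"

text \<open>The value \<open>None\<close> means that the rank is at least every ordinal.\<close>

definition rk ::
  "('f, 'r) lang \<Rightarrow> ('f, 'r, 'm) struct \<Rightarrow> nat \<Rightarrow> 'm imag set \<Rightarrow> 'm imag set \<Rightarrow>
    'm imag ordinal option" where
  "rk L M n A B =
     (if \<exists>\<alpha>. has_rank L M n A B \<alpha> then Some (THE \<alpha>. has_rank L M n A B \<alpha>) else None)"


section \<open>Independence\<close>

text \<open>In \<open>ind A B C\<close> the last argument is the base: \<open>A\<close> is independent from \<open>B\<close> over \<open>C\<close>.\<close>

definition n_indep ::
  "('f, 'r) lang \<Rightarrow> ('f, 'r, 'm) struct \<Rightarrow> nat \<Rightarrow>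
    'm imag set \<Rightarrow> 'm imag set \<Rightarrow> 'm imag set \<Rightarrow> bool" where
  "n_indep L M n A B C \<longleftrightarrow>
     (\<forall>A'. finite A' \<and> A' \<subseteq> A \<longrightarrow> rk L M n A' (B \<union> C) = rk L M n A' C)"

definition exchange_property ::
  "('f, 'r) lang \<Rightarrow> ('f, 'r, 'm) struct \<Rightarrow> 'k rel \<Rightarrow> nat \<Rightarrow> bool" where
  "exchange_property L M \<kappa> n \<longleftrightarrow>
     (\<forall>C k (a :: nat \<Rightarrow> 'm imag).
        C \<subseteq> univ_eq L M \<and> small \<kappa> C \<and> 2 \<le> k \<and> a ` {1..k} \<subseteq> level L M n \<and>
        (\<forall>i \<in> {1..k}. rk L M n {a i} C = Some (ord_succ ord_zero)) \<and>
        a k \<in> acl_eq L M (a ` {1..k - 1} \<union> C) - acl_eq L M (a ` {2..k - 1} \<union> C) \<longrightarrow>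
        a 1 \<in> acl_eq L M (a ` {2..k} \<union> C))"

definition small_in_level ::
  "('f, 'r) lang \<Rightarrow> ('f, 'r, 'm) struct \<Rightarrow> 'k rel \<Rightarrow> nat \<Rightarrow> 'm imag set \<Rightarrow> bool" where
  "small_in_level L M \<kappa> n A \<longleftrightarrow> A \<subseteq> level L M n \<and> small \<kappa> A"

definition ind_invariance ::
  "('f, 'r) lang \<Rightarrow> ('f, 'r, 'm) struct \<Rightarrow> 'k rel \<Rightarrow> nat \<Rightarrow>
    ('m imag set \<Rightarrow> 'm imag set \<Rightarrow> 'm imag set \<Rightarrow> bool) \<Rightarrow> bool" where
  "ind_invariance L M \<kappa> n ind \<longleftrightarrow>
     (\<forall>A B C S \<sigma>. finite A \<and> small_in_level L M \<kappa> n A \<and> small_in_level L M \<kappa> n B \<and>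
        small_in_level L M \<kappa> n C \<and> elementary_map (eq_lang L M) (eq_struct L M) S \<sigma> \<and>
        A \<union> B \<union> C \<subseteq> S \<longrightarrow>
        (ind A B C \<longleftrightarrow> ind (\<sigma> ` A) (\<sigma> ` B) (\<sigma> ` C)))"

definition ind_local_character ::
  "('f, 'r) lang \<Rightarrow> ('f, 'r, 'm) struct \<Rightarrow> 'k rel \<Rightarrow> nat \<Rightarrow>
    ('m imag set \<Rightarrow> 'm imag set \<Rightarrow> 'm imag set \<Rightarrow> bool) \<Rightarrow> bool" where
  "ind_local_character L M \<kappa> n ind \<longleftrightarrow>
     (\<forall>A B. finite A \<and> small_in_level L M \<kappa> n A \<and> small_in_level L M \<kappa> n B \<longrightarrow>
        (\<exists>C \<subseteq> B. countable C \<and> ind A B C))"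

definition ind_finite_character ::
  "('f, 'r) lang \<Rightarrow> ('f, 'r, 'm) struct \<Rightarrow> 'k rel \<Rightarrow> nat \<Rightarrow>
    ('m imag set \<Rightarrow> 'm imag set \<Rightarrow> 'm imag set \<Rightarrow> bool) \<Rightarrow> bool" where
  "ind_finite_character L M \<kappa> n ind \<longleftrightarrow>
     (\<forall>A B C. finite A \<and> small_in_level L M \<kappa> n A \<and> small_in_level L M \<kappa> n B \<and>
        small_in_level L M \<kappa> n C \<longrightarrow>
        (ind A B C \<longleftrightarrow> (\<forall>B'. finite B' \<and> B' \<subseteq> B \<longrightarrow> ind A B' C)))"

definition ind_extension ::
  "('f, 'r) lang \<Rightarrow> ('f, 'r, 'm) struct \<Rightarrow> 'k rel \<Rightarrow> nat \<Rightarrow>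
    ('m imag set \<Rightarrow> 'm imag set \<Rightarrow> 'm imag set \<Rightarrow> bool) \<Rightarrow> bool" where
  "ind_extension L M \<kappa> n ind \<longleftrightarrow>
     (\<forall>as B C. small_in_level L M \<kappa> n (set as) \<and> small_in_level L M \<kappa> n B \<and> C \<subseteq> B \<longrightarrow>
        (\<exists>as'. length as' = length as \<and> set as' \<subseteq> univ_eq L M \<and>
           tp_eq L M as' C = tp_eq L M as C \<and> ind (set as') B C))"

definition ind_monotonicity ::
  "('f, 'r) lang \<Rightarrow> ('f, 'r, 'm) struct \<Rightarrow> 'k rel \<Rightarrow> nat \<Rightarrow>
    ('m imag set \<Rightarrow> 'm imag set \<Rightarrow> 'm imag set \<Rightarrow> bool) \<Rightarrow> bool" where
  "ind_monotonicity L M \<kappa> n ind \<longleftrightarrow>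
     (\<forall>A B C D. finite A \<and> small_in_level L M \<kappa> n A \<and> small_in_level L M \<kappa> n D \<and>
        B \<subseteq> C \<and> C \<subseteq> D \<and> ind A D B \<longrightarrow> ind A C B \<and> ind A D C)"

definition ind_transitivity ::
  "('f, 'r) lang \<Rightarrow> ('f, 'r, 'm) struct \<Rightarrow> 'k rel \<Rightarrow> nat \<Rightarrow>
    ('m imag set \<Rightarrow> 'm imag set \<Rightarrow> 'm imag set \<Rightarrow> bool) \<Rightarrow> bool" where
  "ind_transitivity L M \<kappa> n ind \<longleftrightarrow>
     (\<forall>A B C D. finite A \<and> small_in_level L M \<kappa> n A \<and> small_in_level L M \<kappa> n D \<and>
        B \<subseteq> C \<and> C \<subseteq> D \<and> ind A C B \<and> ind A D C \<longrightarrow> ind A D B)"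

definition ind_symmetry ::
  "('f, 'r) lang \<Rightarrow> ('f, 'r, 'm) struct \<Rightarrow> 'k rel \<Rightarrow> nat \<Rightarrow>
    ('m imag set \<Rightarrow> 'm imag set \<Rightarrow> 'm imag set \<Rightarrow> bool) \<Rightarrow> bool" where
  "ind_symmetry L M \<kappa> n ind \<longleftrightarrow>
     (\<forall>A B C. finite A \<and> finite B \<and> small_in_level L M \<kappa> n A \<and> small_in_level L M \<kappa> n B \<and>
        small_in_level L M \<kappa> n C \<longrightarrow> (ind A B C \<longleftrightarrow> ind B A C))"

definition independence_relation ::
  "('f, 'r) lang \<Rightarrow> ('f, 'r, 'm) struct \<Rightarrow> 'k rel \<Rightarrow> nat \<Rightarrow>
    ('m imag set \<Rightarrow> 'm imag set \<Rightarrow> 'm imag set \<Rightarrow> bool) \<Rightarrow> bool" where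
  "independence_relation L M \<kappa> n ind \<longleftrightarrow>
     ind_invariance L M \<kappa> n ind \<and>
     ind_local_character L M \<kappa> n ind \<and>
     ind_finite_character L M \<kappa> n ind \<and>
     ind_extension L M \<kappa> n ind \<and>
     ind_monotonicity L M \<kappa> n ind \<and>
     ind_transitivity L M \<kappa> n ind \<and>
     ind_symmetry L M \<kappa> n ind"

end

theory Submission
  imports Defs
begin

text \<open>By omega-categoricity there are only finitely many types of tuples in every level: a
  non-isolated type would be realized in one countable model and omitted in another, and both can be
  found as elementary substructures of the saturated model. The type in the imaginary expansion of a
  tuple of imaginaries is determined by the type of representing tuples in the home sort, by a
  back-and-forth argument. Hence algebraic closure inside a level is a closure operator under which
  finite sets have finite closure, the rank of a finite set is a natural number, namely the maximal
  length of an independent sequence, and it depends only on a finite part of the base.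

  Exchange for rank one elements gives additivity of the rank,
  \<open>rk (A \<union> B / C) = rk (B / C) + rk (A / B \<union> C)\<close>, and symmetry follows from it. Extension is proved
  by moving a longest independent sequence, element by element, off the finite closure of finitely
  many parameters, and then using saturation.\<close>

section \<open>Formulas up to semantic equivalence\<close>

text \<open>The structure is saturated but not assumed strongly homogeneous, so there are no
  automorphisms to move tuples with. Their place is taken by finite tuples of equal type: when there
  are finitely many types, each is isolated, and a type-preserving map between finite tuples extends
  to one more element, in the home sort as well as in a level. Saturation, too, is given for the
  home structure only; a condition on imaginaries reaches it by being invariant under the types of
  representatives, hence definable.

  Additivity is a Jordan-Hoelder phenomenon. Below every non-algebraic element there is one of rank
  one, because closures of single elements are finite. Exchange makes two rank-one elements either
  interalgebraic over the base or of rank one over the base with the other, so it does not matter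
  which of them begins a longest sequence.

  Independence is tested on all finite subsets of the left side, whereas symmetry and extension
  first yield an equality of ranks for the whole left side; additivity is used once more to descend
  to subsets.\<close>

lemma eval_cong: "(\<And>i. i \<in> fv_tm t \<Longrightarrow> e i = e' i) \<Longrightarrow> eval M e t = eval M e' t"
proof (induction t)
  case (App g ts)
  then have "map (eval M e) ts = map (eval M e') ts" by auto
  then show ?case by (simp only: eval.simps)
qed simp

lemma sat_cong: "(\<And>i. i \<in> fv \<phi> \<Longrightarrow> e i = e' i) \<Longrightarrow> sat M e \<phi> = sat M e' \<phi>"
proof (induction \<phi> arbitrary: e e')
  case (Eq s t)
  have "eval M e s = eval M e' s" "eval M e t = eval M e' t"
    using Eq by (auto intro: eval_cong)
  then show ?case by simp
next
  case (Rel r ts)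
  have "map (eval M e) ts = map (eval M e') ts"
    using Rel by (auto intro: eval_cong)
  then show ?case by (simp only: sat.simps)
next
  case (Exi i \<phi>)
  have "sat M (e(i := x)) \<phi> = sat M (e'(i := x)) \<phi>" for x
    using Exi.prems by (intro Exi.IH) auto
  then show ?case by simp
next
  case (Conj \<phi> \<psi>)
  have "sat M e \<phi> = sat M e' \<phi>" "sat M e \<psi> = sat M e' \<psi>"
    using Conj.IH[of e e'] Conj.prems by auto
  then show ?case by simp
next
  case (Neg \<phi>)
  have "sat M e \<phi> = sat M e' \<phi>" using Neg.prems by (intro Neg.IH) simp
  then show ?case by simp
qed

lemma finite_fv_tm: "finite (fv_tm t)"
  by (induction t) auto

lemma finite_fv: "finite (fv \<phi>)"
  by (induction \<phi>) (auto simp: finite_fv_tm)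

section \<open>Renaming of variables\<close>

primrec rename_tm :: "(nat \<Rightarrow> nat) \<Rightarrow> 'f tm \<Rightarrow> 'f tm" where
  "rename_tm f (Var i) = Var (f i)"
| "rename_tm f (App g ts) = App g (map (rename_tm f) ts)"

lemma fv_rename_tm: "fv_tm (rename_tm f t) = f ` fv_tm t"
  by (induction t) auto

lemma wf_rename_tm: "wf_tm L t \<Longrightarrow> wf_tm L (rename_tm f t)"
  by (induction t) (auto simp: list_all_iff)

lemma eval_rename_tm: "eval M e (rename_tm f t) = eval M (\<lambda>i. e (f i)) t"
proof (induction t)
  case (App g ts)
  then have "map (eval M e \<circ> rename_tm f) ts = map (eval M (\<lambda>i. e (f i))) ts" by simp
  then show ?case by (simp only: eval.simps rename_tm.simps map_map)
qed simp

text \<open>An existence statement instead of a recursive renaming, because \<open>f\<close> may be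
  non-injective and may capture: a bound variable has to move to some \<open>j\<close> outside the
  image of \<open>fv \<phi>\<close> under \<open>f\<close>. The induction generalizes over
  \<open>f\<close> for the same reason.\<close>

lemma rename_ex:
  fixes L :: "('f, 'r) lang"
  assumes "wf_fm L \<phi>"
  shows "\<exists>\<psi>. wf_fm L \<psi> \<and> fv \<psi> \<subseteq> f ` fv \<phi> \<and>
    (\<forall>(M :: ('f, 'r, 'm) struct) e. sat M e \<psi> = sat M (\<lambda>i. e (f i)) \<phi>)"
  using assms
proof (induction \<phi> arbitrary: f)
  case (Eq s t)
  show ?case
    by (rule exI[of _ "Eq (rename_tm f s) (rename_tm f t)"])
      (use Eq in \<open>auto simp: fv_rename_tm wf_rename_tm eval_rename_tm\<close>)
next
  case (Rel r ts)
  have "map (eval M e \<circ> rename_tm f) ts = map (eval M (\<lambda>i. e (f i))) ts"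
    for M :: "('f, 'r, 'm) struct" and e
    by (simp add: eval_rename_tm)
  then have "sat M e (Rel r (map (rename_tm f) ts)) = sat M (\<lambda>i. e (f i)) (Rel r ts)"
    for M :: "('f, 'r, 'm) struct" and e
    by (simp only: sat.simps map_map)
  moreover have "wf_fm L (Rel r (map (rename_tm f) ts))"
    using Rel by (auto simp: list_all_iff wf_rename_tm)
  moreover have "fv (Rel r (map (rename_tm f) ts)) \<subseteq> f ` fv (Rel r ts)"
    by (auto simp: fv_rename_tm)
  ultimately show ?case by blast
next
  case (Neg \<phi>)
  then have "wf_fm L \<phi>" by simp
  from Neg.IH[OF this, of f] obtain \<psi> where "wf_fm L \<psi>" "fv \<psi> \<subseteq> f ` fv \<phi>"
    "\<forall>(M :: ('f, 'r, 'm) struct) e. sat M e \<psi> = sat M (\<lambda>i. e (f i)) \<phi>" by blast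
  then show ?case by (intro exI[of _ "Neg \<psi>"]) auto
next
  case (Conj \<phi>1 \<phi>2)
  then have wf: "wf_fm L \<phi>1" "wf_fm L \<phi>2" by auto
  from Conj.IH(1)[OF wf(1), of f] obtain \<psi>1 where "wf_fm L \<psi>1" "fv \<psi>1 \<subseteq> f ` fv \<phi>1"
    "\<forall>(M :: ('f, 'r, 'm) struct) e. sat M e \<psi>1 = sat M (\<lambda>i. e (f i)) \<phi>1" by blast
  moreover from Conj.IH(2)[OF wf(2), of f] obtain \<psi>2 where "wf_fm L \<psi>2" "fv \<psi>2 \<subseteq> f ` fv \<phi>2"
    "\<forall>(M :: ('f, 'r, 'm) struct) e. sat M e \<psi>2 = sat M (\<lambda>i. e (f i)) \<phi>2" by blast
  ultimately show ?case by (intro exI[of _ "Conj \<psi>1 \<psi>2"]) auto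
next
  case (Exi i \<phi>)
  then have wf: "wf_fm L \<phi>" by simp
  obtain j where j: "j \<notin> f ` fv \<phi>"
    using ex_new_if_finite[OF infinite_UNIV_nat, of "f ` fv \<phi>"] finite_fv[of \<phi>] by blast
  from Exi.IH[OF wf, of "f(i := j)"] obtain \<psi> where \<psi>: "wf_fm L \<psi>" "fv \<psi> \<subseteq> (f(i := j)) ` fv \<phi>"
    "\<And>(M :: ('f, 'r, 'm) struct) e. sat M e \<psi> = sat M (\<lambda>i'. e ((f(i := j)) i')) \<phi>" by blast
  have "sat M (e(j := x)) \<psi> = sat M ((\<lambda>i. e (f i))(i := x)) \<phi>"
    for M :: "('f, 'r, 'm) struct" and e x
    unfolding \<psi>(3) by (rule sat_cong) (use j in auto)
  moreover have "fv (Exi j \<psi>) \<subseteq> f ` fv (Exi i \<phi>)"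
    using \<psi>(2) j by (auto split: if_splits)
  ultimately show ?case
    using \<psi>(1) by (intro exI[of _ "Exi j \<psi>"]) auto
qed

section \<open>Finite conjunctions, disjunctions and blocks of quantifiers\<close>

lemma conj_ex:
  fixes L :: "('f, 'r) lang"
  assumes "finite F" "\<And>\<phi>. \<phi> \<in> F \<Longrightarrow> wf_fm L \<phi>"
  shows "\<exists>\<chi>. wf_fm L \<chi> \<and> fv \<chi> \<subseteq> \<Union> (fv ` F) \<and>
    (\<forall>(M :: ('f, 'r, 'm) struct) e. sat M e \<chi> \<longleftrightarrow> (\<forall>\<phi> \<in> F. sat M e \<phi>))"
  using assms
proof (induction F)
  case empty
  \<comment> \<open>The empty conjunction must be closed as well as true, hence the sentence that
    nothing differs from itself instead of an equation with a free variable.\<close>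
  show ?case by (rule exI[of _ "Neg (Exi 0 (Neg (Eq (Var 0) (Var 0))))"]) auto
next
  case (insert \<phi> F)
  then obtain \<chi> where "wf_fm L \<chi>" "fv \<chi> \<subseteq> \<Union> (fv ` F)"
    "\<forall>(M :: ('f, 'r, 'm) struct) e. sat M e \<chi> \<longleftrightarrow> (\<forall>\<phi> \<in> F. sat M e \<phi>)" by auto
  then show ?case using insert.prems by (intro exI[of _ "Conj \<phi> \<chi>"]) auto
qed

lemma disj_ex:
  fixes L :: "('f, 'r) lang"
  assumes "finite F" "\<And>\<phi>. \<phi> \<in> F \<Longrightarrow> wf_fm L \<phi>"
  shows "\<exists>\<chi>. wf_fm L \<chi> \<and> fv \<chi> \<subseteq> \<Union> (fv ` F) \<and>
    (\<forall>(M :: ('f, 'r, 'm) struct) e. sat M e \<chi> \<longleftrightarrow> (\<exists>\<phi> \<in> F. sat M e \<phi>))"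
proof -
  have "\<exists>\<chi>. wf_fm L \<chi> \<and> fv \<chi> \<subseteq> \<Union> (fv ` Neg ` F) \<and>
    (\<forall>(M :: ('f, 'r, 'm) struct) e. sat M e \<chi> \<longleftrightarrow> (\<forall>\<phi> \<in> Neg ` F. sat M e \<phi>))"
    using assms by (intro conj_ex) auto
  then obtain \<chi> where "wf_fm L \<chi>" "fv \<chi> \<subseteq> \<Union> (fv ` Neg ` F)"
    "\<forall>(M :: ('f, 'r, 'm) struct) e. sat M e \<chi> \<longleftrightarrow> (\<forall>\<phi> \<in> Neg ` F. sat M e \<phi>)"
    by (elim exE conjE) (rule that; (assumption | erule spec | erule allE, erule spec))
  then show ?thesis by (intro exI[of _ "Neg \<chi>"]) auto
qed

text \<open>The new assignment is confined to the universe on \<open>W\<close> only, because the old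
  one may be something like \<open>(!) ys\<close>, whose values beyond the length of
  \<open>ys\<close> are unspecified.\<close>

lemma exists_block_ex:
  fixes M :: "('f, 'r, 'm) struct"
  assumes "finite W" "wf_fm L \<phi>"
  shows "\<exists>\<chi>. wf_fm L \<chi> \<and> fv \<chi> \<subseteq> fv \<phi> - W \<and>
    (\<forall>e. sat M e \<chi> \<longleftrightarrow> (\<exists>e'. e' ` W \<subseteq> univ M \<and> (\<forall>i. i \<notin> W \<longrightarrow> e' i = e i) \<and> sat M e' \<phi>))"
  using assms
proof (induction W)
  case empty
  have "(\<forall>i. e' i = e i) \<longleftrightarrow> e' = e" for e' e :: "nat \<Rightarrow> 'm" by auto
  then show ?case using empty by (intro exI[of _ \<phi>]) auto
next
  case (insert w W)
  then obtain \<chi> where \<chi>: "wf_fm L \<chi>" "fv \<chi> \<subseteq> fv \<phi> - W"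
    "\<And>e. sat M e \<chi> \<longleftrightarrow> (\<exists>e'. e' ` W \<subseteq> univ M \<and> (\<forall>i. i \<notin> W \<longrightarrow> e' i = e i) \<and> sat M e' \<phi>)"
    by auto
  have "sat M e (Exi w \<chi>) \<longleftrightarrow>
    (\<exists>e'. e' ` insert w W \<subseteq> univ M \<and> (\<forall>i. i \<notin> insert w W \<longrightarrow> e' i = e i) \<and> sat M e' \<phi>)" for e
  proof
    assume "sat M e (Exi w \<chi>)"
    then obtain x e' where "x \<in> univ M" "e' ` W \<subseteq> univ M"
      "\<forall>i. i \<notin> W \<longrightarrow> e' i = (e(w := x)) i" "sat M e' \<phi>"
      by (auto simp: \<chi>(3))
    then show "\<exists>e'. e' ` insert w W \<subseteq> univ M \<and> (\<forall>i. i \<notin> insert w W \<longrightarrow> e' i = e i) \<and> sat M e' \<phi>"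
      using insert.hyps by (intro exI[of _ e']) auto
  next
    assume "\<exists>e'. e' ` insert w W \<subseteq> univ M \<and> (\<forall>i. i \<notin> insert w W \<longrightarrow> e' i = e i) \<and> sat M e' \<phi>"
    then obtain e' where "e' ` insert w W \<subseteq> univ M" "\<forall>i. i \<notin> insert w W \<longrightarrow> e' i = e i" "sat M e' \<phi>"
      by auto
    then show "sat M e (Exi w \<chi>)"
      by (auto simp: \<chi>(3) intro!: bexI[of _ "e' w"] exI[of _ e'])
  qed
  then show ?case using \<chi>(1,2) by (intro exI[of _ "Exi w \<chi>"]) auto
qed

abbreviation assignments :: "('f, 'r, 'm) struct \<Rightarrow> (nat \<Rightarrow> 'm) set" where
  "assignments M \<equiv> {e. range e \<subseteq> univ M}"

text \<open>Moving the variables of \<open>\<theta>\<close> up by \<open>length js\<close> frees the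
  ones below for naming the target tuple. These are equated with the moved copies of
  \<open>js\<close>, and everything moved is quantified away. Repetitions in \<open>js\<close> do no
  harm.\<close>

lemma projection_ex:
  fixes M :: "('f, 'r, 'm) struct"
  assumes "wf_fm L \<theta>" and ne: "univ M \<noteq> {}"
  shows "\<exists>\<chi>. wf_fm L \<chi> \<and> fv \<chi> \<subseteq> {..<length js} \<and> (\<forall>ys \<in> tuples (univ M) (length js).
    sat M ((!) ys) \<chi> \<longleftrightarrow> (\<exists>e \<in> assignments M. sat M e \<theta> \<and> map e js = ys))"
proof -
  let ?k = "length js"
  obtain u where u: "u \<in> univ M" using ne by blast
  obtain \<theta>' where \<theta>': "wf_fm L \<theta>'" "fv \<theta>' \<subseteq> (\<lambda>i. i + ?k) ` fv \<theta>"
    "\<And>e. sat M e \<theta>' = sat M (\<lambda>i. e (i + ?k)) \<theta>"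
    using rename_ex[OF assms(1), of "\<lambda>i. i + ?k"] by blast
  let ?F = "insert \<theta>' ((\<lambda>i. Eq (Var i) (Var (js ! i + ?k))) ` {..<?k})"
  have "wf_fm L \<phi>" if "\<phi> \<in> ?F" for \<phi> using that \<theta>'(1) by auto
  then have "\<exists>\<psi>. wf_fm L \<psi> \<and> fv \<psi> \<subseteq> \<Union> (fv ` ?F) \<and>
    (\<forall>(M :: ('f, 'r, 'm) struct) e. sat M e \<psi> \<longleftrightarrow> (\<forall>\<phi> \<in> ?F. sat M e \<phi>))"
    by (intro conj_ex) simp_all
  then obtain \<psi> where \<psi>: "wf_fm L \<psi>" "fv \<psi> \<subseteq> \<Union> (fv ` ?F)"
    "\<And>e. sat M e \<psi> \<longleftrightarrow> (\<forall>\<phi> \<in> ?F. sat M e \<phi>)"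
    by (elim exE conjE) (rule that; (assumption | erule spec | erule allE, erule spec))
  \<comment> \<open>\<open>js\<close> may list variables that do not occur in
    \<open>\<theta>\<close>; their copies must be quantified too.\<close>
  let ?W = "(\<lambda>i. i + ?k) ` (fv \<theta> \<union> set js)"
  have "finite ?W" by (simp add: finite_fv)
  from exists_block_ex[OF this \<psi>(1), of M] obtain \<chi> where \<chi>: "wf_fm L \<chi>" "fv \<chi> \<subseteq> fv \<psi> - ?W"
    "\<And>e. sat M e \<chi> \<longleftrightarrow> (\<exists>e'. e' ` ?W \<subseteq> univ M \<and> (\<forall>i. i \<notin> ?W \<longrightarrow> e' i = e i) \<and> sat M e' \<psi>)"
    by (elim exE conjE) (rule that; (assumption | erule spec | erule allE, erule spec))
  have "fv \<chi> \<subseteq> {..<?k}"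
    using \<chi>(2) \<psi>(2) \<theta>'(2) by fastforce
  moreover have "sat M ((!) ys) \<chi> \<longleftrightarrow> (\<exists>e \<in> assignments M. sat M e \<theta> \<and> map e js = ys)"
    if ys: "ys \<in> tuples (univ M) ?k" for ys
  proof
    assume "sat M ((!) ys) \<chi>"
    then obtain e' where e': "e' ` ?W \<subseteq> univ M" "\<forall>i. i \<notin> ?W \<longrightarrow> e' i = ys ! i" "sat M e' \<psi>"
      by (auto simp: \<chi>(3))
    \<comment> \<open>The default \<open>u\<close> is there because all values of an assignment have
      to lie in the universe.\<close>
    let ?e = "\<lambda>i. if i \<in> fv \<theta> \<union> set js then e' (i + ?k) else u"
    have "sat M (\<lambda>i. e' (i + ?k)) \<theta>" using e'(3) by (simp add: \<psi>(3) \<theta>'(3))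
    then have "sat M ?e \<theta>" by (subst sat_cong[where e' = "\<lambda>i. e' (i + ?k)"]) auto
    moreover have "map ?e js = ys"
    proof (rule nth_equalityI)
      show "length (map ?e js) = length ys" using ys by (simp add: tuples_def)
      fix i assume "i < length (map ?e js)"
      then have i: "i < ?k" by simp
      then have "e' i = e' (js ! i + ?k)" using e'(3) by (auto simp: \<psi>(3))
      moreover have "i \<notin> ?W" using i by auto
      ultimately show "map ?e js ! i = ys ! i" using e'(2) i by auto
    qed
    moreover have "?e \<in> assignments M" using e'(1) u by auto
    ultimately show "\<exists>e \<in> assignments M. sat M e \<theta> \<and> map e js = ys" by blast
  next
    assume "\<exists>e \<in> assignments M. sat M e \<theta> \<and> map e js = ys"
    then obtain e where e: "e \<in> assignments M" "sat M e \<theta>" "map e js = ys" by blast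
    let ?e' = "\<lambda>i. if i \<in> ?W then e (i - ?k) else ys ! i"
    have "sat M (\<lambda>i. ?e' (i + ?k)) \<theta>"
      using e(2) by (subst sat_cong[where e' = e]) auto
    moreover have "?e' i = ?e' (js ! i + ?k)" if "i < ?k" for i
    proof -
      have "js ! i + ?k \<in> ?W" "i \<notin> ?W" using that by auto
      then show ?thesis using that e(3) by auto
    qed
    ultimately have "sat M ?e' \<psi>" by (auto simp: \<psi>(3) \<theta>'(3))
    moreover have "?e' ` ?W \<subseteq> univ M" using e(1) by auto
    ultimately show "sat M ((!) ys) \<chi>"
      unfolding \<chi>(3) by (intro exI[of _ ?e']) auto
  qed
  ultimately show ?thesis using \<chi>(1) by blast
qed

instance tm :: (countable) countable by countable_datatype
instance fm :: (countable, countable) countable by countable_datatype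

lemma set_tm_wf: "wf_tm L t \<Longrightarrow> set_tm t \<subseteq> funs L"
  by (induction t) (auto simp: list_all_iff)

lemma set_fm_wf: "wf_fm L \<phi> \<Longrightarrow> set1_fm \<phi> \<subseteq> funs L \<and> set2_fm \<phi> \<subseteq> rels L"
proof (induction \<phi>)
  case (Rel r ts)
  then show ?case using set_tm_wf[of L] by (auto simp: list_all_iff)
next
  case (Eq s t)
  then show ?case using set_tm_wf[of L s] set_tm_wf[of L t] by auto
qed auto

text \<open>The types of symbols may be uncountable, so countability of the formula type applies
  only after the symbols of \<open>L\<close> have been coded by natural numbers. The coding is
  injective on well-formed formulas, which mention no other symbols.\<close>

lemma countable_formulas:
  assumes "countable_lang L"
  shows "countable {\<phi>. wf_fm L \<phi>}"
proof -
  let ?f = "map_fm (to_nat_on (funs L)) (to_nat_on (rels L))"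
  have inj: "inj_on (to_nat_on (funs L)) (funs L)" "inj_on (to_nat_on (rels L)) (rels L)"
    using assms by (auto simp: countable_lang_def inj_on_to_nat_on)
  have "inj_on ?f {\<phi>. wf_fm L \<phi>}"
  proof (rule inj_onI)
    fix \<phi> \<psi> assume "\<phi> \<in> {\<phi>. wf_fm L \<phi>}" "\<psi> \<in> {\<phi>. wf_fm L \<phi>}" "?f \<phi> = ?f \<psi>"
    then show "\<phi> = \<psi>"
      using set_fm_wf[of L \<phi>] set_fm_wf[of L \<psi>] inj
      by (intro fm.inj_map_strong[of \<phi> \<psi> "to_nat_on (funs L)" "to_nat_on (funs L)"
            "to_nat_on (rels L)" "to_nat_on (rels L)"]) (auto dest: inj_onD)
  qed
  then show ?thesis
    by (rule countable_image_inj_on[rotated]) simp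
qed


section \<open>Tuples of the same type\<close>

text \<open>Equality of types over the empty set, without the parameter list of \<open>tp\<close>.
  Types over a set are handled by appending the same elements to both tuples.\<close>

definition eqtp :: "('f, 'r) lang \<Rightarrow> ('f, 'r, 'm) struct \<Rightarrow> 'm list \<Rightarrow> 'm list \<Rightarrow> bool" where
  "eqtp L M as bs \<longleftrightarrow> length as = length bs \<and>
     (\<forall>\<phi>. wf_fm L \<phi> \<and> fv \<phi> \<subseteq> {..<length as} \<longrightarrow> sat M ((!) as) \<phi> = sat M ((!) bs) \<phi>)"

lemma eqtp_refl: "eqtp L M as as"
  by (simp add: eqtp_def)

lemma eqtp_sym: "eqtp L M as bs \<Longrightarrow> eqtp L M bs as"
  by (simp add: eqtp_def)

lemma eqtp_trans: "eqtp L M as bs \<Longrightarrow> eqtp L M bs cs \<Longrightarrow> eqtp L M as cs"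
  by (simp add: eqtp_def)

lemma eqtp_length: "eqtp L M as bs \<Longrightarrow> length as = length bs"
  by (simp add: eqtp_def)

lemma eqtp_sat: "eqtp L M as bs \<Longrightarrow> wf_fm L \<phi> \<Longrightarrow> fv \<phi> \<subseteq> {..<length as} \<Longrightarrow>
    sat M ((!) as) \<phi> = sat M ((!) bs) \<phi>"
  by (simp add: eqtp_def)

lemma eqtp_witness:
  assumes "\<not> eqtp L M as bs" "length as = length bs"
  shows "\<exists>\<phi>. wf_fm L \<phi> \<and> fv \<phi> \<subseteq> {..<length as} \<and> sat M ((!) as) \<phi> \<and> \<not> sat M ((!) bs) \<phi>"
proof -
  obtain \<phi> where "wf_fm L \<phi>" "fv \<phi> \<subseteq> {..<length as}" "sat M ((!) as) \<phi> \<noteq> sat M ((!) bs) \<phi>"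
    using assms by (auto simp: eqtp_def)
  then show ?thesis
    by (intro exI[of _ "if sat M ((!) as) \<phi> then \<phi> else Neg \<phi>"]) auto
qed

lemma tp_eq_iff:
  assumes "length as = length bs"
  shows "tp L M as {} = tp L M bs {} \<longleftrightarrow> eqtp L M as bs"
proof
  assume eq: "tp L M as {} = tp L M bs {}"
  have "sat M ((!) as) \<phi> = sat M ((!) bs) \<phi>" if "wf_fm L \<phi>" "fv \<phi> \<subseteq> {..<length as}" for \<phi>
  proof -
    have "(\<phi>, []) \<in> tp L M as {} \<longleftrightarrow> (\<phi>, []) \<in> tp L M bs {}" by (simp only: eq)
    then show ?thesis using that assms by (simp add: tp_def)
  qed
  then show "eqtp L M as bs" using assms by (simp add: eqtp_def)
next
  assume "eqtp L M as bs"
  then show "tp L M as {} = tp L M bs {}" by (auto simp: tp_def eqtp_def)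
qed

lemma tp_over_eqI:
  assumes "length as = length bs" "\<And>cs. set cs \<subseteq> C \<Longrightarrow> eqtp L M (as @ cs) (bs @ cs)"
  shows "tp L M as C = tp L M bs C"
proof -
  have "sat M ((!) (as @ cs)) \<phi> = sat M ((!) (bs @ cs)) \<phi>"
    if "wf_fm L \<phi>" "set cs \<subseteq> C" "fv \<phi> \<subseteq> {..<length as + length cs}" for \<phi> cs
    using eqtp_sat[OF assms(2)] that by simp
  then show ?thesis using assms(1) by (auto simp: tp_def)
qed

lemma eqtp_select:
  assumes "eqtp L M as bs" "set js \<subseteq> {..<length as}"
  shows "eqtp L M (map ((!) as) js) (map ((!) bs) js)"
  unfolding eqtp_def
proof (intro conjI allI impI)
  fix \<phi> assume \<phi>: "wf_fm L \<phi> \<and> fv \<phi> \<subseteq> {..<length (map ((!) as) js)}"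
  obtain \<psi> where \<psi>: "wf_fm L \<psi>" "fv \<psi> \<subseteq> (!) js ` fv \<phi>"
    "\<And>e. sat M e \<psi> = sat M (\<lambda>i. e (js ! i)) \<phi>"
    using rename_ex[of L \<phi> "(!) js"] \<phi> by blast
  have "sat M ((!) (map ((!) cs) js)) \<phi> = sat M ((!) cs) \<psi>" for cs
    unfolding \<psi>(3) by (rule sat_cong) (use \<phi> in auto)
  moreover have "fv \<psi> \<subseteq> {..<length as}"
    using \<psi>(2) \<phi> assms(2) by (auto simp: subset_iff)
  ultimately show "sat M ((!) (map ((!) as) js)) \<phi> = sat M ((!) (map ((!) bs) js)) \<phi>"
    using eqtp_sat[OF assms(1) \<psi>(1)] by simp
qed simp

text \<open>Permuting, omitting and repeating coordinates all preserve equality of types.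
  Corresponding entries are compared as pairs, so that no index function has to be supplied where
  this is used.\<close>

lemma eqtp_zip:
  assumes "eqtp L M as bs" "length us = length vs" "set (zip us vs) \<subseteq> set (zip as bs)"
  shows "eqtp L M us vs"
proof -
  have "\<exists>j. j < length as \<and> as ! j = us ! i \<and> bs ! j = vs ! i" if "i < length us" for i
  proof -
    have "(us ! i, vs ! i) \<in> set (zip us vs)"
      using that assms(2) by (metis in_set_zip fst_conv snd_conv)
    then have "(us ! i, vs ! i) \<in> set (zip as bs)" using assms(3) by blast
    then show ?thesis by (metis in_set_zip fst_conv snd_conv)
  qed
  then obtain j where j: "\<And>i. i < length us \<Longrightarrow> j i < length as \<and> as ! j i = us ! i \<and> bs ! j i = vs ! i"
    by metis
  let ?js = "map j [0..<length us]"
  have "us = map ((!) as) ?js" "vs = map ((!) bs) ?js"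
    using j assms(2) by (auto intro!: nth_equalityI)
  moreover have "set ?js \<subseteq> {..<length as}" using j by auto
  ultimately show ?thesis using eqtp_select[OF assms(1), of ?js] by simp
qed

lemma eqtp_eq:
  assumes "eqtp L M as bs" "i < length as" "j < length as" 
  shows "as ! i = as ! j \<longleftrightarrow> bs ! i = bs ! j"
  using eqtp_sat[OF assms(1), of "Eq (Var i) (Var j)"] assms by simp

text \<open>For each of the finitely many other types realized in \<open>Q\<close>, some formula of
  the type of \<open>as\<close> refutes it; the conjunction of these formulas isolates.\<close>

lemma isolating_formula_ex:
  assumes "finite ((\<lambda>as. tp L M as {}) ` Q)" "Q \<subseteq> {xs. length xs = k}" "length as = k"
  shows "\<exists>\<chi>. wf_fm L \<chi> \<and> fv \<chi> \<subseteq> {..<k} \<and> sat M ((!) as) \<chi> \<and>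
    (\<forall>bs \<in> Q. sat M ((!) bs) \<chi> \<longrightarrow> eqtp L M as bs)"
proof -
  let ?T = "(\<lambda>as. tp L M as {}) ` Q - {tp L M as {}}"
  have "\<exists>\<phi>. wf_fm L \<phi> \<and> fv \<phi> \<subseteq> {..<k} \<and> sat M ((!) as) \<phi> \<and>
      (\<forall>bs. length bs = k \<and> tp L M bs {} = t \<longrightarrow> \<not> sat M ((!) bs) \<phi>)"
    if t: "t \<in> ?T" for t
  proof -
    obtain cs where cs: "cs \<in> Q" "t = tp L M cs {}" "tp L M cs {} \<noteq> tp L M as {}"
      using t by auto
    have len: "length cs = k" using cs assms by auto
    then have "\<not> eqtp L M as cs" using cs(3) tp_eq_iff[of as cs] assms(3) by auto
    then obtain \<phi> where \<phi>: "wf_fm L \<phi>" "fv \<phi> \<subseteq> {..<k}" "sat M ((!) as) \<phi>" "\<not> sat M ((!) cs) \<phi>"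
      using eqtp_witness[of L M as cs] len assms(3) by auto
    moreover have "\<not> sat M ((!) bs) \<phi>" if "length bs = k" "tp L M bs {} = t" for bs
    proof -
      have "eqtp L M bs cs" using that cs(2) len tp_eq_iff[of bs cs L M] by simp
      then show ?thesis using eqtp_sat[of L M bs cs \<phi>] \<phi> that by simp
    qed
    ultimately show ?thesis by blast
  qed
  then obtain f where f: "\<And>t. t \<in> ?T \<Longrightarrow> wf_fm L (f t) \<and> fv (f t) \<subseteq> {..<k} \<and> sat M ((!) as) (f t) \<and>
      (\<forall>bs. length bs = k \<and> tp L M bs {} = t \<longrightarrow> \<not> sat M ((!) bs) (f t))"
    by metis
  have "\<exists>\<chi>. wf_fm L \<chi> \<and> fv \<chi> \<subseteq> \<Union> (fv ` f ` ?T) \<and>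
    (\<forall>M e. sat M e \<chi> \<longleftrightarrow> (\<forall>\<phi> \<in> f ` ?T. sat M e \<phi>))"
    by (rule conj_ex) (use assms(1) f in auto)
  then obtain \<chi> where \<chi>: "wf_fm L \<chi>" "fv \<chi> \<subseteq> \<Union> (fv ` f ` ?T)"
    "\<And>e. sat M e \<chi> \<longleftrightarrow> (\<forall>\<phi> \<in> f ` ?T. sat M e \<phi>)"
    by (elim exE conjE) (rule that; (assumption | erule spec | erule allE, erule spec))
  have "fv \<chi> \<subseteq> {..<k}" using \<chi>(2) f by blast
  moreover have "sat M ((!) as) \<chi>" using f by (auto simp: \<chi>(3))
  moreover have "eqtp L M as bs" if "bs \<in> Q" "sat M ((!) bs) \<chi>" for bs
  proof (rule ccontr)
    assume "\<not> eqtp L M as bs"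
    then have "tp L M bs {} \<in> ?T" using that(1) assms tp_eq_iff[of as bs L M] by auto
    then show False using f[of "tp L M bs {}"] that assms(2) by (auto simp: \<chi>(3))
  qed
  ultimately show ?thesis using \<chi>(1) by blast
qed


section \<open>Saturation for tuples\<close>

text \<open>Definability is made a property of predicates, so that saturation can be applied to
  conditions that are never written out as formulas.\<close>

definition pdef ::
  "('f, 'r) lang \<Rightarrow> ('f, 'r, 'm) struct \<Rightarrow> 'm set \<Rightarrow> nat \<Rightarrow> ('m list \<Rightarrow> bool) \<Rightarrow> bool" where
  "pdef L M R N P \<longleftrightarrow> (\<exists>\<phi> bs. wf_fm L \<phi> \<and> set bs \<subseteq> R \<and> fv \<phi> \<subseteq> {..<N + length bs} \<and>
     (\<forall>xs \<in> tuples (univ M) N. P xs \<longleftrightarrow> sat M ((!) (xs @ bs)) \<phi>))"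

lemma pdefE:
  assumes "pdef L M R N P"
  obtains \<phi> bs where "wf_fm L \<phi>" "set bs \<subseteq> R" "fv \<phi> \<subseteq> {..<N + length bs}"
    "\<forall>xs \<in> tuples (univ M) N. P xs \<longleftrightarrow> sat M ((!) (xs @ bs)) \<phi>"
  using assms unfolding pdef_def by (elim exE conjE) (rule that)

lemma pdefI:
  assumes "wf_fm L \<phi>" "set bs \<subseteq> R" "fv \<phi> \<subseteq> {..<N + length bs}"
    "\<And>xs. xs \<in> tuples (univ M) N \<Longrightarrow> P xs \<longleftrightarrow> sat M ((!) (xs @ bs)) \<phi>"
  shows "pdef L M R N P"
  unfolding pdef_def using assms by (intro exI[of _ \<phi>] exI[of _ bs]) simp

lemma pdef_mono: "pdef L M R N P \<Longrightarrow> R \<subseteq> R' \<Longrightarrow> pdef L M R' N P"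
  by (erule pdefE) (rule pdefI, auto)

lemma pdef_True: "pdef L M R N (\<lambda>_. True)"
  by (rule pdefI[of L "Neg (Exi 0 (Neg (Eq (Var 0) (Var 0))))" "[]"]) auto

lemma pdef_Neg:
  assumes "pdef L M R N P"
  shows "pdef L M R N (\<lambda>xs. \<not> P xs)"
  using assms by (elim pdefE) (rule pdefI[of L "Neg _"], auto)

lemma pdef_conj:
  assumes "pdef L M R N P" "pdef L M R N Q"
  shows "pdef L M R N (\<lambda>xs. P xs \<and> Q xs)"
proof -
  from assms(1) obtain \<phi> bs where \<phi>: "wf_fm L \<phi>" "set bs \<subseteq> R" "fv \<phi> \<subseteq> {..<N + length bs}"
    "\<forall>xs \<in> tuples (univ M) N. P xs \<longleftrightarrow> sat M ((!) (xs @ bs)) \<phi>" by (rule pdefE)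
  from assms(2) obtain \<psi> cs where \<psi>: "wf_fm L \<psi>" "set cs \<subseteq> R" "fv \<psi> \<subseteq> {..<N + length cs}"
    "\<forall>xs \<in> tuples (univ M) N. Q xs \<longleftrightarrow> sat M ((!) (xs @ cs)) \<psi>" by (rule pdefE)
  \<comment> \<open>In the joint parameter list \<open>cs\<close> stands behind \<open>bs\<close>,
    so the parameter variables of \<open>\<psi>\<close> move by \<open>length bs\<close>.\<close>
  let ?f = "\<lambda>i. if i < N then i else i + length bs"
  from rename_ex[OF \<psi>(1), of ?f] obtain \<psi>' where \<psi>': "wf_fm L \<psi>'" "fv \<psi>' \<subseteq> ?f ` fv \<psi>"
    "\<And>e. sat M e \<psi>' = sat M (\<lambda>i. e (?f i)) \<psi>" by blast
  show ?thesis
  proof (rule pdefI[of L "Conj \<phi> \<psi>'" "bs @ cs"])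
    fix xs assume xs: "xs \<in> tuples (univ M) N"
    then have len: "length xs = N" by (simp add: tuples_def)
    have "sat M ((!) (xs @ bs @ cs)) \<phi> = sat M ((!) (xs @ bs)) \<phi>"
      by (rule sat_cong) (use \<phi>(3) len in \<open>auto simp: nth_append\<close>)
    moreover have "sat M ((!) (xs @ bs @ cs)) \<psi>' = sat M ((!) (xs @ cs)) \<psi>"
      unfolding \<psi>'(3) by (rule sat_cong) (use \<psi>(3) len in \<open>auto simp: nth_append\<close>)
    ultimately show "(P xs \<and> Q xs) = sat M ((!) (xs @ bs @ cs)) (Conj \<phi> \<psi>')"
      using bspec[OF \<phi>(4) xs] bspec[OF \<psi>(4) xs] by simp
  qed (use \<phi> \<psi> \<psi>' in \<open>auto 0 3 split: if_splits\<close>)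
qed

lemma pdef_Ball:
  assumes "finite \<P>" "\<And>P. P \<in> \<P> \<Longrightarrow> pdef L M R N P"
  shows "pdef L M R N (\<lambda>xs. \<forall>P \<in> \<P>. P xs)"
  using assms
proof (induction \<P>)
  case empty
  show ?case using pdef_True by simp
next
  case (insert P \<P>)
  then have "pdef L M R N (\<lambda>xs. P xs \<and> (\<forall>P \<in> \<P>. P xs))" by (intro pdef_conj) auto
  then show ?case by simp
qed

lemma pdef_Bex:
  assumes "finite \<P>" "\<And>P. P \<in> \<P> \<Longrightarrow> pdef L M R N P"
  shows "pdef L M R N (\<lambda>xs. \<exists>P \<in> \<P>. P xs)"
proof -
  have "pdef L M R N (\<lambda>xs. \<not> (\<forall>P \<in> (\<lambda>P xs. \<not> P xs) ` \<P>. P xs))"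
    using assms by (intro pdef_Neg pdef_Ball) (auto intro: pdef_Neg)
  then show ?thesis by simp
qed

lemma pdef_exists_tail:
  assumes "pdef L M R (Suc N) P" "R \<subseteq> univ M" "univ M \<noteq> {}"
  shows "pdef L M R 1 (\<lambda>xs. \<exists>ys \<in> tuples (univ M) N. P (hd xs # ys))"
proof -
  from assms(1) obtain \<phi> bs where \<phi>: "wf_fm L \<phi>" "set bs \<subseteq> R" "fv \<phi> \<subseteq> {..<Suc N + length bs}"
    "\<forall>xs \<in> tuples (univ M) (Suc N). P xs \<longleftrightarrow> sat M ((!) (xs @ bs)) \<phi>" by (rule pdefE)
  \<comment> \<open>The first coordinate and the parameters are kept; the \<open>N\<close>
    coordinates between them are projected away.\<close>
  let ?js = "0 # [Suc N..<Suc N + length bs]"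
  obtain u where u: "u \<in> univ M" using assms(3) by blast
  have "\<exists>\<chi>. wf_fm L \<chi> \<and> fv \<chi> \<subseteq> {..<length ?js} \<and> (\<forall>ys \<in> tuples (univ M) (length ?js).
    sat M ((!) ys) \<chi> \<longleftrightarrow> (\<exists>e \<in> assignments M. sat M e \<phi> \<and> map e ?js = ys))"
    by (rule projection_ex[OF \<phi>(1) assms(3)])
  then obtain \<chi> where \<chi>: "wf_fm L \<chi>" "fv \<chi> \<subseteq> {..<length ?js}"
    "\<forall>ys \<in> tuples (univ M) (length ?js).
      sat M ((!) ys) \<chi> \<longleftrightarrow> (\<exists>e \<in> assignments M. sat M e \<phi> \<and> map e ?js = ys)"
    by (elim exE conjE) (rule that)
  show ?thesis
  proof (rule pdefI[of L \<chi> bs])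
    fix xs assume "xs \<in> tuples (univ M) 1"
    then obtain x where x: "xs = [x]" "x \<in> univ M" by (auto simp: tuples_def length_Suc_conv)
    have "x # bs \<in> tuples (univ M) (length ?js)" using x \<phi>(2) assms(2) by (auto simp: tuples_def simp del: upt_Suc)
    then have "sat M ((!) (x # bs)) \<chi> \<longleftrightarrow>
      (\<exists>e \<in> assignments M. sat M e \<phi> \<and> map e ?js = x # bs)" by (rule bspec[OF \<chi>(3)])
    also have "\<dots> \<longleftrightarrow> (\<exists>ys \<in> tuples (univ M) N. P (x # ys))"
    proof
      assume "\<exists>e \<in> assignments M. sat M e \<phi> \<and> map e ?js = x # bs"
      then obtain e where e: "e \<in> assignments M" "sat M e \<phi>" "map e ?js = x # bs"
        by (elim bexE conjE) (rule that)
      let ?ys = "map e [1..<Suc N]"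
      have ys: "?ys \<in> tuples (univ M) N" using e(1) by (auto simp: tuples_def)
      then have xys: "x # ?ys \<in> tuples (univ M) (Suc N)" using x by (auto simp: tuples_def)
      have "((x # ?ys) @ bs) ! i = e i" if "i < Suc N + length bs" for i
      proof -
        have "(x # ?ys) @ bs = map e [0..<Suc N + length bs]"
        proof -
          have "[0..<Suc N + length bs] = (0 # [1..<Suc N]) @ [Suc N..<Suc N + length bs]"
            using upt_add_eq_append[of 0 "Suc N" "length bs"] upt_conv_Cons[of 0 "Suc N"]
            by (simp del: upt_Suc)
          then show ?thesis using e(3) by (simp del: upt_Suc)
        qed
        then show ?thesis using that by (simp del: upt_Suc)
      qed
      then have "sat M ((!) ((x # ?ys) @ bs)) \<phi>"
        using e(2) \<phi>(3) by (subst sat_cong[where e' = e]) auto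
      then show "\<exists>ys \<in> tuples (univ M) N. P (x # ys)" using bspec[OF \<phi>(4) xys] ys by blast
    next
      assume "\<exists>ys \<in> tuples (univ M) N. P (x # ys)"
      then obtain ys where ys: "ys \<in> tuples (univ M) N" "P (x # ys)" by blast
      let ?l = "(x # ys) @ bs"
      let ?e = "\<lambda>i. if i < Suc N + length bs then ?l ! i else u"
      have len: "length ys = N" using ys by (simp add: tuples_def)
      have "x # ys \<in> tuples (univ M) (Suc N)" using x ys by (auto simp: tuples_def)
      from bspec[OF \<phi>(4) this] have "sat M ((!) ?l) \<phi>" using ys by simp
      then have "sat M ?e \<phi>" using \<phi>(3) by (subst sat_cong[where e' = "(!) ?l"]) auto
      moreover have l: "set ?l \<subseteq> univ M" using x ys \<phi>(2) assms(2) by (auto simp: tuples_def)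
      have "?e i \<in> univ M" for i
      proof (cases "i < Suc N + length bs")
        case True
        then have "?l ! i \<in> set ?l" using len by (intro nth_mem) simp
        then show ?thesis using True l by (simp only: if_True) blast
      qed (use u in simp)
      then have "?e \<in> assignments M" by blast
      moreover have "map ?e [Suc N..<Suc N + length bs] = bs"
        by (rule nth_equalityI) (use len in \<open>auto simp: nth_append simp del: upt_Suc\<close>)
      then have "map ?e ?js = x # bs" by (simp del: upt_Suc)
      ultimately show "\<exists>e \<in> assignments M. sat M e \<phi> \<and> map e ?js = x # bs"
        by (intro bexI[of _ ?e] conjI)
    qed
    finally show "(\<exists>ys \<in> tuples (univ M) N. P (hd xs # ys)) = sat M ((!) (xs @ bs)) \<chi>"
      using x by simp
  qed (use \<chi>(1,2) \<phi>(2) in \<open>auto simp del: upt_Suc\<close>)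
qed

lemma pdef_instantiate:
  assumes "pdef L M R (Suc N) P" "x \<in> univ M"
  shows "pdef L M (insert x R) N (\<lambda>ys. P (x # ys))"
proof -
  from assms(1) obtain \<phi> bs where \<phi>: "wf_fm L \<phi>" "set bs \<subseteq> R" "fv \<phi> \<subseteq> {..<Suc N + length bs}"
    "\<forall>xs \<in> tuples (univ M) (Suc N). P xs \<longleftrightarrow> sat M ((!) (xs @ bs)) \<phi>" by (rule pdefE)
  \<comment> \<open>Variable 0 becomes the first parameter, at position \<open>N\<close>; the other
    tuple variables move down by one and the old parameters stay where they are.\<close>
  let ?f = "\<lambda>i. if i = 0 then N else if i \<le> N then i - 1 else i"
  from rename_ex[OF \<phi>(1), of ?f] obtain \<psi> where \<psi>: "wf_fm L \<psi>" "fv \<psi> \<subseteq> ?f ` fv \<phi>"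
    "\<And>e. sat M e \<psi> = sat M (\<lambda>i. e (?f i)) \<phi>" by blast
  show ?thesis
  proof (rule pdefI[of L \<psi> "x # bs"])
    show "fv \<psi> \<subseteq> {..<N + length (x # bs)}"
      using \<psi>(2) \<phi>(3) by (auto split: if_splits)
    fix ys assume ys: "ys \<in> tuples (univ M) N"
    then have len: "length ys = N" by (simp add: tuples_def)
    have "sat M ((!) (ys @ x # bs)) \<psi> = sat M ((!) ((x # ys) @ bs)) \<phi>"
      unfolding \<psi>(3)
    proof (rule sat_cong)
      fix i
      show "(ys @ x # bs) ! ?f i = ((x # ys) @ bs) ! i"
        using len by (cases i) (auto simp: nth_append Suc_diff_le)
    qed
    moreover have "x # ys \<in> tuples (univ M) (Suc N)" using ys assms(2) by (auto simp: tuples_def)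
    ultimately show "P (x # ys) = sat M ((!) (ys @ x # bs)) \<psi>"
      using bspec[OF \<phi>(4), of "x # ys"] by simp
  qed (use \<phi>(2) \<psi>(1) in auto)
qed

locale saturated_model =
  fixes L :: "('f, 'r) lang" and M :: "('f, 'r, 'm) struct" and \<kappa> :: "'k rel"
  assumes struct: "is_struct L M"
    and cinfinite: "Cinfinite \<kappa>"
    and saturated: "saturated L \<kappa> M"
begin

lemma univ_nonempty: "univ M \<noteq> {}"
  using struct by (simp add: is_struct_def)

section \<open>Sets smaller than the saturation cardinal\<close>

lemma small_finite: "finite A \<Longrightarrow> small \<kappa> A"
  using cinfinite unfolding small_def cinfinite_def
  using card_of_Well_order[of A]
  by (auto intro!: finite_ordLess_infinite simp: Field_card_of card_order_on_well_order_on)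

lemma small_insert:
  assumes "small \<kappa> A"
  shows "small \<kappa> (insert a A)"
proof -
  have "small \<kappa> ({a} \<union> A)"
    unfolding small_def
    by (rule card_of_Un_ordLess_infinite_Field)
      (use cinfinite assms small_finite[of "{a}"] in \<open>auto simp: small_def cinfinite_def\<close>)
  then show ?thesis by simp
qed

lemma small_Un_finite: "finite A \<Longrightarrow> small \<kappa> B \<Longrightarrow> small \<kappa> (A \<union> B)"
  by (induction A rule: finite_induct) (auto intro: small_insert)

text \<open>A union of finite sets over an infinite index set is no larger than the index set. It
  serves to keep the home representatives of a small set of imaginaries small.\<close>

lemma small_UN_finite:
  assumes "small \<kappa> B" "\<And>b. b \<in> B \<Longrightarrow> finite (f b)"
  shows "small \<kappa> (\<Union>b \<in> B. f b)"
proof (cases "finite B")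
  case True
  then show ?thesis using assms(2) by (intro small_finite) blast
next
  case False
  have "(card_of (f b), card_of B) \<in> ordLeq" if "b \<in> B" for b
    using assms(2)[OF that] False finite_ordLess_infinite[OF card_of_Well_order card_of_Well_order]
    by (intro ordLess_imp_ordLeq) (simp add: Field_card_of)
  then have "(card_of (\<Union>b \<in> B. f b), card_of B) \<in> ordLeq"
    by (intro card_of_UNION_ordLeq_infinite[OF False] card_of_mono1) auto
  then show ?thesis using assms(1) unfolding small_def by (rule ordLeq_ordLess_trans)
qed

lemma small_mono: "small \<kappa> B \<Longrightarrow> A \<subseteq> B \<Longrightarrow> small \<kappa> A"
  unfolding small_def by (meson card_of_mono1 ordLeq_ordLess_trans)

lemma saturation_one:
  assumes R: "R \<subseteq> univ M" "small \<kappa> R"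
    and def: "\<And>P. P \<in> \<P> \<Longrightarrow> pdef L M R 1 P"
    and fin: "\<And>F. finite F \<Longrightarrow> F \<subseteq> \<P> \<Longrightarrow> \<exists>x \<in> univ M. \<forall>P \<in> F. P [x]"
  shows "\<exists>x \<in> univ M. \<forall>P \<in> \<P>. P [x]"
proof -
  have "\<exists>\<phi> bs. wf_fm L \<phi> \<and> set bs \<subseteq> R \<and> fv \<phi> \<subseteq> {..<Suc (length bs)} \<and>
    (\<forall>x \<in> univ M. P [x] \<longleftrightarrow> sat M ((!) (x # bs)) \<phi>)" if P: "P \<in> \<P>" for P
  proof -
    from def[OF P] obtain \<phi> bs where "wf_fm L \<phi>" "set bs \<subseteq> R" "fv \<phi> \<subseteq> {..<1 + length bs}"
      and *: "\<forall>xs \<in> tuples (univ M) 1. P xs \<longleftrightarrow> sat M ((!) (xs @ bs)) \<phi>" by (rule pdefE)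
    moreover have "P [x] \<longleftrightarrow> sat M ((!) (x # bs)) \<phi>" if "x \<in> univ M" for x
      using bspec[OF *, of "[x]"] that by (simp add: tuples_def)
    ultimately show ?thesis by (intro exI[of _ \<phi>] exI[of _ bs]) simp
  qed
  then obtain \<phi> bs where \<phi>: "\<And>P. P \<in> \<P> \<Longrightarrow> wf_fm L (\<phi> P) \<and> set (bs P) \<subseteq> R \<and>
    fv (\<phi> P) \<subseteq> {..<Suc (length (bs P))} \<and> (\<forall>x \<in> univ M. P [x] \<longleftrightarrow> sat M ((!) (x # bs P)) (\<phi> P))"
    by metis
  \<comment> \<open>Position 0 is overwritten by the realizing element, so its value here is
    arbitrary.\<close>
  let ?e = "\<lambda>P. (!) (undefined # bs P)"
  have sat: "sat M ((?e P)(0 := x)) (\<phi> P) \<longleftrightarrow> P [x]" if "P \<in> \<P>" "x \<in> univ M" for P x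
  proof -
    have "sat M ((?e P)(0 := x)) (\<phi> P) = sat M ((!) (x # bs P)) (\<phi> P)"
      by (rule sat_cong) (auto simp: nth_Cons split: nat.splits)
    then show ?thesis using \<phi>[OF that(1)] that(2) by simp
  qed
  let ?\<Gamma> = "(\<lambda>P. (\<phi> P, ?e P)) ` \<P>"
  have "?\<Gamma> \<subseteq> param_formulas L R"
  proof -
    have "?e P ` (fv (\<phi> P) - {0}) \<subseteq> R" if "P \<in> \<P>" for P
    proof
      fix y assume "y \<in> ?e P ` (fv (\<phi> P) - {0})"
      then obtain i where "i \<in> fv (\<phi> P)" "i \<noteq> 0" "y = ?e P i" by auto
      then have "y = bs P ! (i - 1)" "i - 1 < length (bs P)"
        using \<phi>[OF that] by (auto simp: nth_Cons split: nat.splits)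
      then show "y \<in> R" using \<phi>[OF that] nth_mem[of "i - 1" "bs P"] by auto
    qed
    then have "(\<phi> P, ?e P) \<in> param_formulas L R" if "P \<in> \<P>" for P
      using \<phi>[OF that] that unfolding param_formulas_def mem_Collect_eq case_prod_conv by blast
    then show ?thesis by blast
  qed
  moreover have "\<exists>b \<in> univ M. realizes M b \<Gamma>0" if \<Gamma>0: "finite \<Gamma>0" "\<Gamma>0 \<subseteq> ?\<Gamma>" for \<Gamma>0
  proof -
    obtain F where F: "F \<subseteq> \<P>" "finite F" "\<Gamma>0 = (\<lambda>P. (\<phi> P, ?e P)) ` F"
      using finite_subset_image[OF \<Gamma>0] by auto
    then obtain x where "x \<in> univ M" "\<forall>P \<in> F. P [x]" using fin by blast
    then show ?thesis using F sat by (intro bexI[of _ x]) (auto simp: realizes_def)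
  qed
  ultimately obtain b where "b \<in> univ M" "realizes M b ?\<Gamma>"
    using saturated[unfolded saturated_def, rule_format, of R ?\<Gamma>] R by blast
  then show ?thesis using sat by (intro bexI[of _ b]) (auto simp: realizes_def)
qed

text \<open>The first coordinate is chosen so that every finite part of the family can still be
  completed by a tail; it then joins the parameters, which stay small, and the induction continues
  with the tail.\<close>

lemma saturation:
  assumes "R \<subseteq> univ M" "small \<kappa> R"
    and "\<And>P. P \<in> \<P> \<Longrightarrow> pdef L M R N P"
    and "\<And>F. finite F \<Longrightarrow> F \<subseteq> \<P> \<Longrightarrow> \<exists>xs \<in> tuples (univ M) N. \<forall>P \<in> F. P xs"
  shows "\<exists>xs \<in> tuples (univ M) N. \<forall>P \<in> \<P>. P xs"
  using assms
proof (induction N arbitrary: R \<P>)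
  case 0
  have "P []" if "P \<in> \<P>" for P
    using "0.prems"(4)[of "{P}"] that by (auto simp: tuples_def)
  then show ?case by (auto simp: tuples_def)
next
  case (Suc N)
  let ?Q = "\<lambda>F xs. \<exists>ys \<in> tuples (univ M) N. \<forall>P \<in> F. P (hd xs # ys)"
  have split: "xs \<in> tuples (univ M) (Suc N) \<longleftrightarrow> (\<exists>x \<in> univ M. \<exists>ys \<in> tuples (univ M) N. xs = x # ys)" for xs
    by (cases xs) (auto simp: tuples_def)
  have "\<exists>x \<in> univ M. \<forall>P \<in> ?Q ` {F. finite F \<and> F \<subseteq> \<P>}. P [x]"
  proof (rule saturation_one[OF Suc.prems(1,2)])
    fix P assume "P \<in> ?Q ` {F. finite F \<and> F \<subseteq> \<P>}"
    then obtain F where F: "finite F" "F \<subseteq> \<P>" "P = ?Q F" by blast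
    show "pdef L M R 1 P"
      unfolding F(3)
      by (rule pdef_exists_tail[OF pdef_Ball]) (use F Suc.prems univ_nonempty in auto)
  next
    fix G assume "finite G" "G \<subseteq> ?Q ` {F. finite F \<and> F \<subseteq> \<P>}"
    from finite_subset_image[OF this] obtain \<F>
      where \<F>: "\<F> \<subseteq> {F. finite F \<and> F \<subseteq> \<P>}" "finite \<F>" "G = ?Q ` \<F>"
      by (elim exE conjE) (rule that)
    have "finite (\<Union>\<F>)" "\<Union>\<F> \<subseteq> \<P>" using \<F> by auto
    from Suc.prems(4)[OF this] obtain xs where xs: "xs \<in> tuples (univ M) (Suc N)" "\<forall>P \<in> \<Union>\<F>. P xs"
      by (elim bexE) (rule that)
    from xs(1) obtain x ys where x: "x \<in> univ M" "ys \<in> tuples (univ M) N" "xs = x # ys"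
      unfolding split by (elim bexE) (rule that)
    have "\<forall>P \<in> F. P (x # ys)" if "F \<in> \<F>" for F 
      using bspec[OF xs(2)[unfolded x(3)] UnionI[OF that]] by blast
    then have "?Q F [x]" if "F \<in> \<F>" for F using x(2) that by (intro bexI[of _ ys]) simp_all
    then show "\<exists>x \<in> univ M. \<forall>P \<in> G. P [x]"
      unfolding \<F>(3) using x(1) by (intro bexI[of _ x] ballI) (elim imageE, simp_all)
  qed
  then obtain x where x: "x \<in> univ M" "\<forall>P \<in> ?Q ` {F. finite F \<and> F \<subseteq> \<P>}. P [x]"
    by (elim bexE) (rule that)
  have Q: "?Q F [x]" if "finite F" "F \<subseteq> \<P>" for F
    by (rule bspec[OF x(2)]) (use that in simp)
  have "\<exists>xs \<in> tuples (univ M) N. \<forall>P \<in> (\<lambda>P ys. P (x # ys)) ` \<P>. P xs"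
  proof (rule Suc.IH[of "insert x R"])
    show "small \<kappa> (insert x R)" by (rule small_insert[OF Suc.prems(2)])
    show "insert x R \<subseteq> univ M" using Suc.prems(1) x by simp
    show "pdef L M (insert x R) N P" if "P \<in> (\<lambda>P ys. P (x # ys)) ` \<P>" for P
      using that Suc.prems(3) x(1) by (auto intro: pdef_instantiate)
    fix G assume "finite G" "G \<subseteq> (\<lambda>P ys. P (x # ys)) ` \<P>"
    from finite_subset_image[OF this] obtain F
      where F: "F \<subseteq> \<P>" "finite F" "G = (\<lambda>P ys. P (x # ys)) ` F"
      by (elim exE conjE) (rule that)
    from Q[OF F(2,1), unfolded list.sel] obtain ys
      where "ys \<in> tuples (univ M) N" "\<forall>P \<in> F. P (x # ys)"
      by (elim bexE) (rule that)
    then show "\<exists>xs \<in> tuples (univ M) N. \<forall>P \<in> G. P xs"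
      unfolding F(3) by (intro bexI[of _ ys]) simp_all
  qed
  then obtain ys where "ys \<in> tuples (univ M) N" "\<forall>P \<in> (\<lambda>P ys. P (x # ys)) ` \<P>. P ys"
    by (elim bexE) (rule that)
  then show ?case using x(1) by (intro bexI[of _ "x # ys"]) (simp_all add: tuples_def)
qed

end


section \<open>Countable elementary substructures\<close>

text \<open>The Tarski-Vaught criterion.\<close>

definition tv_closed :: "('f, 'r) lang \<Rightarrow> ('f, 'r, 'm) struct \<Rightarrow> 'm set \<Rightarrow> bool" where
  "tv_closed L M U \<longleftrightarrow> U \<subseteq> univ M \<and> U \<noteq> {} \<and>
     (\<forall>\<phi> i e. wf_fm L \<phi> \<and> range e \<subseteq> U \<and> sat M e (Exi i \<phi>) \<longrightarrow> (\<exists>x \<in> U. sat M (e(i := x)) \<phi>))"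

lemma tv_closedD:
  "tv_closed L M U \<Longrightarrow> wf_fm L \<phi> \<Longrightarrow> range e \<subseteq> U \<Longrightarrow> sat M e (Exi i \<phi>) \<Longrightarrow>
    \<exists>x \<in> U. sat M (e(i := x)) \<phi>"
  unfolding tv_closed_def by blast

text \<open>The criterion is applied to the formula saying that a new variable equals the value of
  \<open>f\<close>; its only witness is that value.\<close>

lemma tv_closed_fint:
  assumes "tv_closed L M U" "is_struct L M" "f \<in> funs L" "xs \<in> tuples U (farity L f)"
  shows "fint M f xs \<in> U"
proof -
  let ?k = "farity L f"
  obtain u where u: "u \<in> U" using assms(1) by (auto simp: tv_closed_def)
  let ?e = "\<lambda>i. if i < ?k then xs ! i else u"
  let ?\<phi> = "Eq (Var ?k) (App f (map Var [0..<?k])) :: ('a, 'b) fm"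
  have len: "length xs = ?k" using assms(4) by (simp add: tuples_def)
  have e: "range ?e \<subseteq> U" using assms(4) u by (auto simp: tuples_def)
  have map: "map (eval M (?e(?k := x))) (map Var [0..<?k]) = xs" for x
    using len by (auto intro: nth_equalityI)
  have sat: "sat M (?e(?k := x)) ?\<phi> \<longleftrightarrow> x = fint M f xs" for x
    using map[of x] by (simp only: sat.simps eval.simps) simp
  have "xs \<in> tuples (univ M) ?k"
    using assms(1,4) by (auto simp: tuples_def tv_closed_def)
  then have "fint M f xs \<in> univ M" using assms(2,3) by (auto simp: is_struct_def)
  then have "sat M ?e (Exi ?k ?\<phi>)" using sat by (simp only: sat.simps(5)) blast
  moreover have "wf_fm L ?\<phi>" using assms(3) by (auto simp: list_all_iff)
  ultimately obtain x where "x \<in> U" "sat M (?e(?k := x)) ?\<phi>"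
    using tv_closedD[OF assms(1) _ e] by blast
  then show ?thesis unfolding sat by simp
qed

text \<open>If \<open>U\<close> were finite, a formula with all its elements as parameters could
  demand one more element, and the criterion would put the witness into \<open>U\<close>.\<close>

lemma tv_closed_infinite:
  assumes "tv_closed L M U" "infinite (univ M)"
  shows "infinite U"
proof
  assume fin: "finite U"
  then obtain us where us: "set us = U" using finite_list by blast
  obtain u where u: "u \<in> U" using assms(1) by (auto simp: tv_closed_def)
  let ?k = "length us"
  let ?e = "\<lambda>i. if i < ?k then us ! i else u"
  let ?F = "(\<lambda>i. Neg (Eq (Var ?k) (Var i))) ` {..<?k} :: ('a, 'b) fm set"
  have "\<exists>\<chi>. wf_fm L \<chi> \<and> fv \<chi> \<subseteq> \<Union> (fv ` ?F) \<and>
    (\<forall>(M :: ('a, 'b, 'c) struct) e. sat M e \<chi> \<longleftrightarrow> (\<forall>\<phi> \<in> ?F. sat M e \<phi>))"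
    by (intro conj_ex) auto
  then obtain \<chi> where \<chi>: "wf_fm L \<chi>" "\<And>e. sat M e \<chi> \<longleftrightarrow> (\<forall>\<phi> \<in> ?F. sat M e \<phi>)"
    by (elim exE conjE) (rule that; (assumption | erule spec | erule allE, erule spec))
  have sat: "sat M (?e(?k := x)) \<chi> \<longleftrightarrow> x \<notin> U" for x
    using us by (auto simp: \<chi>(2) in_set_conv_nth)
  have "\<exists>x \<in> univ M. x \<notin> U" using assms(2) fin by (meson finite_subset subsetI)
  then have "sat M ?e (Exi ?k \<chi>)" by (simp only: sat.simps(5) sat)
  moreover have "range ?e \<subseteq> U" using u us by auto
  ultimately obtain x where "x \<in> U" "sat M (?e(?k := x)) \<chi>"
    using tv_closedD[OF assms(1) \<chi>(1)] by blast
  then show False unfolding sat by simp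
qed

text \<open>\<open>omega_categorical\<close> compares models on sets of natural numbers, so a
  countable elementary substructure is copied to \<open>UNIV\<close> along an enumeration
  \<open>h\<close>. The use of \<open>inv h\<close> is meaningful when the range of \<open>h\<close>
  is closed under the functions, as a Tarski-Vaught set is.\<close>

definition pullback :: "(nat \<Rightarrow> 'm) \<Rightarrow> ('f, 'r, 'm) struct \<Rightarrow> ('f, 'r, nat) struct" where
  "pullback h M = \<lparr>univ = UNIV, fint = (\<lambda>f xs. inv h (fint M f (map h xs))),
     rint = (\<lambda>r xs. rint M r (map h xs))\<rparr>"

lemma eval_pullback:
  assumes "tv_closed L M (range h)" "is_struct L M" "wf_tm L t"
  shows "h (eval (pullback h M) e t) = eval M (\<lambda>i. h (e i)) t"
  using assms(3)
proof (induction t)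
  case (App f ts)
  then have IH: "map (\<lambda>t. h (eval (pullback h M) e t)) ts = map (eval M (\<lambda>i. h (e i))) ts"
    by (auto simp: list_all_iff)
  have "fint M f (map (\<lambda>t. h (eval (pullback h M) e t)) ts) \<in> range h"
    by (rule tv_closed_fint[OF assms(1,2)]) (use App.prems in \<open>auto simp: tuples_def\<close>)
  then show ?case
    unfolding IH by (simp add: pullback_def comp_def f_inv_into_f IH[unfolded pullback_def])
qed simp

text \<open>Injectivity of \<open>h\<close> takes care of equations, and the criterion of the
  existential quantifier, by supplying a witness in the range of \<open>h\<close>.\<close>

lemma sat_pullback:
  assumes "tv_closed L M (range h)" "is_struct L M" "inj h" "wf_fm L \<phi>"
  shows "sat (pullback h M) e \<phi> = sat M (\<lambda>i. h (e i)) \<phi>"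
  using assms(4)
proof (induction \<phi> arbitrary: e)
  case (Eq s t)
  then show ?case
    using eval_pullback[OF assms(1,2), of s e] eval_pullback[OF assms(1,2), of t e] assms(3)
    by (auto dest: injD) (metis injD)
next
  case (Rel r ts)
  then have "map (h \<circ> eval (pullback h M) e) ts = map (eval M (\<lambda>i. h (e i))) ts"
    using eval_pullback[OF assms(1,2)] by (auto simp: list_all_iff)
  then have "rint M r (map h (map (eval (pullback h M) e) ts)) = rint M r (map (eval M (\<lambda>i. h (e i))) ts)"
    by (simp only: map_map)
  then show ?case by (simp add: pullback_def)
next
  case (Exi i \<phi>)
  then have wf: "wf_fm L \<phi>" by simp
  have upd: "(\<lambda>j. h ((e(i := x)) j)) = (\<lambda>j. h (e j))(i := h x)" for x by auto
  have "sat (pullback h M) (e(i := x)) \<phi> = sat M ((\<lambda>j. h (e j))(i := h x)) \<phi>" for x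
    using Exi.IH[OF wf, of "e(i := x)"] unfolding upd .
  moreover have "univ (pullback h M) = UNIV" by (simp add: pullback_def)
  ultimately have "sat (pullback h M) e (Exi i \<phi>) \<longleftrightarrow> (\<exists>x. sat M ((\<lambda>j. h (e j))(i := h x)) \<phi>)"
    by simp
  also have "\<dots> \<longleftrightarrow> sat M (\<lambda>j. h (e j)) (Exi i \<phi>)"
  proof
    assume "\<exists>x. sat M ((\<lambda>j. h (e j))(i := h x)) \<phi>"
    moreover have "range h \<subseteq> univ M" using assms(1) by (simp add: tv_closed_def)
    ultimately show "sat M (\<lambda>j. h (e j)) (Exi i \<phi>)" by auto
  next
    assume "sat M (\<lambda>j. h (e j)) (Exi i \<phi>)"
    from tv_closedD[OF assms(1) wf _ this]
    show "\<exists>x. sat M ((\<lambda>j. h (e j))(i := h x)) \<phi>" by auto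
  qed
  finally show ?case .
qed auto

lemma pullback_model:
  assumes "tv_closed L M (range h)" "is_model L M T" "inj h" "T \<subseteq> sentences L"
  shows "is_model L (pullback h M) T"
proof -
  have st: "is_struct L M" using assms(2) by (simp add: is_model_def)
  have "sat (pullback h M) e \<phi>" if "\<phi> \<in> T" for \<phi> e
  proof -
    have "wf_fm L \<phi>" using that assms(4) by (auto simp: sentences_def)
    moreover have "range (\<lambda>i. h (e i)) \<subseteq> univ M" using assms(1) by (auto simp: tv_closed_def)
    ultimately show ?thesis
      using sat_pullback[OF assms(1) st assms(3)] assms(2) that by (auto simp: is_model_def)
  qed
  then show ?thesis by (auto simp: is_model_def is_struct_def pullback_def)
qed

lemma eval_iso:
  assumes iso: "\<forall>f \<in> funs L. \<forall>xs \<in> tuples (univ S) (farity L f). h (fint S f xs) = fint S' f (map h xs)"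
    and "is_struct L S" "wf_tm L t" "range e \<subseteq> univ S"
  shows "eval S e t \<in> univ S \<and> h (eval S e t) = eval S' (\<lambda>i. h (e i)) t"
  using assms(3)
proof (induction t)
  case (App f ts)
  then have IH: "map (h \<circ> eval S e) ts = map (eval S' (\<lambda>i. h (e i))) ts"
    "map (eval S e) ts \<in> tuples (univ S) (farity L f)" "f \<in> funs L"
    by (auto simp: list_all_iff tuples_def)
  then have "h (fint S f (map (eval S e) ts)) = fint S' f (map h (map (eval S e) ts))"
    using iso by blast
  also have "\<dots> = fint S' f (map (eval S' (\<lambda>i. h (e i))) ts)" by (simp only: map_map IH(1))
  finally show ?case using IH assms(2) by (auto simp: is_struct_def)
qed (use assms(4) in auto)

lemma sat_iso:
  assumes h: "bij_betw h (univ S) (univ S')"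
    "\<forall>f \<in> funs L. \<forall>xs \<in> tuples (univ S) (farity L f). h (fint S f xs) = fint S' f (map h xs)"
    "\<forall>r \<in> rels L. \<forall>xs \<in> tuples (univ S) (rarity L r). rint S r xs \<longleftrightarrow> rint S' r (map h xs)"
    and "is_struct L S" "wf_fm L \<phi>" "range e \<subseteq> univ S"
  shows "sat S e \<phi> = sat S' (\<lambda>i. h (e i)) \<phi>"
  using assms(5,6)
proof (induction \<phi> arbitrary: e)
  case (Eq s t)
  then have "eval S e s \<in> univ S" "eval S e t \<in> univ S"
    "h (eval S e s) = eval S' (\<lambda>i. h (e i)) s" "h (eval S e t) = eval S' (\<lambda>i. h (e i)) t"
    using eval_iso[OF h(2) assms(4)] by auto
  then show ?case using h(1) by (auto simp: bij_betw_def dest: inj_onD) (metis inj_onD)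
next
  case (Rel r ts)
  then have *: "map (h \<circ> eval S e) ts = map (eval S' (\<lambda>i. h (e i))) ts"
    "map (eval S e) ts \<in> tuples (univ S) (rarity L r)" "r \<in> rels L"
    using eval_iso[OF h(2) assms(4)] by (auto simp: list_all_iff tuples_def)
  then have "rint S r (map (eval S e) ts) = rint S' r (map h (map (eval S e) ts))"
    using h(3) by blast
  also have "\<dots> = rint S' r (map (eval S' (\<lambda>i. h (e i))) ts)" by (simp only: map_map *(1))
  finally show ?case by simp
next
  case (Exi i \<phi>)
  have upd: "(\<lambda>j. h ((e(i := x)) j)) = (\<lambda>j. h (e j))(i := h x)" for x by auto
  have "sat S (e(i := x)) \<phi> = sat S' ((\<lambda>j. h (e j))(i := h x)) \<phi>" if "x \<in> univ S" for x
    unfolding upd[symmetric] by (rule Exi.IH) (use Exi.prems that in auto)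
  moreover have "univ S' = h ` univ S" using h(1) by (simp add: bij_betw_def)
  ultimately show ?case by auto
qed auto

text \<open>A formula sees finitely many variables, so witnesses can be indexed by a formula, a
  variable and a finite list of values. This keeps every stage of the closing process countable,
  which indexing by whole assignments would not.\<close>

lemma skolem_hull_ex:
  assumes "countable_lang L" "univ M \<noteq> {}" "finite A" "A \<subseteq> univ M"
  shows "\<exists>U. countable U \<and> tv_closed L M U \<and> A \<subseteq> U"
proof -
  obtain u where u: "u \<in> univ M" using assms(2) by blast
  let ?e = "\<lambda>es i. if i < length es then es ! i else u"
  define wit where "wit \<phi> i es =
    (if sat M (?e es) (Exi i \<phi>) then SOME x. x \<in> univ M \<and> sat M ((?e es)(i := x)) \<phi> else u)" for \<phi> i es
  have wit: "wit \<phi> i es \<in> univ M \<and> sat M ((?e es)(i := wit \<phi> i es)) \<phi>"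
    if "sat M (?e es) (Exi i \<phi>)" for \<phi> i es
  proof -
    have "\<exists>x. x \<in> univ M \<and> sat M ((?e es)(i := x)) \<phi>" using that by auto
    from someI_ex[OF this] show ?thesis using that unfolding wit_def by presburger
  qed
  have wit_univ: "wit \<phi> i es \<in> univ M" for \<phi> i es
    using wit[of es i \<phi>] u by (cases "sat M (?e es) (Exi i \<phi>)") (auto simp: wit_def)
  define step where "step V = V \<union> (\<lambda>(\<phi>, i, es). wit \<phi> i es) ` ({\<phi>. wf_fm L \<phi>} \<times> UNIV \<times> lists V)" for V
  define V where "V n = (step ^^ n) (insert u A)" for n
  have cnt: "countable (V n)" for n
  proof (induction n)
    case 0
    show ?case using assms(3) by (simp add: V_def countable_finite)
  next
    case (Suc n)
    then have "countable ({\<phi>. wf_fm L \<phi>} \<times> (UNIV :: nat set) \<times> lists (V n))"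
      using countable_formulas[OF assms(1)] by (intro countable_SIGMA countable_lists) auto
    then show ?case using Suc by (simp add: V_def step_def)
  qed
  have univ: "V n \<subseteq> univ M" for n
    by (induction n) (use assms(4) u wit_univ in \<open>auto simp: V_def step_def\<close>)
  have mono: "V m \<subseteq> V n" if "m \<le> n" for m n
    using that by (induction rule: dec_induct) (auto simp: V_def step_def)
  let ?U = "\<Union>n. V n"
  have fin: "\<exists>n. F \<subseteq> V n" if "finite F" "F \<subseteq> ?U" for F
    using that
  proof (induction F)
    case (insert x F)
    then obtain m n where "F \<subseteq> V m" "x \<in> V n" by auto
    then have "insert x F \<subseteq> V (max m n)" using mono[of m "max m n"] mono[of n "max m n"] by auto
    then show ?case by blast
  qed simp
  have "\<exists>x \<in> ?U. sat M (e(i := x)) \<phi>"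
    if \<phi>: "wf_fm L \<phi>" "range e \<subseteq> ?U" "sat M e (Exi i \<phi>)" for \<phi> i e
  proof -
    obtain k where k: "fv \<phi> \<subseteq> {..<k}" using finite_fv[of \<phi>] by (meson finite_nat_iff_bounded)
    let ?es = "map e [0..<k]"
    have "set ?es \<subseteq> ?U" using \<phi>(2) by auto
    from fin[OF _ this] obtain n where n: "set ?es \<subseteq> V n" by auto
    have "sat M (?e ?es) (Exi i \<phi>)"
      using \<phi>(3) by (subst sat_cong[where e' = e]) (use k in auto)
    from wit[OF this] have "sat M ((?e ?es)(i := wit \<phi> i ?es)) \<phi>" by blast
    then have "sat M (e(i := wit \<phi> i ?es)) \<phi>"
      by (subst (asm) sat_cong[where e' = "e(i := wit \<phi> i ?es)"]) (use k in auto)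
    moreover have "wit \<phi> i ?es \<in> V (Suc n)"
    proof -
      have "(\<phi>, i, ?es) \<in> {\<phi>. wf_fm L \<phi>} \<times> UNIV \<times> lists (V n)" using \<phi>(1) n by auto
      then have "wit \<phi> i ?es \<in> step (V n)" unfolding step_def by force
      then show ?thesis by (simp add: V_def)
    qed
    ultimately show ?thesis by blast
  qed
  moreover have "u \<in> ?U" "A \<subseteq> ?U" using V_def[of 0] by auto
  ultimately have "tv_closed L M ?U" using univ unfolding tv_closed_def by blast
  then show ?thesis using cnt \<open>A \<subseteq> ?U\<close> by (intro exI[of _ ?U]) auto
qed


section \<open>The Ryll-Nardzewski theorem\<close>

context saturated_model
begin

text \<open>The formulas may involve more and more variables, so saturation for tuples of a fixed
  length does not suffice. Values are fixed one variable at a time over the finitely many earlier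
  ones, keeping each \<open>\<theta> n\<close> satisfiable; as every formula has finitely many
  variables, the limit assignment satisfies all of them.\<close>

lemma realize_descending:
  assumes wf: "\<And>n. wf_fm L (\<theta> n)" and con: "\<And>n. \<exists>e \<in> assignments M. sat M e (\<theta> n)"
    and desc: "\<And>n e. e \<in> assignments M \<Longrightarrow> sat M e (\<theta> (Suc n)) \<Longrightarrow> sat M e (\<theta> n)"
  shows "\<exists>c \<in> assignments M. \<forall>n. sat M c (\<theta> n)"
proof -
  have desc': "sat M e (\<theta> m)" if "e \<in> assignments M" "sat M e (\<theta> n)" "m \<le> n" for e m n
    using that(3,2)
  proof (induction rule: dec_induct)
    case (step n)
    show ?case by (rule step.IH[OF desc[OF that(1) step.prems]])
  qed
  \<comment> \<open>The extension of \<open>cs\<close> may depend on \<open>n\<close>; a common one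
    is obtained only in the limit.\<close>
  define Q where "Q cs \<longleftrightarrow> set cs \<subseteq> univ M \<and>
    (\<forall>n. \<exists>e \<in> assignments M. map e [0..<length cs] = cs \<and> sat M e (\<theta> n))" for cs
  have Q_Nil: "Q []" using con by (simp add: Q_def)
  have Q_step: "\<exists>x. Q (cs @ [x])" if cs: "Q cs" for cs
  proof -
    let ?m = "length cs"
    let ?P = "\<lambda>n xs. \<exists>e \<in> assignments M. sat M e (\<theta> n) \<and> map e [0..<Suc ?m] = cs @ xs"
    have cs_univ: "set cs \<subseteq> univ M" using cs by (simp add: Q_def)
    have "\<exists>x \<in> univ M. \<forall>P \<in> range ?P. P [x]"
    proof (rule saturation_one[of "set cs"])
      show "set cs \<subseteq> univ M" "small \<kappa> (set cs)" using cs_univ small_finite by auto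
      fix P assume "P \<in> range ?P"
      then obtain n where P: "P = ?P n" by blast
      have "\<exists>\<chi>. wf_fm L \<chi> \<and> fv \<chi> \<subseteq> {..<length [0..<Suc ?m]} \<and>
        (\<forall>ys \<in> tuples (univ M) (length [0..<Suc ?m]). sat M ((!) ys) \<chi> \<longleftrightarrow>
          (\<exists>e \<in> assignments M. sat M e (\<theta> n) \<and> map e [0..<Suc ?m] = ys))"
        by (rule projection_ex[OF wf univ_nonempty])
      then obtain \<chi> where \<chi>: "wf_fm L \<chi>" "fv \<chi> \<subseteq> {..<Suc ?m}"
        "\<forall>ys \<in> tuples (univ M) (Suc ?m). sat M ((!) ys) \<chi> \<longleftrightarrow>
          (\<exists>e \<in> assignments M. sat M e (\<theta> n) \<and> map e [0..<Suc ?m] = ys)"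
        unfolding length_upt diff_zero by (elim exE conjE) (rule that)
      \<comment> \<open>The new element is last in the tuple described by \<open>\<chi>\<close> but
        comes before the parameters in \<open>pdef\<close>.\<close>
      let ?f = "\<lambda>i. if i < ?m then Suc i else 0"
      from rename_ex[OF \<chi>(1), of ?f] obtain \<psi> where \<psi>: "wf_fm L \<psi>" "fv \<psi> \<subseteq> ?f ` fv \<chi>"
        "\<And>e. sat M e \<psi> = sat M (\<lambda>i. e (?f i)) \<chi>" by blast
      show "pdef L M (set cs) 1 P"
      proof (rule pdefI[OF \<psi>(1) order_refl])
        show "fv \<psi> \<subseteq> {..<1 + ?m}" using \<psi>(2) by (auto split: if_splits)
        fix xs assume "xs \<in> tuples (univ M) 1"
        then obtain x where x: "xs = [x]" "x \<in> univ M" by (auto simp: tuples_def length_Suc_conv)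
        have "cs @ xs \<in> tuples (univ M) (Suc ?m)" using x cs_univ by (auto simp: tuples_def)
        from bspec[OF \<chi>(3) this] have "P xs \<longleftrightarrow> sat M ((!) (cs @ xs)) \<chi>" by (simp only: P)
        also have "\<dots> \<longleftrightarrow> sat M ((!) (xs @ cs)) \<psi>"
          unfolding \<psi>(3) by (rule sat_cong) (use x \<chi>(2) in \<open>auto simp: nth_append less_Suc_eq\<close>)
        finally show "P xs \<longleftrightarrow> sat M ((!) (xs @ cs)) \<psi>" .
      qed
    next
      fix F assume "finite F" "F \<subseteq> range ?P"
      from finite_subset_image[OF this] obtain I where I: "finite I" "F = ?P ` I"
        by (elim exE conjE) (rule that)
      \<comment> \<open>The sequence descends, so a bound for the indices in \<open>I\<close> takes
        care of all of them.\<close>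
      obtain N where N: "\<And>n. n \<in> I \<Longrightarrow> n \<le> N" using I(1) by (meson finite_nat_set_iff_bounded_le)
      obtain e where e: "e \<in> assignments M" "map e [0..<?m] = cs" "sat M e (\<theta> N)"
        using cs unfolding Q_def by blast
      have "?P n [e ?m]" if "n \<in> I" for n
        using e desc'[OF e(1,3) N[OF that]] by (intro bexI[of _ e] conjI) auto
      moreover have "e ?m \<in> univ M" using e(1) by blast
      ultimately show "\<exists>x \<in> univ M. \<forall>P \<in> F. P [x]"
        unfolding I(2) by (intro bexI[of _ "e ?m"]) auto
    qed
    then obtain x where x: "x \<in> univ M" "\<forall>P \<in> range ?P. P [x]" by (elim bexE) (rule that)
    have "?P n [x]" for n by (rule bspec[OF x(2)]) simp
    then have "\<forall>n. \<exists>e \<in> assignments M. map e [0..<length (cs @ [x])] = cs @ [x] \<and> sat M e (\<theta> n)"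
      unfolding length_append_singleton by blast
    moreover have "set (cs @ [x]) \<subseteq> univ M" using cs_univ x(1) by simp
    ultimately have "Q (cs @ [x])" unfolding Q_def by (rule conjI[rotated])
    then show ?thesis ..
  qed
  have "\<exists>css. \<forall>n. (length (css n) = n \<and> Q (css n)) \<and> (\<exists>x. css (Suc n) = css n @ [x])"
  proof (rule dependent_nat_choice)
    show "\<exists>cs. length cs = 0 \<and> Q cs" using Q_Nil by simp
    fix cs n assume "length cs = n \<and> Q cs"
    then show "\<exists>ds. (length ds = Suc n \<and> Q ds) \<and> (\<exists>x. ds = cs @ [x])"
      using Q_step[of cs] by (metis length_append_singleton)
  qed
  then obtain css where css: "\<And>n. length (css n) = n" "\<And>n. Q (css n)" "\<And>n. \<exists>x. css (Suc n) = css n @ [x]"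
    by metis
  define c where "c i = css (Suc i) ! i" for i
  have css_c: "css n = map c [0..<n]" for n
  proof (induction n)
    case 0
    show ?case using css(1)[of 0] by simp
  next
    case (Suc n)
    obtain x where "css (Suc n) = css n @ [x]" using css(3) by blast
    moreover from this have "c n = x" using css(1)[of n] by (simp add: c_def nth_append)
    ultimately show ?case using Suc by simp
  qed
  have "c i \<in> univ M" for i
    using css(2)[of "Suc i"] unfolding css_c Q_def by auto
  moreover have "sat M c (\<theta> n)" for n
  proof -
    obtain k where k: "fv (\<theta> n) \<subseteq> {..<k}" using finite_fv[of "\<theta> n"] by (meson finite_nat_iff_bounded)
    obtain e where e: "map e [0..<k] = map c [0..<k]" "sat M e (\<theta> n)"
      using css(2)[of k] unfolding css_c Q_def length_map length_upt diff_zero by blast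
    then show ?thesis using k by (subst sat_cong[where e' = e]) auto
  qed
  ultimately show ?thesis by blast
qed

text \<open>Formulas act as forcing conditions, ordered by the sets of assignments that satisfy them, and
  the members of \<open>\<D>\<close> as dense sets.\<close>

lemma generic_assignment_ex:
  assumes cnt: "countable \<D>" "\<D> \<noteq> {}"
    and dense: "\<And>D \<theta>. D \<in> \<D> \<Longrightarrow> wf_fm L \<theta> \<Longrightarrow> \<exists>e \<in> assignments M. sat M e \<theta> \<Longrightarrow>
      \<exists>\<eta> \<in> D. wf_fm L \<eta> \<and> (\<exists>e \<in> assignments M. sat M e \<eta> \<and> sat M e \<theta>)"
  shows "\<exists>c \<in> assignments M. \<forall>D \<in> \<D>. \<exists>\<eta> \<in> D. sat M c \<eta>"
proof -
  let ?con = "\<lambda>\<theta>. wf_fm L \<theta> \<and> (\<exists>e \<in> assignments M. sat M e \<theta>)"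
  \<comment> \<open>Conjoining a member of the \<open>n\<close>-th dense set meets that set and
    makes the sequence descend at the same time.\<close>
  let ?next = "\<lambda>n \<theta> \<theta>'. \<exists>\<eta> \<in> from_nat_into \<D> n. \<theta>' = Conj \<eta> \<theta>"
  have "\<exists>\<theta>. \<forall>n. ?con (\<theta> n) \<and> ?next n (\<theta> n) (\<theta> (Suc n))"
  proof (rule dependent_nat_choice)
    obtain u where "u \<in> univ M" using univ_nonempty by blast
    then have "(\<lambda>_. u) \<in> assignments M" by auto
    then have "?con (Eq (Var 0) (Var 0))" by (auto intro!: bexI[of _ "\<lambda>_. u"])
    then show "\<exists>\<theta>. ?con \<theta>" by blast
    fix \<theta> n assume \<theta>: "?con \<theta>"
    have "from_nat_into \<D> n \<in> \<D>" using cnt(2) by (rule from_nat_into)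
    from dense[OF this, of \<theta>] \<theta> obtain \<eta> where "\<eta> \<in> from_nat_into \<D> n" "wf_fm L \<eta>"
      "\<exists>e \<in> assignments M. sat M e \<eta> \<and> sat M e \<theta>" by blast
    then show "\<exists>\<theta>'. ?con \<theta>' \<and> ?next n \<theta> \<theta>'"
      using \<theta> by (intro exI[of _ "Conj \<eta> \<theta>"]) auto
  qed
  then obtain \<theta> where \<theta>: "\<And>n. wf_fm L (\<theta> n)" "\<And>n. \<exists>e \<in> assignments M. sat M e (\<theta> n)"
    "\<And>n. ?next n (\<theta> n) (\<theta> (Suc n))" by blast
  have "\<exists>c \<in> assignments M. \<forall>n. sat M c (\<theta> n)"
  proof (rule realize_descending[OF \<theta>(1,2)])
    fix n e assume "sat M e (\<theta> (Suc n))"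
    then show "sat M e (\<theta> n)" using \<theta>(3)[of n] by auto
  qed
  then obtain c where c: "c \<in> assignments M" "\<And>n. sat M c (\<theta> n)" by blast
  have "\<exists>\<eta> \<in> D. sat M c \<eta>" if D: "D \<in> \<D>" for D
  proof -
    obtain n where n: "D = from_nat_into \<D> n"
      using from_nat_into_surj[OF cnt(1) D] by auto
    obtain \<eta> where \<eta>: "\<eta> \<in> D" "\<theta> (Suc n) = Conj \<eta> (\<theta> n)" using \<theta>(3)[of n] n by blast
    have "sat M c (\<theta> (Suc n))" by (rule c(2))
    then have "sat M c \<eta>" by (simp add: \<eta>(2))
    with \<eta>(1) show ?thesis by blast
  qed
  then show ?thesis using c(1) by blast
qed

text \<open>The model omitting the type is found inside \<open>M\<close> as the range of a generic
  assignment: by \<open>D1\<close> the range satisfies the Tarski-Vaught criterion, and by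
  \<open>D2\<close> none of its tuples has the type of \<open>a\<close>. Density of
  \<open>D2\<close> comes from non-isolation.\<close>

lemma omitting_types:
  assumes cnt: "countable_lang L" and a: "length a = k"
    and noniso: "\<And>\<chi>. wf_fm L \<chi> \<Longrightarrow> fv \<chi> \<subseteq> {..<k} \<Longrightarrow> \<exists>ys \<in> tuples (univ M) k. sat M ((!) ys) \<chi> \<Longrightarrow>
      \<exists>ys \<in> tuples (univ M) k. sat M ((!) ys) \<chi> \<and> \<not> eqtp L M a ys"
  shows "\<exists>U. countable U \<and> tv_closed L M U \<and> (\<forall>ys \<in> tuples U k. \<not> eqtp L M a ys)"
proof -
  \<comment> \<open>The conditions that refute \<open>Exi i \<phi>\<close> or name a witness for it
    by some variable \<open>j\<close>.\<close>
  define D1 where "D1 = (\<lambda>(\<phi>, i). {\<theta>. (\<forall>e \<in> assignments M. sat M e \<theta> \<longrightarrow> \<not> sat M e (Exi i \<phi>)) \<or>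
    (\<exists>j. \<forall>e \<in> assignments M. sat M e \<theta> \<longrightarrow> sat M (e(i := e j)) \<phi>)})"
  define D2 where "D2 js = {\<theta>. \<exists>\<psi>. wf_fm L \<psi> \<and> fv \<psi> \<subseteq> {..<k} \<and> sat M ((!) a) \<psi> \<and>
    (\<forall>e \<in> assignments M. sat M e \<theta> \<longrightarrow> \<not> sat M ((!) (map e js)) \<psi>)}" for js
  let ?\<D> = "D1 ` ({\<phi>. wf_fm L \<phi>} \<times> UNIV) \<union> D2 ` {js. length js = k}"
  have "\<exists>c \<in> assignments M. \<forall>D \<in> ?\<D>. \<exists>\<eta> \<in> D. sat M c \<eta>"
  proof (rule generic_assignment_ex)
    show "countable ?\<D>"
      using countable_formulas[OF cnt] by (intro countable_Un countable_image countable_SIGMA) auto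
    show "?\<D> \<noteq> {}" using Ex_list_of_length[of k] by blast
  next
    fix D \<theta> assume D: "D \<in> ?\<D>" and wf: "wf_fm L \<theta>" and con: "\<exists>e \<in> assignments M. sat M e \<theta>"
    let ?goal = "\<exists>\<eta> \<in> D. wf_fm L \<eta> \<and> (\<exists>e \<in> assignments M. sat M e \<eta> \<and> sat M e \<theta>)"
    from D consider (wit) \<phi> i where "wf_fm L \<phi>" "D = D1 (\<phi>, i)" | (omit) js where "length js = k" "D = D2 js"
      by auto
    then show ?goal
    proof cases
      case wit
      show ?goal
      proof (cases "\<exists>e \<in> assignments M. sat M e \<theta> \<and> sat M e (Exi i \<phi>)")
        case False
        then have "\<theta> \<in> D" unfolding wit(2) D1_def by blast
        then show ?thesis using wf con by blast
      next
        case True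
        then obtain e x where e: "e \<in> assignments M" "sat M e \<theta>" "x \<in> univ M" "sat M (e(i := x)) \<phi>"
          by auto
        \<comment> \<open>A variable not mentioned by the condition is available as a name for the
          witness.\<close>
        obtain j where j: "j \<notin> fv \<theta> \<union> fv \<phi> \<union> {i}"
          using ex_new_if_finite[OF infinite_UNIV_nat, of "fv \<theta> \<union> fv \<phi> \<union> {i}"] finite_fv by blast
        let ?f = "\<lambda>v. if v = i then j else v"
        from rename_ex[OF wit(1), of ?f] obtain \<psi> where \<psi>: "wf_fm L \<psi>"
          "\<And>e. sat M e \<psi> = sat M (\<lambda>v. e (?f v)) \<phi>" by blast
        have \<psi>': "sat M e' \<psi> = sat M (e'(i := e' j)) \<phi>" for e'
          unfolding \<psi>(2) by (rule sat_cong) auto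
        have "\<psi> \<in> D" unfolding wit(2) D1_def using \<psi>' by auto
        moreover have "sat M (e(j := x)) \<theta>"
          using e(2) j by (subst sat_cong[where e' = e]) auto
        moreover have "sat M (e(j := x)) \<psi>"
          unfolding \<psi>' using e(4) j by (subst sat_cong[where e' = "e(i := x)"]) auto
        moreover have "e(j := x) \<in> assignments M" using e(1,3) by auto
        ultimately show ?thesis using \<psi>(1) by blast
      qed
    next
      case omit
      \<comment> \<open>\<open>\<chi>\<close> describes the tuples that can occur at
        \<open>js\<close> under the condition \<open>\<theta>\<close>. It does not isolate the type
        of \<open>a\<close>, so one of these tuples has another type and violates a formula of the
        type of \<open>a\<close>.\<close>
      have "\<exists>\<chi>. wf_fm L \<chi> \<and> fv \<chi> \<subseteq> {..<length js} \<and> (\<forall>ys \<in> tuples (univ M) (length js).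
        sat M ((!) ys) \<chi> \<longleftrightarrow> (\<exists>e \<in> assignments M. sat M e \<theta> \<and> map e js = ys))"
        by (rule projection_ex[OF wf univ_nonempty])
      then obtain \<chi> where \<chi>: "wf_fm L \<chi>" "fv \<chi> \<subseteq> {..<k}" "\<forall>ys \<in> tuples (univ M) k.
        sat M ((!) ys) \<chi> \<longleftrightarrow> (\<exists>e \<in> assignments M. sat M e \<theta> \<and> map e js = ys)"
        unfolding omit(1) by (elim exE conjE) (rule that)
      obtain e where e: "e \<in> assignments M" "sat M e \<theta>" using con by blast
      then have "map e js \<in> tuples (univ M) k" using omit(1) by (auto simp: tuples_def)
      with bspec[OF \<chi>(3) this] e have "\<exists>ys \<in> tuples (univ M) k. sat M ((!) ys) \<chi>" by blast
      from noniso[OF \<chi>(1,2) this] obtain ys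
        where ys: "ys \<in> tuples (univ M) k" "sat M ((!) ys) \<chi>" "\<not> eqtp L M a ys" by blast
      obtain e where e: "e \<in> assignments M" "sat M e \<theta>" "map e js = ys"
        using bspec[OF \<chi>(3) ys(1)] ys(2) by blast
      have "length a = length ys" using a ys(1) by (simp add: tuples_def)
      from eqtp_witness[OF ys(3) this] obtain \<psi> where \<psi>: "wf_fm L \<psi>" "fv \<psi> \<subseteq> {..<k}"
        "sat M ((!) a) \<psi>" "\<not> sat M ((!) ys) \<psi>" using a by blast
      from rename_ex[OF \<psi>(1), of "(!) js"] obtain \<psi>' where \<psi>': "wf_fm L \<psi>'"
        "\<And>e. sat M e \<psi>' = sat M (\<lambda>i. e (js ! i)) \<psi>" by blast
      have sat': "sat M e' \<psi>' = sat M ((!) (map e' js)) \<psi>" for e'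
        unfolding \<psi>'(2) by (rule sat_cong) (use \<psi>(2) omit(1) in auto)
      have "Neg \<psi>' \<in> D"
        unfolding omit(2) D2_def using \<psi> sat' by (auto intro!: exI[of _ \<psi>])
      moreover have "sat M e (Neg \<psi>')" using sat'[of e] e(3) \<psi>(4) by simp
      ultimately show ?goal using \<psi>'(1) e(1,2) by (intro bexI[of _ "Neg \<psi>'"]) auto
    qed
  qed
  then obtain c where c: "c \<in> assignments M" "\<forall>D \<in> ?\<D>. \<exists>\<eta> \<in> D. sat M c \<eta>"
    by (elim bexE) (rule that)
  have "\<exists>x \<in> range c. sat M (e(i := x)) \<phi>"
    if \<phi>: "wf_fm L \<phi>" "range e \<subseteq> range c" "sat M e (Exi i \<phi>)" for \<phi> i e
  proof -
    \<comment> \<open>Parameters in the range of \<open>c\<close> are values of variables, so the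
      formula can be renamed into one evaluated at \<open>c\<close> itself, where genericity
      applies.\<close>
    have "\<forall>v. \<exists>w. e v = c w" using \<phi>(2) by blast
    then obtain f where f: "\<And>v. e v = c (f v)" by metis
    obtain j where j: "j \<notin> f ` fv \<phi>"
      using ex_new_if_finite[OF infinite_UNIV_nat, of "f ` fv \<phi>"] finite_fv[of \<phi>] by blast
    let ?f = "\<lambda>v. if v = i then j else f v"
    from rename_ex[OF \<phi>(1), of ?f] obtain \<psi> where \<psi>: "wf_fm L \<psi>"
      "\<And>e. sat M e \<psi> = sat M (\<lambda>v. e (?f v)) \<phi>" by blast
    have sat: "sat M (c(j := x)) \<psi> = sat M (e(i := x)) \<phi>" for x
      unfolding \<psi>(2) by (rule sat_cong) (use j f in auto)
    have "D1 (\<psi>, j) \<in> ?\<D>" using \<psi>(1) by blast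
    from bspec[OF c(2) this] obtain \<eta> where \<eta>: "\<eta> \<in> D1 (\<psi>, j)" "sat M c \<eta>" by blast
    have "sat M c (Exi j \<psi>)" using \<phi>(3) sat by simp
    then obtain j' where "sat M (c(j := c j')) \<psi>"
      using \<eta> c(1) unfolding D1_def by blast
    then show ?thesis using sat by blast
  qed
  then have "tv_closed L M (range c)" using c(1) unfolding tv_closed_def by blast
  moreover have "\<not> eqtp L M a ys" if "ys \<in> tuples (range c) k" for ys
  proof -
    have "ys \<in> lists (range c)" "length ys = k" using that by (auto simp: tuples_def)
    then obtain js where js: "ys = map c js" "length js = k"
      by (metis ex_map_conv in_listsD length_map rangeE)
    then have "D2 js \<in> ?\<D>" by blast
    from bspec[OF c(2) this] obtain \<eta> where "\<eta> \<in> D2 js" "sat M c \<eta>" by blast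
    then obtain \<psi> where "wf_fm L \<psi>" "fv \<psi> \<subseteq> {..<k}" "sat M ((!) a) \<psi>" "\<not> sat M ((!) ys) \<psi>"
      using c(1) unfolding D2_def js(1) by blast
    then show ?thesis using eqtp_sat[of L M a ys \<psi>] a by blast
  qed
  ultimately show ?thesis by (intro exI[of _ "range c"]) auto
qed

text \<open>Once every type is isolated, the negations of the isolating formulas cannot be realized
  together: a realization would violate the formula of its own type. By saturation, finitely many of
  the isolating formulas already cover all tuples.\<close>

theorem finite_types:
  assumes cnt: "countable_lang L" and T: "T \<subseteq> sentences L" "omega_categorical L T" "is_model L M T"
  shows "finite ((\<lambda>as. tp L M as {}) ` tuples (univ M) k)"
proof (cases "finite (univ M)")
  \<comment> \<open>Categoricity constrains infinite models only; over a finite universe there are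
    just finitely many tuples.\<close>
  case True
  then have "finite (tuples (univ M) k)"
    using finite_lists_length_eq[of "univ M" k] by (simp add: tuples_def conj_commute)
  then show ?thesis by simp
next
  case False
  have "\<exists>\<chi>. wf_fm L \<chi> \<and> fv \<chi> \<subseteq> {..<k} \<and> sat M ((!) a) \<chi> \<and>
      (\<forall>ys \<in> tuples (univ M) k. sat M ((!) ys) \<chi> \<longrightarrow> eqtp L M a ys)"
    if a: "a \<in> tuples (univ M) k" for a
  proof (rule ccontr)
    assume neg: "\<not> ?thesis"
    have len: "length a = k" using a by (simp add: tuples_def)
    have "\<exists>ys \<in> tuples (univ M) k. sat M ((!) ys) \<chi> \<and> \<not> eqtp L M a ys"
      if \<chi>: "wf_fm L \<chi>" "fv \<chi> \<subseteq> {..<k}" "\<exists>ys \<in> tuples (univ M) k. sat M ((!) ys) \<chi>" for \<chi>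
    proof (rule ccontr)
      assume neg': "\<not> ?thesis"
      then obtain ys where "sat M ((!) ys) \<chi>" "eqtp L M a ys" using \<chi>(3) by blast
      then have "sat M ((!) a) \<chi>" using eqtp_sat[of L M a ys \<chi>] \<chi> len by blast
      then show False using neg neg' \<chi>(1,2) by blast
    qed
    from omitting_types[OF cnt len this] obtain U2 where U2: "countable U2" "tv_closed L M U2"
      "\<And>ys. ys \<in> tuples U2 k \<Longrightarrow> \<not> eqtp L M a ys" by blast
    have "set a \<subseteq> univ M" using a by (simp add: tuples_def)
    from skolem_hull_ex[OF cnt univ_nonempty _ this] obtain U1 where
      U1: "countable U1" "tv_closed L M U1" "set a \<subseteq> U1" by blast
    define h1 where "h1 = from_nat_into U1"
    define h2 where "h2 = from_nat_into U2"
    have h: "inj h1" "range h1 = U1" "inj h2" "range h2 = U2"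
      using bij_betw_from_nat_into[OF U1(1) tv_closed_infinite[OF U1(2) False]]
        bij_betw_from_nat_into[OF U2(1) tv_closed_infinite[OF U2(2) False]]
      by (auto simp: h1_def h2_def bij_betw_def)
    have tv: "tv_closed L M (range h1)" "tv_closed L M (range h2)" using h U1 U2 by auto
    have m1: "is_model L (pullback h1 M) T" and m2: "is_model L (pullback h2 M) T"
      using pullback_model[OF tv(1) T(3) h(1) T(1)] pullback_model[OF tv(2) T(3) h(3) T(1)] by auto
    have "infinite (univ (pullback h1 M))" "infinite (univ (pullback h2 M))"
      by (simp_all add: pullback_def)
    then have "isomorphic L (pullback h1 M) (pullback h2 M)"
      using m1 m2 T(2) unfolding omega_categorical_def by blast
    then obtain g where g: "bij_betw g (univ (pullback h1 M)) (univ (pullback h2 M))"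
      "\<forall>f \<in> funs L. \<forall>xs \<in> tuples (univ (pullback h1 M)) (farity L f).
        g (fint (pullback h1 M) f xs) = fint (pullback h2 M) f (map g xs)"
      "\<forall>r \<in> rels L. \<forall>xs \<in> tuples (univ (pullback h1 M)) (rarity L r).
        rint (pullback h1 M) r xs \<longleftrightarrow> rint (pullback h2 M) r (map g xs)"
      unfolding isomorphic_def by (elim exE conjE) (rule that)
    have sat: "sat M (\<lambda>i. h1 (e i)) \<phi> = sat M (\<lambda>i. h2 (g (e i))) \<phi>" if "wf_fm L \<phi>" for e \<phi>
    proof -
      have "sat M (\<lambda>i. h1 (e i)) \<phi> = sat (pullback h1 M) e \<phi>"
        using sat_pullback[OF tv(1) struct h(1) that] by simp
      also have "\<dots> = sat (pullback h2 M) (\<lambda>i. g (e i)) \<phi>"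
        by (rule sat_iso[OF g _ that]) (use m1 in \<open>auto simp: is_model_def pullback_def\<close>)
      also have "\<dots> = sat M (\<lambda>i. h2 (g (e i))) \<phi>"
        by (rule sat_pullback[OF tv(2) struct h(3) that])
      finally show ?thesis .
    qed
    have "\<exists>ns. a = map h1 ns" using U1(3) h(2) by (metis ex_map_conv rangeE subsetD)
    then obtain ns where ns: "a = map h1 ns" ..
    have "eqtp L M a (map (\<lambda>n. h2 (g n)) ns)"
      unfolding eqtp_def
    proof (intro conjI allI impI)
      fix \<phi> assume \<phi>: "wf_fm L \<phi> \<and> fv \<phi> \<subseteq> {..<length a}"
      have "sat M ((!) a) \<phi> = sat M (\<lambda>i. h1 (ns ! i)) \<phi>"
        by (rule sat_cong) (use \<phi> ns in auto)
      also have "\<dots> = sat M (\<lambda>i. h2 (g (ns ! i))) \<phi>" using sat \<phi> by blast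
      also have "\<dots> = sat M ((!) (map (\<lambda>n. h2 (g n)) ns)) \<phi>"
        by (rule sat_cong) (use \<phi> ns in auto)
      finally show "sat M ((!) a) \<phi> = sat M ((!) (map (\<lambda>n. h2 (g n)) ns)) \<phi>" .
    qed (simp add: ns)
    moreover have "map (\<lambda>n. h2 (g n)) ns \<in> tuples U2 k"
      using h(4) len ns by (auto simp: tuples_def)
    ultimately show False using U2(3) by blast
  qed
  then have "\<forall>a \<in> tuples (univ M) k. \<exists>\<chi>. wf_fm L \<chi> \<and> fv \<chi> \<subseteq> {..<k} \<and> sat M ((!) a) \<chi> \<and>
      (\<forall>ys \<in> tuples (univ M) k. sat M ((!) ys) \<chi> \<longrightarrow> eqtp L M a ys)" by blast
  from bchoice[OF this] obtain \<chi> where \<chi>: "\<And>a. a \<in> tuples (univ M) k \<Longrightarrow> wf_fm L (\<chi> a) \<and>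
      fv (\<chi> a) \<subseteq> {..<k} \<and> sat M ((!) a) (\<chi> a) \<and>
      (\<forall>ys \<in> tuples (univ M) k. sat M ((!) ys) (\<chi> a) \<longrightarrow> eqtp L M a ys)" by blast
  let ?P = "\<lambda>a ys. \<not> sat M ((!) ys) (\<chi> a)"
  have "\<exists>F. finite F \<and> F \<subseteq> ?P ` tuples (univ M) k \<and> \<not> (\<exists>xs \<in> tuples (univ M) k. \<forall>P \<in> F. P xs)"
  proof (rule ccontr)
    assume neg: "\<not> ?thesis"
    have "\<exists>xs \<in> tuples (univ M) k. \<forall>P \<in> ?P ` tuples (univ M) k. P xs"
    proof (rule saturation[of "{}"])
      fix P assume "P \<in> ?P ` tuples (univ M) k"
      then obtain a where "a \<in> tuples (univ M) k" "P = ?P a" by blast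
      then show "pdef L M {} k P" using \<chi> by (intro pdefI[of L "Neg (\<chi> a)" "[]"]) auto
    qed (use neg small_finite in auto)
    then obtain xs where xs: "xs \<in> tuples (univ M) k" "\<forall>P \<in> ?P ` tuples (univ M) k. P xs"
      by (elim bexE) (rule that)
    from bspec[OF xs(2) imageI[OF xs(1)]] show False using \<chi>[OF xs(1)] by blast
  qed
  then obtain F where F: "finite F" "F \<subseteq> ?P ` tuples (univ M) k"
    "\<not> (\<exists>xs \<in> tuples (univ M) k. \<forall>P \<in> F. P xs)" by (elim exE conjE) (rule that)
  from finite_subset_image[OF F(1,2)] obtain A where
    A: "A \<subseteq> tuples (univ M) k" "finite A" "F = ?P ` A" by (elim exE conjE) (rule that)
  have "tp L M xs {} \<in> (\<lambda>as. tp L M as {}) ` A" if xs: "xs \<in> tuples (univ M) k" for xs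
  proof -
    obtain a where a: "a \<in> A" "sat M ((!) xs) (\<chi> a)" using F(3) A(3) xs by auto
    then have "eqtp L M a xs" using \<chi>[of a] A(1) xs by blast
    then have "tp L M a {} = tp L M xs {}" using tp_eq_iff[of a xs L M] eqtp_length by blast
    then show ?thesis using a(1) by (intro image_eqI[of _ _ a]) simp_all
  qed
  then have "(\<lambda>as. tp L M as {}) ` tuples (univ M) k \<subseteq> (\<lambda>as. tp L M as {}) ` A" by blast
  then show ?thesis using A(2) finite_surj by blast
qed

end


section \<open>Definable sets with finitely many types\<close>

text \<open>The chains unfolded from the successor step of \<open>rank_ge\<close>: each entry avoids
  the closure of the base together with the earlier entries. Order matters, since closure need not
  satisfy exchange.\<close>

primrec indep_seq :: "('a set \<Rightarrow> 'a set) \<Rightarrow> 'a set \<Rightarrow> 'a list \<Rightarrow> bool" where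
  "indep_seq cl B [] \<longleftrightarrow> True"
| "indep_seq cl B (x # xs) \<longleftrightarrow> x \<notin> cl B \<and> indep_seq cl (insert x B) xs"

text \<open>The variable to be quantified moves from the front to position \<open>k\<close>, behind
  the tuple, so that the remaining variables number \<open>xs\<close> from 0.\<close>

lemma exists_head_ex:
  fixes M :: "('f, 'r, 'm) struct"
  assumes "wf_fm L \<phi>" "fv \<phi> \<subseteq> {..<Suc k}"
  shows "\<exists>\<psi>. wf_fm L \<psi> \<and> fv \<psi> \<subseteq> {..<k} \<and> (\<forall>xs. length xs = k \<longrightarrow>
    (sat M ((!) xs) \<psi> \<longleftrightarrow> (\<exists>x \<in> univ M. sat M ((!) (x # xs)) \<phi>)))"
proof -
  let ?f = "\<lambda>i. if i = 0 then k else i - 1"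
  from rename_ex[OF assms(1), of ?f] obtain \<psi> where \<psi>: "wf_fm L \<psi>" "fv \<psi> \<subseteq> ?f ` fv \<phi>"
    "\<And>e. sat M e \<psi> = sat M (\<lambda>i. e (?f i)) \<phi>" by blast
  have "sat M (((!) xs)(k := x)) \<psi> = sat M ((!) (x # xs)) \<phi>" if "length xs = k" for x xs
    unfolding \<psi>(3) by (rule sat_cong) (use assms(2) that in \<open>auto simp: nth_Cons split: nat.splits\<close>)
  moreover have "fv (Exi k \<psi>) \<subseteq> {..<k}"
  proof
    fix v assume "v \<in> fv (Exi k \<psi>)"
    then obtain i where "i \<in> fv \<phi>" "v = ?f i" "v \<noteq> k" using \<psi>(2) by auto
    then show "v \<in> {..<k}" using assms(2) by (auto split: if_splits)
  qed
  ultimately show ?thesis using \<psi>(1) by (intro exI[of _ "Exi k \<psi>"]) auto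
qed

section \<open>Algebraic closure and manipulation of tuples\<close>

lemma acl_mono: "A \<subseteq> B \<Longrightarrow> acl L M A \<subseteq> acl L M B"
  unfolding acl_def by blast

lemma acl_extensive: "A \<subseteq> univ M \<Longrightarrow> A \<subseteq> acl L M A"
proof
  fix a assume a: "A \<subseteq> univ M" "a \<in> A"
  have "{x \<in> univ M. sat M ((!) (x # [a])) (Eq (Var 0) (Var 1))} \<subseteq> {a}" by auto
  then have "finite {x \<in> univ M. sat M ((!) (x # [a])) (Eq (Var 0) (Var 1))}"
    by (rule finite_subset) simp
  then show "a \<in> acl L M A"
    using a unfolding acl_def by (auto intro!: exI[of _ "Eq (Var 0) (Var 1)"] exI[of _ "[a]"])
qed

lemma acl_finitary: "a \<in> acl L M A \<Longrightarrow> \<exists>B. finite B \<and> B \<subseteq> A \<and> a \<in> acl L M B"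
proof -
  assume "a \<in> acl L M A"
  then obtain \<phi> bs where "a \<in> univ M" "wf_fm L \<phi>" "set bs \<subseteq> A" "fv \<phi> \<subseteq> {..<Suc (length bs)}"
     "sat M ((!) (a # bs)) \<phi>" "finite {x \<in> univ M. sat M ((!) (x # bs)) \<phi>}"
    unfolding acl_def mem_Collect_eq by (elim exE conjE) (rule that)
  then have "a \<in> acl L M (set bs)" unfolding acl_def by blast
  then show ?thesis using \<open>set bs \<subseteq> A\<close> by (intro exI[of _ "set bs"]) simp
qed

lemma set_zip_same: "set (zip xs xs) = (\<lambda>x. (x, x)) ` set xs"
  by (simp add: zip_same_conv_map)

lemma eqtp_distinct:
  assumes "eqtp L M xs ys" "distinct xs"
  shows "distinct ys"
  using assms eqtp_eq[OF assms(1)] eqtp_length[OF assms(1)] by (simp add: distinct_conv_nth)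

lemma eqtp_tl:
  assumes "eqtp L M (x # xs) (y # ys)"
  shows "eqtp L M xs ys"
  by (rule eqtp_zip[OF assms]) (use eqtp_length[OF assms] in auto)

lemma eqtp_appendD:
  assumes "eqtp L M (us @ xs) (vs @ ys)" "length us = length vs"
  shows "eqtp L M us vs" "eqtp L M xs ys"
  by (rule eqtp_zip[OF assms(1)]; use eqtp_length[OF assms(1)] assms(2) in auto)+

lemma eqtp_nth_Cons:
  assumes "eqtp L M (us @ xs) (vs @ ys)" "length us = length vs" "i < length us"
  shows "eqtp L M (us ! i # xs) (vs ! i # ys)"
proof (rule eqtp_zip[OF assms(1)])
  show "length (us ! i # xs) = length (vs ! i # ys)" using eqtp_length[OF assms(1)] assms(2) by simp
  have "(us ! i, vs ! i) \<in> set (zip us vs)"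
    using assms(2,3) by (metis in_set_zip fst_conv snd_conv)
  then show "set (zip (us ! i # xs) (vs ! i # ys)) \<subseteq> set (zip (us @ xs) (vs @ ys))"
    using assms(2) by auto
qed

text \<open>Instantiated twice, by the home sort of \<open>M\<close> and by a level of the imaginary
  expansion. Homogeneity and the behaviour of closure are derived from finiteness of types alone, so
  that no saturation of the expansion has to be proved.\<close>

locale finite_type_space =
  fixes L :: "('f, 'r) lang" and M :: "('f, 'r, 'm) struct" and V :: "'m set" and \<delta> :: "('f, 'r) fm"
  assumes V_univ: "V \<subseteq> univ M"
    and \<delta>_wf: "wf_fm L \<delta>" "fv \<delta> \<subseteq> {0}"
    and \<delta>_sat: "\<And>x. x \<in> univ M \<Longrightarrow> sat M (\<lambda>_. x) \<delta> \<longleftrightarrow> x \<in> V"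
    and finite_tps: "\<And>k. finite ((\<lambda>as. tp L M as {}) ` tuples V k)"
begin

lemma \<delta>_sat_Cons: "x \<in> univ M \<Longrightarrow> sat M ((!) (x # xs)) \<delta> \<longleftrightarrow> x \<in> V"
  using \<delta>_sat[of x] \<delta>_wf(2) by (subst sat_cong[where e' = "\<lambda>_. x"]) auto

lemma isolating_formula_V:
  assumes "set as \<subseteq> V"
  shows "\<exists>\<chi>. wf_fm L \<chi> \<and> fv \<chi> \<subseteq> {..<length as} \<and> sat M ((!) as) \<chi> \<and>
    (\<forall>bs. length bs = length as \<and> set bs \<subseteq> V \<and> sat M ((!) bs) \<chi> \<longrightarrow> eqtp L M as bs)"
  using isolating_formula_ex[OF finite_tps[of "length as"] _ refl]
  unfolding tuples_def by blast

text \<open>The substitute for an automorphism: one formula isolates the type of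
  \<open>x # xs\<close>, and its existential projection belongs to the type of \<open>xs\<close>,
  hence also to that of \<open>ys\<close>.\<close>

lemma homogeneous:
  assumes eq: "eqtp L M xs ys" and V: "set xs \<subseteq> V" "set ys \<subseteq> V" "x \<in> V"
  shows "\<exists>y \<in> V. eqtp L M (x # xs) (y # ys)"
proof -
  let ?k = "length xs"
  have len: "length ys = ?k" using eqtp_length[OF eq] by simp
  from isolating_formula_V[of "x # xs"] V obtain \<chi> where \<chi>: "wf_fm L \<chi>" "fv \<chi> \<subseteq> {..<Suc ?k}"
    "sat M ((!) (x # xs)) \<chi>"
    "\<And>bs. length bs = Suc ?k \<Longrightarrow> set bs \<subseteq> V \<Longrightarrow> sat M ((!) bs) \<chi> \<Longrightarrow> eqtp L M (x # xs) bs"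
    by auto
  from exists_head_ex[of L "Conj \<delta> \<chi>" ?k M] \<chi>(1,2) \<delta>_wf obtain \<psi> where \<psi>: "wf_fm L \<psi>" "fv \<psi> \<subseteq> {..<?k}"
    "\<And>zs. length zs = ?k \<Longrightarrow>
      sat M ((!) zs) \<psi> \<longleftrightarrow> (\<exists>z \<in> univ M. sat M ((!) (z # zs)) (Conj \<delta> \<chi>))" by auto
  have x: "x \<in> univ M" using V V_univ by blast
  have "sat M ((!) xs) \<psi>" using \<psi>(3)[of xs] x \<chi>(3) \<delta>_sat_Cons[OF x] V(3) by auto
  then have "sat M ((!) ys) \<psi>" using eqtp_sat[OF eq \<psi>(1,2)] by simp
  then obtain y where y: "y \<in> univ M" "sat M ((!) (y # ys)) \<delta>" "sat M ((!) (y # ys)) \<chi>"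
    using \<psi>(3)[OF len] by auto
  then have "y \<in> V" using \<delta>_sat_Cons by blast
  moreover have "eqtp L M (x # xs) (y # ys)" using \<chi>(4)[of "y # ys"] len V \<open>y \<in> V\<close> y(3) by simp
  ultimately show ?thesis by blast
qed

lemma homogeneous_tuple:
  assumes "eqtp L M xs ys" "set xs \<subseteq> V" "set ys \<subseteq> V" "set us \<subseteq> V"
  shows "\<exists>vs. set vs \<subseteq> V \<and> length vs = length us \<and> eqtp L M (us @ xs) (vs @ ys)"
  using assms(4)
proof (induction us)
  case Nil
  then show ?case using assms by auto
next
  case (Cons u us)
  then obtain vs where vs: "set vs \<subseteq> V" "length vs = length us" "eqtp L M (us @ xs) (vs @ ys)" by auto
  from homogeneous[OF vs(3), of u] obtain v where "v \<in> V" "eqtp L M (u # us @ xs) (v # vs @ ys)"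
    using Cons.prems assms vs(1) by auto
  then show ?case using vs by (intro exI[of _ "v # vs"]) auto
qed

text \<open>Elements of the same type over \<open>bs\<close> take the place of an orbit. A formula
  witnessing algebraicity holds of all of them; conversely the isolating formula, restricted to
  \<open>V\<close> by \<open>\<delta>\<close>, defines exactly them.\<close>

lemma acl_iff:
  assumes "set bs \<subseteq> V" "a \<in> V"
  shows "a \<in> acl L M (set bs) \<longleftrightarrow> finite {x \<in> V. eqtp L M (x # bs) (a # bs)}"
proof
  assume "a \<in> acl L M (set bs)"
  then obtain \<phi> cs where \<phi>: "wf_fm L \<phi>" "set cs \<subseteq> set bs" "fv \<phi> \<subseteq> {..<Suc (length cs)}"
     "sat M ((!) (a # cs)) \<phi>" "finite {x \<in> univ M. sat M ((!) (x # cs)) \<phi>}"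
    unfolding acl_def mem_Collect_eq by (elim exE conjE) (rule that)
  have "sat M ((!) (x # cs)) \<phi>" if "eqtp L M (x # bs) (a # bs)" for x
  proof -
    have "eqtp L M (x # cs) (a # cs)"
      by (rule eqtp_zip[OF that]) (use \<phi>(2) in \<open>auto simp: set_zip_same\<close>)
    then show ?thesis using eqtp_sat[of L M "x # cs" "a # cs" \<phi>] \<phi> by simp
  qed
  then have "{x \<in> V. eqtp L M (x # bs) (a # bs)} \<subseteq> {x \<in> univ M. sat M ((!) (x # cs)) \<phi>}"
    using V_univ by blast
  then show "finite {x \<in> V. eqtp L M (x # bs) (a # bs)}" using \<phi>(5) finite_subset by blast
next
  assume fin: "finite {x \<in> V. eqtp L M (x # bs) (a # bs)}"
  from isolating_formula_V[of "a # bs"] assms obtain \<chi> where \<chi>: "wf_fm L \<chi>"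
    "fv \<chi> \<subseteq> {..<Suc (length bs)}" "sat M ((!) (a # bs)) \<chi>"
    "\<And>cs. length cs = Suc (length bs) \<Longrightarrow> set cs \<subseteq> V \<Longrightarrow> sat M ((!) cs) \<chi> \<Longrightarrow> eqtp L M (a # bs) cs"
    by auto
  have "x \<in> V \<and> eqtp L M (x # bs) (a # bs)"
    if "x \<in> univ M" "sat M ((!) (x # bs)) (Conj \<delta> \<chi>)" for x
  proof -
    have "x \<in> V" using that \<delta>_sat_Cons by simp
    then show ?thesis using \<chi>(4)[of "x # bs"] that assms by (simp add: eqtp_sym)
  qed
  then have "{x \<in> univ M. sat M ((!) (x # bs)) (Conj \<delta> \<chi>)} \<subseteq> {x \<in> V. eqtp L M (x # bs) (a # bs)}"
    by blast
  then have "finite {x \<in> univ M. sat M ((!) (x # bs)) (Conj \<delta> \<chi>)}" using fin finite_subset by blast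
  moreover have a: "a \<in> univ M" using assms V_univ by blast
  moreover have "sat M ((!) (a # bs)) (Conj \<delta> \<chi>)" using \<chi>(3) \<delta>_sat_Cons[OF a] assms by simp
  moreover have "wf_fm L (Conj \<delta> \<chi>)" "fv (Conj \<delta> \<chi>) \<subseteq> {..<Suc (length bs)}" using \<chi> \<delta>_wf by auto
  ultimately show "a \<in> acl L M (set bs)" unfolding acl_def by blast
qed

text \<open>A counting argument: if \<open>a'\<close> had more conjugates over \<open>bs'\<close>
  than \<open>a\<close> has over \<open>bs\<close>, homogeneity would move them, all at once, to
  that many distinct conjugates of \<open>a\<close>.\<close>

lemma acl_invariant:
  assumes eq: "eqtp L M (a # bs) (a' # bs')" and V: "set (a # bs) \<subseteq> V" "set (a' # bs') \<subseteq> V"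
    and a: "a \<in> acl L M (set bs)"
  shows "a' \<in> acl L M (set bs')"
proof -
  let ?X = "{x \<in> V. eqtp L M (x # bs) (a # bs)}" and ?X' = "{x \<in> V. eqtp L M (x # bs') (a' # bs')}"
  have fin: "finite ?X" using acl_iff[of bs a] V a by auto
  have "finite ?X'"
  proof (rule ccontr)
    assume "infinite ?X'"
    from infinite_arbitrarily_large[OF this, of "Suc (card ?X)"] obtain Y
      where Y: "finite Y" "card Y = Suc (card ?X)" "Y \<subseteq> ?X'"
      by (elim exE conjE) (rule that)
    obtain ys where ys: "set ys = Y" "distinct ys" using finite_distinct_list[OF Y(1)] by blast
    have "eqtp L M bs' bs" using eqtp_tl[OF eq] by (rule eqtp_sym)
    from homogeneous_tuple[OF this, of ys] V Y(3) ys(1) obtain vs where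
      vs: "set vs \<subseteq> V" "length vs = length ys" "eqtp L M (ys @ bs') (vs @ bs)" by auto
    have "vs ! i \<in> ?X" if "i < length vs" for i
    proof -
      have 1: "eqtp L M (ys ! i # bs') (vs ! i # bs)" using eqtp_nth_Cons[OF vs(3)] vs(2) that by simp
      have 2: "eqtp L M (ys ! i # bs') (a' # bs')" using ys(1) Y(3) that vs(2) by auto
      have "eqtp L M (vs ! i # bs) (a # bs)"
        using eqtp_trans[OF eqtp_sym[OF 1] eqtp_trans[OF 2 eqtp_sym[OF eq]]] .
      then show ?thesis using vs(1) that by auto
    qed
    then have "set vs \<subseteq> ?X" by (auto simp: in_set_conv_nth)
    then have "card (set vs) \<le> card ?X" using fin card_mono by blast
    moreover have "distinct vs"
      using eqtp_distinct[OF eqtp_appendD(1)[OF vs(3)]] vs(2) ys(2) by simp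
    ultimately show False using Y(2) ys vs(2) distinct_card[of vs] distinct_card[of ys] by simp
  qed
  then show ?thesis using acl_iff[of bs' a'] V by auto
qed

section \<open>Closure inside \<open>V\<close>\<close>

abbreviation cl :: "'m set \<Rightarrow> 'm set" where
  "cl A \<equiv> acl L M A \<inter> V"

text \<open>There are finitely many types of one element over \<open>bs\<close>, and an algebraic
  one has finitely many realizations.\<close>

lemma finite_cl:
  assumes "finite A" "A \<subseteq> V"
  shows "finite (cl A)"
proof -
  obtain bs where bs: "set bs = A" using finite_list[OF assms(1)] by blast
  let ?t = "\<lambda>x. tp L M (x # bs) {}"
  have "?t ` cl A \<subseteq> (\<lambda>as. tp L M as {}) ` tuples V (Suc (length bs))"
    using bs assms(2) by (auto simp: tuples_def intro!: imageI)
  then have "finite (?t ` cl A)" using finite_tps finite_subset by blast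
  moreover have "finite {x \<in> V. ?t x = t}" if t: "t \<in> ?t ` cl A" for t
  proof -
    obtain a where a: "a \<in> cl A" "t = ?t a" using t by blast
    have "{x \<in> V. ?t x = t} = {x \<in> V. eqtp L M (x # bs) (a # bs)}"
      using tp_eq_iff[of "_ # bs" "a # bs" L M] a(2) by auto
    then show ?thesis using acl_iff[of bs a] a bs assms(2) by auto
  qed
  ultimately have "finite (\<Union>t \<in> ?t ` cl A. {x \<in> V. ?t x = t})" by blast
  moreover have "cl A \<subseteq> (\<Union>t \<in> ?t ` cl A. {x \<in> V. ?t x = t})" by auto
  ultimately show ?thesis by (rule finite_subset[rotated])
qed

text \<open>A conjugate of \<open>a\<close> over \<open>cs\<close> comes with a conjugate
  \<open>bs'\<close> of the intermediate tuple \<open>bs\<close>. There are finitely many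
  \<open>bs'\<close>, because they lie in the finite closure of \<open>cs\<close>, and each of them
  admits finitely many conjugates of \<open>a\<close>.\<close>

lemma cl_idem:
  assumes "A \<subseteq> V"
  shows "cl (cl A) \<subseteq> cl A"
proof
  fix a assume a: "a \<in> cl (cl A)"
  obtain B where B: "finite B" "B \<subseteq> cl A" "a \<in> acl L M B" using acl_finitary[of a L M "cl A"] a by auto
  have "\<forall>b \<in> B. \<exists>C. finite C \<and> C \<subseteq> A \<and> b \<in> acl L M C" using B(2) acl_finitary[of _ L M A] by blast
  then obtain C where C: "\<And>b. b \<in> B \<Longrightarrow> finite (C b) \<and> C b \<subseteq> A \<and> b \<in> acl L M (C b)" by metis
  obtain bs where bs: "set bs = B" using finite_list[OF B(1)] by blast
  have "finite (\<Union>b \<in> B. C b)" using B(1) C by blast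
  from finite_list[OF this] obtain cs where cs: "set cs = (\<Union>b \<in> B. C b)" by blast
  have csA: "set cs \<subseteq> A" using C cs by auto
  have BV: "set bs \<subseteq> V" "set cs \<subseteq> V" using B(2) bs csA assms by auto
  have bcs: "b \<in> acl L M (set cs)" if "b \<in> B" for b
    using C[OF that] acl_mono[of "C b" "set cs" L M] cs that by blast
  let ?BB = "{bs'. set bs' \<subseteq> cl (set cs) \<and> length bs' = length bs}"
  let ?X = "\<lambda>bs'. {x \<in> V. eqtp L M (x # bs') (a # bs)}"
  have "finite ?BB" using finite_lists_length_eq[OF finite_cl[of "set cs"]] BV by simp
  moreover have "finite (?X bs')" if "bs' \<in> ?BB" for bs'
  proof (cases "?X bs' = {}")
    case False
    then obtain x0 where x0: "x0 \<in> V" "eqtp L M (x0 # bs') (a # bs)" by blast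
    have bs'V: "set bs' \<subseteq> V" using that by blast
    have "x0 \<in> acl L M (set bs')"
      by (rule acl_invariant[OF eqtp_sym[OF x0(2)]]) (use a B(3) BV bs bs'V x0 in auto)
    then have "finite {x \<in> V. eqtp L M (x # bs') (x0 # bs')}" using acl_iff[OF bs'V x0(1)] by blast
    moreover have "?X bs' \<subseteq> {x \<in> V. eqtp L M (x # bs') (x0 # bs')}"
      using eqtp_trans[OF _ eqtp_sym[OF x0(2)]] by blast
    ultimately show ?thesis by (rule finite_subset[rotated])
  next
    case True
    show ?thesis unfolding True by simp
  qed
  ultimately have "finite (\<Union>bs' \<in> ?BB. ?X bs')" by blast
  moreover have "{x \<in> V. eqtp L M (x # cs) (a # cs)} \<subseteq> (\<Union>bs' \<in> ?BB. ?X bs')"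
  proof
    fix x assume "x \<in> {x \<in> V. eqtp L M (x # cs) (a # cs)}"
    then have x: "x \<in> V" "eqtp L M (a # cs) (x # cs)" by (auto intro: eqtp_sym)
    from homogeneous_tuple[OF x(2), of bs] a x(1) BV obtain bs' where
      bs': "set bs' \<subseteq> V" "length bs' = length bs" "eqtp L M (bs @ a # cs) (bs' @ x # cs)" by auto
    have "bs' ! i \<in> cl (set cs)" if "i < length bs'" for i
    proof -
      have "eqtp L M (bs ! i # a # cs) (bs' ! i # x # cs)"
        using eqtp_nth_Cons[OF bs'(3)] bs'(2) that by simp
      then have "eqtp L M (bs ! i # cs) (bs' ! i # cs)" by (rule eqtp_zip) auto
      moreover have "bs ! i \<in> B" using that bs'(2) bs by auto
      moreover have "bs' ! i \<in> V" using that bs'(1) by auto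
      ultimately show ?thesis
        using acl_invariant[of "bs ! i" cs "bs' ! i" cs] bcs BV bs by auto
    qed
    then have "bs' \<in> ?BB" using bs'(2) by (auto simp: in_set_conv_nth)
    moreover have "eqtp L M (x # bs') (a # bs)"
      by (rule eqtp_zip[OF eqtp_sym[OF bs'(3)]]) (use bs'(2) in auto)
    ultimately show "x \<in> (\<Union>bs' \<in> ?BB. ?X bs')" using x(1) by blast
  qed
  ultimately have "finite {x \<in> V. eqtp L M (x # cs) (a # cs)}" by (rule finite_subset[rotated])
  then have "a \<in> acl L M (set cs)" using acl_iff[OF BV(2)] a by blast
  then show "a \<in> cl A" using acl_mono[OF csA, of L M] a by blast
qed

section \<open>Moving independent sequences\<close>

lemma indep_seq_invariant:
  assumes "eqtp L M (ds @ cs) (ds' @ cs')" "length ds = length ds'"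
    "set (ds @ cs) \<subseteq> V" "set (ds' @ cs') \<subseteq> V" "indep_seq cl (set cs) ds"
  shows "indep_seq cl (set cs') ds'"
  using assms
proof (induction ds arbitrary: ds' cs cs')
  case (Cons d ds)
  then obtain d' es' where ds': "ds' = d' # es'" by (cases ds') auto
  have len: "length cs = length cs'" "length ds = length es'"
    using Cons.prems(2) eqtp_length[OF Cons.prems(1)] ds' by auto
  have "eqtp L M (d' # cs') (d # cs)"
    by (rule eqtp_zip[OF eqtp_sym[OF Cons.prems(1)]]) (use len ds' in auto)
  then have "d' \<notin> cl (set cs')"
    using acl_invariant[of d' cs' d cs] Cons.prems ds' by auto
  moreover have "eqtp L M (ds @ d # cs) (es' @ d' # cs')"
    by (rule eqtp_zip[OF Cons.prems(1)]) (use len ds' in auto)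
  then have "indep_seq cl (set (d' # cs')) es'"
    by (rule Cons.IH[of "d # cs"]) (use Cons.prems len ds' in auto)
  ultimately show ?case by (simp add: ds')
qed simp

text \<open>A non-algebraic type has infinitely many realizations in \<open>V\<close>, too many for
  the finite closure of \<open>bs\<close>.\<close>

lemma nonalgebraic_extension:
  assumes "a \<in> V" "set cs \<subseteq> V" "set bs \<subseteq> V" "a \<notin> acl L M (set cs)"
  shows "\<exists>a' \<in> V. eqtp L M (a # cs) (a' # cs) \<and> a' \<notin> acl L M (set bs)"
proof -
  have "infinite {x \<in> V. eqtp L M (x # cs) (a # cs)}" using acl_iff assms by blast
  moreover have "finite (cl (set bs))" using finite_cl assms(3) by simp
  ultimately have "\<not> {x \<in> V. eqtp L M (x # cs) (a # cs)} \<subseteq> cl (set bs)" using finite_subset by blast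
  then obtain x where x: "x \<in> V" "eqtp L M (x # cs) (a # cs)" "x \<notin> acl L M (set bs)" by blast
  then show ?thesis using eqtp_sym[OF x(2)] by blast
qed

text \<open>Each entry is first copied over \<open>cs'\<close> by homogeneity and then replaced by a
  realization outside the closure of \<open>bs\<close>. The chosen entry joins \<open>cs'\<close>
  and \<open>bs\<close>, while the original one joins \<open>cs\<close>; hence two tuples
  \<open>cs\<close> and \<open>cs'\<close> in the induction, even if they agree at the
  start.\<close>

lemma indep_seq_extension:
  assumes "eqtp L M cs cs'" "set cs \<subseteq> V" "set cs' \<subseteq> V" "set bs \<subseteq> V" "set ds \<subseteq> V"
    "indep_seq cl (set cs) ds"
  shows "\<exists>ds'. set ds' \<subseteq> V \<and> length ds' = length ds \<and> eqtp L M (ds @ cs) (ds' @ cs') \<and>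
    indep_seq cl (set bs) ds'"
  using assms
proof (induction ds arbitrary: cs cs' bs)
  case Nil
  then show ?case by auto
next
  case (Cons d ds)
  have len: "length cs = length cs'" using eqtp_length[OF Cons.prems(1)] .
  obtain d1 where d1: "d1 \<in> V" "eqtp L M (d # cs) (d1 # cs')"
    using homogeneous[OF Cons.prems(1-3), of d] Cons.prems(5) by auto
  have "d1 \<notin> acl L M (set cs')"
    using acl_invariant[OF eqtp_sym[OF d1(2)]] Cons.prems d1(1) by auto
  then obtain d' where d': "d' \<in> V" "eqtp L M (d1 # cs') (d' # cs')" "d' \<notin> acl L M (set bs)"
    using nonalgebraic_extension[OF d1(1) Cons.prems(3,4)] by blast
  have "eqtp L M (d # cs) (d' # cs')" using eqtp_trans[OF d1(2) d'(2)] .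
  from Cons.IH[OF this, of "d' # bs"] obtain ds' where ds': "set ds' \<subseteq> V" "length ds' = length ds"
    "eqtp L M (ds @ d # cs) (ds' @ d' # cs')" "indep_seq cl (set (d' # bs)) ds'"
    using Cons.prems d'(1) by auto
  have "eqtp L M ((d # ds) @ cs) ((d' # ds') @ cs')"
    by (rule eqtp_zip[OF ds'(3)]) (use len ds'(2) in auto)
  then show ?case using ds' d' by (intro exI[of _ "d' # ds'"]) auto
qed

end


section \<open>Rank in locally finite closure systems\<close>

definition fin_ord :: "nat \<Rightarrow> 'o::{wellorder, no_top}" where
  "fin_ord m = (ord_succ ^^ m) ord_zero"

lemma fin_ord_simps: "fin_ord 0 = ord_zero" "fin_ord (Suc m) = ord_succ (fin_ord m)"
  by (simp_all add: fin_ord_def)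

lemma fin_ord_inject: "(fin_ord m :: 'o::{wellorder, no_top}) = fin_ord m' \<longleftrightarrow> m = m'"
proof
  show "(fin_ord m :: 'o) = fin_ord m' \<Longrightarrow> m = m'"
  proof (induction m arbitrary: m')
    case 0
    then show ?case
      using ord_succ_neq_zero[where 'o = 'o] by (cases m') (auto simp: fin_ord_simps dest: sym)
  next
    case (Suc m)
    then show ?case
      using ord_succ_neq_zero[where 'o = 'o] by (cases m') (auto simp: fin_ord_simps ord_succ_eq_iff)
  qed
qed simp

lemma rank_ge_fin_ord:
  "rank_ge cl A B (fin_ord m :: 'o::{wellorder, no_top}) \<longleftrightarrow>
    (\<exists>xs. length xs = m \<and> set xs \<subseteq> cl A \<and> indep_seq cl B xs)"
proof (induction m arbitrary: B)
  case 0
  show ?case by (simp add: fin_ord_simps rank_ge.zero)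
next
  case (Suc m)
  have "rank_ge cl A B (fin_ord (Suc m) :: 'o) \<longleftrightarrow>
    (\<exists>a \<in> cl A - cl B. \<exists>xs. length xs = m \<and> set xs \<subseteq> cl A \<and> indep_seq cl ({a} \<union> B) xs)"
    by (simp only: fin_ord_simps rank_ge_succ_iff Suc)
  also have "\<dots> \<longleftrightarrow> (\<exists>xs. length xs = Suc m \<and> set xs \<subseteq> cl A \<and> indep_seq cl B xs)"
  proof
    assume "\<exists>a \<in> cl A - cl B. \<exists>xs. length xs = m \<and> set xs \<subseteq> cl A \<and> indep_seq cl ({a} \<union> B) xs"
    then obtain a xs where "a \<in> cl A - cl B" "length xs = m" "set xs \<subseteq> cl A" "indep_seq cl ({a} \<union> B) xs"
      by blast
    then show "\<exists>xs. length xs = Suc m \<and> set xs \<subseteq> cl A \<and> indep_seq cl B xs"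
      by (intro exI[of _ "a # xs"]) auto
  next
    assume "\<exists>xs. length xs = Suc m \<and> set xs \<subseteq> cl A \<and> indep_seq cl B xs"
    then obtain a xs where "length (a # xs) = Suc m" "set (a # xs) \<subseteq> cl A" "indep_seq cl B (a # xs)"
      by (metis length_Suc_conv)
    then show "\<exists>a \<in> cl A - cl B. \<exists>xs. length xs = m \<and> set xs \<subseteq> cl A \<and> indep_seq cl ({a} \<union> B) xs"
      by (intro bexI[of _ a] exI[of _ xs]) auto
  qed
  finally show ?case .
qed

text \<open>Meant to exclude transfinite ranks: a rank beyond the finite ordinals forces every
  finite rank, hence arbitrarily long independent sequences. In the successor case, finite ranks
  over the base enlarged by \<open>a\<close> give the next ones over the base itself.\<close>

lemma rank_ge_infinite:
  assumes "rank_ge cl A B (\<alpha> :: 'o::{wellorder, no_top})"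
  shows "\<alpha> \<in> range fin_ord \<or> (\<forall>m. rank_ge cl A B (fin_ord m :: 'o))"
  using assms
proof (induction rule: rank_ge.induct)
  case (zero B)
  have "ord_zero = (fin_ord 0 :: 'o)" by (simp add: fin_ord_simps)
  then show ?case by blast
next
  case (succ a B \<alpha>)
  from succ.IH show ?case
  proof
    assume "\<alpha> \<in> range fin_ord"
    then obtain m where "\<alpha> = fin_ord m" by blast
    then have "ord_succ \<alpha> = fin_ord (Suc m)" by (simp add: fin_ord_simps)
    then show ?case by blast
  next
    assume "\<forall>m. rank_ge cl A ({a} \<union> B) (fin_ord m :: 'o)"
    then have "rank_ge cl A B (fin_ord m :: 'o)" for m
      using succ.hyps(1) by (cases m) (auto simp: fin_ord_simps intro: rank_ge.zero rank_ge.succ)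
    then show ?case by blast
  qed
next
  case (limit \<alpha> B)
  have "fin_ord m < \<alpha>" for m
  proof (induction m)
    case 0
    then show ?case
      using limit.hyps(1) ord_zero_le[of \<alpha>] by (auto simp: fin_ord_simps ord_limit_def)
  next
    case (Suc m)
    then show ?case using limit.hyps(1) by (simp add: fin_ord_simps ord_limit_def)
  qed
  then show ?case using limit.hyps(2) by blast
qed

lemma indep_seq_append:
  "indep_seq cl B (xs @ ys) \<longleftrightarrow> indep_seq cl B xs \<and> indep_seq cl (B \<union> set xs) ys"
  by (induction xs arbitrary: B) auto

text \<open>The maximum is meaningful for a finite subset \<open>A\<close> of the ambient set, where
  the size of \<open>cl A\<close> bounds all lengths.\<close>

definition nrk :: "('a set \<Rightarrow> 'a set) \<Rightarrow> 'a set \<Rightarrow> 'a set \<Rightarrow> nat" where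
  "nrk cl A B = Max {length xs | xs. set xs \<subseteq> cl A \<and> indep_seq cl B xs}"

text \<open>The laws are relative to \<open>V\<close>, because closure cut down to a level contains
  its argument only if the argument lies in that level.\<close>

locale locally_finite_closure =
  fixes V :: "'a set" and cl :: "'a set \<Rightarrow> 'a set"
  assumes cl_V: "A \<subseteq> V \<Longrightarrow> cl A \<subseteq> V"
    and cl_ext: "A \<subseteq> V \<Longrightarrow> A \<subseteq> cl A"
    and cl_mono: "A \<subseteq> B \<Longrightarrow> B \<subseteq> V \<Longrightarrow> cl A \<subseteq> cl B"
    and cl_cl: "A \<subseteq> V \<Longrightarrow> cl (cl A) \<subseteq> cl A"
    and cl_finite: "finite A \<Longrightarrow> A \<subseteq> V \<Longrightarrow> finite (cl A)"
    and cl_finitary: "x \<in> cl A \<Longrightarrow> A \<subseteq> V \<Longrightarrow> \<exists>B. finite B \<and> B \<subseteq> A \<and> x \<in> cl B"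
begin

lemma cl_subset_cl: "A \<subseteq> cl B \<Longrightarrow> B \<subseteq> V \<Longrightarrow> cl A \<subseteq> cl B"
  using cl_mono[of A "cl B"] cl_cl[of B] cl_V[of B] by blast

text \<open>Independence depends on the base only through its closure and survives shrinking that
  closure; \<open>B'\<close> need not be a subset of \<open>B\<close>.\<close>

lemma indep_seq_cl:
  assumes "indep_seq cl B xs" "B \<subseteq> V" "B' \<subseteq> cl B" "set xs \<subseteq> V"
  shows "indep_seq cl B' xs"
  using assms
proof (induction xs arbitrary: B B')
  case (Cons x xs)
  have "cl B' \<subseteq> cl B" using cl_subset_cl Cons.prems by blast
  moreover have "indep_seq cl (insert x B') xs"
  proof (rule Cons.IH[of "insert x B"])
    have V: "insert x B \<subseteq> V" using Cons.prems by simp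
    show "insert x B' \<subseteq> cl (insert x B)"
      using Cons.prems cl_mono[OF _ V, of B] cl_ext[OF V] by blast
  qed (use Cons.prems in auto)
  ultimately show ?case using Cons.prems by auto
qed simp

lemma indep_seq_antimono:
  assumes "indep_seq cl B xs" "B' \<subseteq> B" "B \<union> set xs \<subseteq> V"
  shows "indep_seq cl B' xs"
  by (rule indep_seq_cl[OF assms(1)]) (use assms(2,3) cl_ext[of B] in auto)

lemma indep_seq_finitary:
  assumes "\<And>B0. finite B0 \<Longrightarrow> B0 \<subseteq> B \<Longrightarrow> indep_seq cl B0 xs" "B \<subseteq> V" "set xs \<subseteq> V"
  shows "indep_seq cl B xs"
  using assms
proof (induction xs arbitrary: B)
  case (Cons x xs)
  have "x \<notin> cl B"
  proof
    assume "x \<in> cl B"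
    from cl_finitary[OF this Cons.prems(2)] obtain B0 where "finite B0" "B0 \<subseteq> B" "x \<in> cl B0" by blast
    then show False using Cons.prems(1)[of B0] by simp
  qed
  moreover have "indep_seq cl (insert x B) xs"
  proof (rule Cons.IH)
    fix B0 assume B0: "finite B0" "B0 \<subseteq> insert x B"
    \<comment> \<open>\<open>x\<close> is removed first because passing to the tail of the sequence
      puts it back into the base.\<close>
    have "indep_seq cl (B0 - {x}) (x # xs)" using B0 by (intro Cons.prems(1)) auto
    then have "indep_seq cl (insert x (B0 - {x})) xs" by simp
    then show "indep_seq cl B0 xs"
      by (rule indep_seq_antimono) (use B0 Cons.prems in auto)
  qed (use Cons.prems in auto)
  ultimately show ?case by simp
qed simp

lemma indep_seq_length:
  assumes "indep_seq cl B xs" "set xs \<subseteq> cl A" "finite A" "A \<subseteq> V" "B \<subseteq> V"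
  shows "length xs \<le> card (cl A)"
proof -
  have "distinct xs \<and> set xs \<inter> B = {}" if "indep_seq cl B xs" "set xs \<subseteq> V" "B \<subseteq> V" for B xs
    using that
  proof (induction xs arbitrary: B)
    case (Cons x xs)
    then have "distinct xs \<and> set xs \<inter> insert x B = {}" by (intro Cons.IH) auto
    moreover have "x \<notin> B" using Cons.prems cl_ext[of B] by auto
    ultimately show ?case by auto
  qed simp
  then have "distinct xs" using assms cl_V[of A] by blast
  then show ?thesis using assms cl_finite card_mono[of "cl A" "set xs"] distinct_card[of xs] by simp
qed

section \<open>Rank as the maximal length of an independent sequence\<close>

lemma finite_indep_lengths:
  assumes "finite A" "A \<subseteq> V" "B \<subseteq> V"
  shows "finite {length xs | xs. set xs \<subseteq> cl A \<and> indep_seq cl B xs}"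
proof -
  have "{length xs | xs. set xs \<subseteq> cl A \<and> indep_seq cl B xs} \<subseteq> {..card (cl A)}"
    using indep_seq_length[OF _ _ assms] by auto
  then show ?thesis by (rule finite_subset) simp
qed

lemma nrk_attained:
  assumes "finite A" "A \<subseteq> V" "B \<subseteq> V"
  shows "\<exists>xs. length xs = nrk cl A B \<and> set xs \<subseteq> cl A \<and> indep_seq cl B xs"
proof -
  have "0 \<in> {length xs | xs. set xs \<subseteq> cl A \<and> indep_seq cl B xs}" by force
  then have "nrk cl A B \<in> {length xs | xs. set xs \<subseteq> cl A \<and> indep_seq cl B xs}"
    unfolding nrk_def using finite_indep_lengths[OF assms] by (intro Max_in) blast+
  then show ?thesis by force
qed

lemma nrk_ge:
  assumes "finite A" "A \<subseteq> V" "B \<subseteq> V" "set xs \<subseteq> cl A" "indep_seq cl B xs"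
  shows "length xs \<le> nrk cl A B"
  unfolding nrk_def using assms by (intro Max_ge finite_indep_lengths) auto

lemma rank_ge_fin_ord_iff:
  assumes "finite A" "A \<subseteq> V" "B \<subseteq> V"
  shows "rank_ge cl A B (fin_ord m :: 'o::{wellorder, no_top}) \<longleftrightarrow> m \<le> nrk cl A B"
proof
  assume "rank_ge cl A B (fin_ord m :: 'o)"
  then show "m \<le> nrk cl A B" using nrk_ge[OF assms] unfolding rank_ge_fin_ord by blast
next
  assume m: "m \<le> nrk cl A B"
  obtain xs where xs: "length xs = nrk cl A B" "set xs \<subseteq> cl A" "indep_seq cl B xs"
    using nrk_attained[OF assms] by blast
  have "indep_seq cl B (take m xs)"
    using xs(3) indep_seq_append[of cl B "take m xs" "drop m xs"] by simp
  moreover have "set (take m xs) \<subseteq> cl A" using xs(2) set_take_subset[of m xs] by blast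
  moreover have "length (take m xs) = m" using xs(1) m by simp
  ultimately show "rank_ge cl A B (fin_ord m :: 'o)" unfolding rank_ge_fin_ord by blast
qed

lemma rank_iff:
  assumes "finite A" "A \<subseteq> V" "B \<subseteq> V"
  shows "rank_ge cl A B (\<alpha> :: 'o::{wellorder, no_top}) \<and> \<not> rank_ge cl A B (ord_succ \<alpha>) \<longleftrightarrow>
    \<alpha> = fin_ord (nrk cl A B)"
proof
  assume \<alpha>: "rank_ge cl A B \<alpha> \<and> \<not> rank_ge cl A B (ord_succ \<alpha>)"
  have "\<not> rank_ge cl A B (fin_ord (Suc (nrk cl A B)) :: 'o)"
    unfolding rank_ge_fin_ord_iff[OF assms] by simp
  then obtain m where m: "\<alpha> = fin_ord m" using rank_ge_infinite[of cl A B \<alpha>] \<alpha> by blast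
  have "m \<le> nrk cl A B" "\<not> Suc m \<le> nrk cl A B"
    using \<alpha> unfolding m fin_ord_simps(2)[symmetric] rank_ge_fin_ord_iff[OF assms] by auto
  then show "\<alpha> = fin_ord (nrk cl A B)" using m by (simp add: le_antisym not_less_eq_eq)
next
  assume "\<alpha> = fin_ord (nrk cl A B)"
  then show "rank_ge cl A B \<alpha> \<and> \<not> rank_ge cl A B (ord_succ \<alpha>)"
    by (simp add: fin_ord_simps(2)[symmetric] rank_ge_fin_ord_iff[OF assms])
qed

lemma nrk_le_base:
  assumes "finite A" "A \<subseteq> V" "B \<subseteq> V" "B' \<subseteq> V" "B' \<subseteq> cl B"
  shows "nrk cl A B \<le> nrk cl A B'"
proof -
  obtain xs where xs: "length xs = nrk cl A B" "set xs \<subseteq> cl A" "indep_seq cl B xs"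
    using nrk_attained[OF assms(1-3)] by blast
  have "set xs \<subseteq> V" using xs(2) cl_V[OF assms(2)] by blast
  then have "indep_seq cl B' xs" by (rule indep_seq_cl[OF xs(3) assms(3,5)])
  then show ?thesis using nrk_ge[OF assms(1,2,4) xs(2)] xs(1) by simp
qed

lemma nrk_antimono:
  assumes "finite A" "A \<subseteq> V" "B \<subseteq> V" "B' \<subseteq> B"
  shows "nrk cl A B \<le> nrk cl A B'"
  by (rule nrk_le_base) (use assms cl_ext[of B] in auto)

text \<open>The rank consults the base only through questions whether \<open>x\<close> lies in the
  closure of \<open>B \<union> X\<close>, with \<open>x\<close> and the elements of \<open>X\<close>
  taken from the finite set \<open>cl A\<close>. Each of the finitely many positive answers has a
  finite witness in \<open>B\<close>, and the union of these witnesses gives the same answers as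
  \<open>B\<close>.\<close>

lemma nrk_finite_base:
  assumes "finite A" "A \<subseteq> V" "B \<subseteq> V"
  shows "\<exists>B0. finite B0 \<and> B0 \<subseteq> B \<and> nrk cl A B0 = nrk cl A B"
proof -
  have fin: "finite (cl A)" using assms cl_finite by blast
  have clA: "cl A \<subseteq> V" using assms cl_V by blast
  have "\<exists>C. finite C \<and> C \<subseteq> B \<and> x \<in> cl (C \<union> X)" if "x \<in> cl (B \<union> X)" "X \<subseteq> cl A" for x X
  proof -
    have BX: "B \<union> X \<subseteq> V" using that assms clA by auto
    from cl_finitary[OF that(1) BX] obtain D where D: "finite D" "D \<subseteq> B \<union> X" "x \<in> cl D" by blast
    have "cl D \<subseteq> cl ((D \<inter> B) \<union> X)" by (rule cl_mono) (use D(2) BX in auto)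
    then show ?thesis using D by (intro exI[of _ "D \<inter> B"]) auto
  qed
  then have "\<forall>p \<in> {(x, X). X \<subseteq> cl A \<and> x \<in> cl A \<and> x \<in> cl (B \<union> X)}.
    \<exists>C. finite C \<and> C \<subseteq> B \<and> fst p \<in> cl (C \<union> snd p)" by auto
  from bchoice[OF this] obtain C where C0: "\<forall>p \<in> {(x, X). X \<subseteq> cl A \<and> x \<in> cl A \<and> x \<in> cl (B \<union> X)}.
    finite (C p) \<and> C p \<subseteq> B \<and> fst p \<in> cl (C p \<union> snd p)" by (elim exE) (rule that)
  have C: "finite (C (x, X)) \<and> C (x, X) \<subseteq> B \<and> x \<in> cl (C (x, X) \<union> X)"
    if "X \<subseteq> cl A" "x \<in> cl A" "x \<in> cl (B \<union> X)" for x X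
    using bspec[OF C0, of "(x, X)"] that by simp
  let ?P = "{(x, X). X \<subseteq> cl A \<and> x \<in> cl A \<and> x \<in> cl (B \<union> X)}"
  let ?B0 = "\<Union>p \<in> ?P. C p"
  have "?P \<subseteq> cl A \<times> Pow (cl A)" by auto
  then have "finite ?P" using fin finite_subset by blast
  moreover have "finite (C p)" if "p \<in> ?P" for p using C that by auto
  ultimately have finB0: "finite ?B0" by blast
  have B0: "?B0 \<subseteq> B"
  proof (rule UN_least)
    fix p assume "p \<in> ?P"
    from bspec[OF C0 this] show "C p \<subseteq> B" by simp
  qed
  have step: "x \<in> cl (B \<union> X) \<longleftrightarrow> x \<in> cl (?B0 \<union> X)" if "x \<in> cl A" "X \<subseteq> cl A" for x X
  proof
    assume x: "x \<in> cl (B \<union> X)"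
    have "(x, X) \<in> ?P" using that x by simp
    then have "C (x, X) \<subseteq> ?B0" by (rule UN_upper)
    then have "C (x, X) \<union> X \<subseteq> ?B0 \<union> X" by (rule Un_mono[OF _ order_refl])
    moreover have "?B0 \<union> X \<subseteq> V" using order_trans[OF B0 assms(3)] order_trans[OF that(2) clA] by (rule Un_least)
    ultimately have "cl (C (x, X) \<union> X) \<subseteq> cl (?B0 \<union> X)" by (rule cl_mono)
    then show "x \<in> cl (?B0 \<union> X)" using C[OF that(2,1) x] by blast
  next
    assume "x \<in> cl (?B0 \<union> X)"
    moreover have "cl (?B0 \<union> X) \<subseteq> cl (B \<union> X)"
      using Un_mono[OF B0 order_refl] Un_least[OF assms(3) order_trans[OF that(2) clA]] by (rule cl_mono)
    ultimately show "x \<in> cl (B \<union> X)" by blast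
  qed
  have seq: "indep_seq cl (B \<union> X) xs \<longleftrightarrow> indep_seq cl (?B0 \<union> X) xs" if "set xs \<subseteq> cl A" "X \<subseteq> cl A" for xs X
    using that
  proof (induction xs arbitrary: X)
    case (Cons x xs)
    have "indep_seq cl (B \<union> insert x X) xs \<longleftrightarrow> indep_seq cl (?B0 \<union> insert x X) xs"
      by (rule Cons.IH) (use Cons.prems in auto)
    then show ?case using step[of x X] Cons.prems by simp
  qed simp
  have "indep_seq cl B xs \<longleftrightarrow> indep_seq cl ?B0 xs" if "set xs \<subseteq> cl A" for xs
    using seq[OF that, of "{}"] by simp
  then have "{length xs | xs. set xs \<subseteq> cl A \<and> indep_seq cl ?B0 xs} =
      {length xs | xs. set xs \<subseteq> cl A \<and> indep_seq cl B xs}" by blast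
  then have "nrk cl A ?B0 = nrk cl A B" unfolding nrk_def by (rule arg_cong)
  then show ?thesis using finB0 B0 by blast
qed

lemma nrk_cong_base:
  assumes "B \<subseteq> V" "B' \<subseteq> V" "cl B = cl B'" "finite A" "A \<subseteq> V"
  shows "nrk cl A B = nrk cl A B'"
proof (rule antisym)
  show "nrk cl A B \<le> nrk cl A B'"
    by (rule nrk_le_base[OF assms(4,5,1,2)]) (simp only: assms(3) cl_ext[OF assms(2)])
  show "nrk cl A B' \<le> nrk cl A B"
    by (rule nrk_le_base[OF assms(4,5,2,1)]) (simp only: assms(3)[symmetric] cl_ext[OF assms(1)])
qed

lemma nrk_pos:
  assumes "finite A" "A \<subseteq> V" "B \<subseteq> V" "x \<in> cl A" "x \<notin> cl B"
  shows "Suc (nrk cl A (insert x B)) \<le> nrk cl A B"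
proof -
  have xB: "insert x B \<subseteq> V" using assms cl_V[of A] by blast
  obtain xs where xs: "length xs = nrk cl A (insert x B)" "set xs \<subseteq> cl A" "indep_seq cl (insert x B) xs"
    using nrk_attained[OF assms(1,2) xB] by blast
  then show ?thesis using nrk_ge[OF assms(1-3), of "x # xs"] assms by simp
qed

text \<open>Descent on the size of \<open>cl {a}\<close>: if \<open>a\<close> has rank at least two,
  the second entry of an independent sequence is not algebraic over the first, so the first entry
  has a strictly smaller closure.\<close>

lemma rank_one_ex:
  assumes "a \<in> V" "B \<subseteq> V" "a \<notin> cl B"
  shows "\<exists>b \<in> cl {a}. b \<notin> cl B \<and> nrk cl {b} B = 1"
  using assms
proof (induction "card (cl {a})" arbitrary: a rule: less_induct)
  case less
  have a: "a \<in> cl {a}" using cl_ext[of "{a}"] less.prems by blast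
  have pos: "nrk cl {a} B \<ge> 1" using nrk_pos[of "{a}" B a] less.prems a by simp
  show ?case
  proof (cases "nrk cl {a} B = 1")
    case True
    then show ?thesis using a less.prems by blast
  next
    case False
    then have "2 \<le> nrk cl {a} B" using pos by simp
    moreover obtain xs where xs: "length xs = nrk cl {a} B" "set xs \<subseteq> cl {a}" "indep_seq cl B xs"
      using nrk_attained[of "{a}" B] less.prems by blast
    ultimately obtain x y ys where xy: "xs = x # y # ys" by (metis Suc_le_length_iff numeral_2_eq_2)
    have x: "x \<in> cl {a}" "y \<in> cl {a}" "x \<notin> cl B" "y \<notin> cl (insert x B)" using xs xy by auto
    have xV: "x \<in> V" using x cl_V[of "{a}"] less.prems by blast
    have "cl {x} \<subseteq> cl {a}" using cl_subset_cl[of "{x}" "{a}"] x(1) less.prems by simp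
    moreover have "cl {x} \<subseteq> cl (insert x B)" using cl_mono[of "{x}" "insert x B"] xV less.prems by simp
    then have "y \<notin> cl {x}" using x(4) by blast
    ultimately have "cl {x} \<subset> cl {a}" using x(2) by blast
    moreover have "finite (cl {a})" using cl_finite[of "{a}"] less.prems by simp
    ultimately have "card (cl {x}) < card (cl {a})" by (rule psubset_card_mono[rotated])
    from less.hyps[OF this xV less.prems(2) x(3)] show ?thesis using \<open>cl {x} \<subseteq> cl {a}\<close> by blast
  qed
qed

end

text \<open>In the application \<open>sm\<close> is smallness relative to the saturation cardinal.\<close>

locale exchange_closure = locally_finite_closure +
  fixes sm :: "'a set \<Rightarrow> bool"
  assumes sm_insert: "sm B \<Longrightarrow> sm (insert x B)"
    and exchange: "B \<subseteq> V \<Longrightarrow> sm B \<Longrightarrow> x \<in> V \<Longrightarrow> y \<in> V \<Longrightarrow> nrk cl {x} B = 1 \<Longrightarrow> nrk cl {y} B = 1 \<Longrightarrow>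
      y \<in> cl (insert x B) \<Longrightarrow> y \<notin> cl B \<Longrightarrow> x \<in> cl (insert y B)"
begin

text \<open>A Jordan--Hoelder argument: two rank one elements over \<open>B\<close> either generate the same closed set
  over \<open>B\<close>, or each has rank one over \<open>B\<close> and the other.\<close>

lemma nrk_rank_one_step:
  assumes "finite A" "A \<subseteq> V" "B \<subseteq> V" "sm B" "a \<in> cl A" "a \<notin> cl B" "nrk cl {a} B = 1"
  shows "nrk cl A B = Suc (nrk cl A (insert a B))"
  using assms(3-)
proof (induction "nrk cl A B" arbitrary: B a rule: less_induct)
  case less
  note B = less.prems(1) and smB = less.prems(2) and a = less.prems(3,4,5)
  have clA: "cl A \<subseteq> V" using assms(2) cl_V by blast
  have aV: "a \<in> V" using a clA by blast
  have rank_one: "nrk cl {x} (insert y B) = 1"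
    if "x \<in> V" "y \<in> V" "nrk cl {x} B = 1" "x \<notin> cl (insert y B)" for x y
  proof (rule antisym)
    have V: "insert y B \<subseteq> V" using that B by simp
    show "nrk cl {x} (insert y B) \<le> 1"
      using nrk_antimono[of "{x}" "insert y B" B] that V by auto
    show "1 \<le> nrk cl {x} (insert y B)"
      using nrk_pos[of "{x}" "insert y B" x] that V cl_ext[of "{x}"] by auto
  qed
  obtain xs where xs: "length xs = nrk cl A B" "set xs \<subseteq> cl A" "indep_seq cl B xs"
    using nrk_attained[OF assms(1,2) B] by blast
  have "nrk cl A B \<noteq> 0" using nrk_pos[OF assms(1,2) B a(1,2)] by simp
  then obtain x ys where x: "xs = x # ys" using xs(1) by (cases xs) auto
  have xA: "x \<in> cl A" "x \<notin> cl B" using x xs by auto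
  \<comment> \<open>The first entry \<open>x\<close> of a longest sequence may have higher rank. A
    rank-one element \<open>b\<close> of its closure leaves the remaining entries independent, so no
    length is lost by the replacement.\<close>
  then obtain b where b: "b \<in> cl {x}" "b \<notin> cl B" "nrk cl {b} B = 1"
    using rank_one_ex[of x B] clA B by blast
  have xV: "x \<in> V" using xA clA by blast
  have bA: "b \<in> cl A" using b(1) cl_subset_cl[of "{x}" A] xA assms(2) by auto
  have bV: "b \<in> V" using bA clA by blast
  have "indep_seq cl (insert b B) ys"
  proof (rule indep_seq_cl[of "insert x B"])
    show "indep_seq cl (insert x B) ys" using x xs by simp
    show "insert b B \<subseteq> cl (insert x B)"
      using b(1) cl_mono[of "{x}" "insert x B"] cl_ext[of "insert x B"] xV B by auto
    show "set ys \<subseteq> V" using x xs clA by auto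
  qed (use xV B in auto)
  then have "length ys \<le> nrk cl A (insert b B)"
    using nrk_ge[OF assms(1,2), of "insert b B" ys] bV B x xs by simp
  then have eqb: "nrk cl A B = Suc (nrk cl A (insert b B))"
    using nrk_pos[OF assms(1,2) B bA b(2)] xs(1) x by simp
  have Vb: "insert b B \<subseteq> V" and Va: "insert a B \<subseteq> V" using bV aV B by auto
  show ?case
  proof (cases "a \<in> cl (insert b B)")
    case True
    then have ba: "b \<in> cl (insert a B)" using exchange[OF B smB bV aV b(3) a(3) _ a(2)] by blast
    have "cl (insert a B) = cl (insert b B)"
    proof
      show "cl (insert a B) \<subseteq> cl (insert b B)"
        by (rule cl_subset_cl[OF _ Vb]) (use True cl_ext[OF Vb] in auto)
      show "cl (insert b B) \<subseteq> cl (insert a B)"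
        by (rule cl_subset_cl[OF _ Va]) (use ba cl_ext[OF Va] in auto)
    qed
    then have "nrk cl A (insert a B) = nrk cl A (insert b B)"
      using nrk_cong_base[OF Va Vb _ assms(1,2)] by blast
    then show ?thesis using eqb by simp
  next
    case False
    then have ba: "b \<notin> cl (insert a B)"
      using exchange[OF B smB aV bV a(3) b(3) _ b(2)] by blast
    \<comment> \<open>Over either enlarged base the induction hypothesis adds the other element;
      both ways end over the same base, with \<open>a\<close> and \<open>b\<close>, so they count
      the same rank.\<close>
    have "nrk cl A (insert b B) < nrk cl A B" using eqb by simp
    from less.hyps[OF this Vb sm_insert[OF smB] a(1) False] rank_one[OF aV bV a(3) False]
    have 1: "nrk cl A (insert b B) = Suc (nrk cl A (insert a (insert b B)))" by blast
    have "nrk cl A (insert a B) < nrk cl A B"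
      using nrk_pos[OF assms(1,2) B a(1,2)] by simp
    from less.hyps[OF this Va sm_insert[OF smB] bA ba] rank_one[OF bV aV b(3) ba]
    have "nrk cl A (insert a B) = Suc (nrk cl A (insert b (insert a B)))" by blast
    then show ?thesis using 1 eqb by (simp add: insert_commute)
  qed
qed

text \<open>The equation is stated for every \<open>A'\<close> whose closure contains the chain,
  because additivity takes a chain built for one set and splits it off from the rank of a larger
  one.\<close>

lemma rank_one_chain_ex:
  assumes "finite A" "A \<subseteq> V" "B \<subseteq> V" "sm B"
  shows "\<exists>xs. length xs = nrk cl A B \<and> set xs \<subseteq> cl A \<and> A \<subseteq> cl (B \<union> set xs) \<and>
    (\<forall>A'. finite A' \<and> A' \<subseteq> V \<and> set xs \<subseteq> cl A' \<longrightarrow> nrk cl A' B = length xs + nrk cl A' (B \<union> set xs))"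
  using assms(3,4)
proof (induction "nrk cl A B" arbitrary: B rule: less_induct)
  case less
  note B = less.prems(1) and smB = less.prems(2)
  have clA: "cl A \<subseteq> V" using assms(2) cl_V by blast
  show ?case
  proof (cases "A \<subseteq> cl B")
    case True
    then have "cl A \<subseteq> cl B" using cl_subset_cl B by blast
    moreover obtain xs where xs: "length xs = nrk cl A B" "set xs \<subseteq> cl A" "indep_seq cl B xs"
      using nrk_attained[OF assms(1,2) B] by blast
    ultimately have "xs = []" by (cases xs) auto
    then have "nrk cl A B = 0" using xs(1) by simp
    then show ?thesis using True by (intro exI[of _ "[]"]) auto
  next
    case False
    then obtain x where x: "x \<in> A" "x \<notin> cl B" by blast
    obtain a where a: "a \<in> cl {x}" "a \<notin> cl B" "nrk cl {a} B = 1"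
      using rank_one_ex[of x B] x assms(2) B by blast
    have aA: "a \<in> cl A" using a(1) cl_mono[of "{x}" A] x(1) assms(2) by auto
    have aV: "a \<in> V" using aA clA by blast
    have V: "insert a B \<subseteq> V" using aV B by simp
    have eq: "nrk cl A B = Suc (nrk cl A (insert a B))"
      using nrk_rank_one_step[OF assms(1,2) B smB aA a(2,3)] .
    then have "nrk cl A (insert a B) < nrk cl A B" by simp
    from less.hyps[OF this V sm_insert[OF smB]] obtain xs where xs: "length xs = nrk cl A (insert a B)"
      "set xs \<subseteq> cl A" "A \<subseteq> cl (insert a B \<union> set xs)"
      "\<forall>A'. finite A' \<and> A' \<subseteq> V \<and> set xs \<subseteq> cl A' \<longrightarrow>
        nrk cl A' (insert a B) = length xs + nrk cl A' (insert a B \<union> set xs)"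
      by (elim exE conjE) (rule that)
    have "nrk cl A' B = length (a # xs) + nrk cl A' (B \<union> set (a # xs))"
      if "finite A'" "A' \<subseteq> V" "set (a # xs) \<subseteq> cl A'" for A'
      using nrk_rank_one_step[OF that(1,2) B smB _ a(2,3)] xs(4)[rule_format, of A'] that by simp
    then show ?thesis using xs aA eq by (intro exI[of _ "a # xs"]) simp
  qed
qed

text \<open>The rank of the union is used up in two stages, by a rank-one chain generating
  \<open>B\<close> over \<open>C\<close> and one generating \<open>A\<close> over
  \<open>B \<union> C\<close>. Afterwards the union lies in the closure of the base, and rank zero
  remains.\<close>

lemma nrk_additive:
  assumes "finite A" "A \<subseteq> V" "finite B" "B \<subseteq> V" "C \<subseteq> V" "sm C" "sm (B \<union> C)"
  shows "nrk cl (A \<union> B) C = nrk cl B C + nrk cl A (B \<union> C)"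
proof -
  have AB: "finite (A \<union> B)" "A \<union> B \<subseteq> V" using assms by auto
  have BC: "B \<union> C \<subseteq> V" using assms by auto
  from rank_one_chain_ex[OF assms(3,4,5,6)] obtain bs
    where bs: "length bs = nrk cl B C" "set bs \<subseteq> cl B" "B \<subseteq> cl (C \<union> set bs)"
    "\<forall>A'. finite A' \<and> A' \<subseteq> V \<and> set bs \<subseteq> cl A' \<longrightarrow>
      nrk cl A' C = length bs + nrk cl A' (C \<union> set bs)"
    by (elim exE conjE) (rule that)
  from rank_one_chain_ex[OF assms(1,2) BC assms(7)] obtain as where as: "length as = nrk cl A (B \<union> C)" "set as \<subseteq> cl A" "A \<subseteq> cl (B \<union> C \<union> set as)"
    "\<forall>A'. finite A' \<and> A' \<subseteq> V \<and> set as \<subseteq> cl A' \<longrightarrow>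
      nrk cl A' (B \<union> C) = length as + nrk cl A' (B \<union> C \<union> set as)"
    by (elim exE conjE) (rule that)
  have sub: "cl A \<subseteq> cl (A \<union> B)" "cl B \<subseteq> cl (A \<union> B)" using cl_mono AB by auto
  have bsV: "C \<union> set bs \<subseteq> V" using bs(2) cl_V[OF assms(4)] assms(5) by blast
  have "cl (C \<union> set bs) = cl (B \<union> C)"
  proof
    have "set bs \<subseteq> cl (B \<union> C)" using bs(2) cl_mono[of B "B \<union> C"] BC by blast
    then show "cl (C \<union> set bs) \<subseteq> cl (B \<union> C)" using cl_subset_cl[OF _ BC] cl_ext[OF BC] by auto
    show "cl (B \<union> C) \<subseteq> cl (C \<union> set bs)" using cl_subset_cl[OF _ bsV] bs(3) cl_ext[OF bsV] by auto
  qed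
  then have "nrk cl (A \<union> B) (C \<union> set bs) = nrk cl (A \<union> B) (B \<union> C)"
    using nrk_cong_base[OF bsV BC _ AB] by blast
  then have "nrk cl (A \<union> B) C = nrk cl B C + nrk cl (A \<union> B) (B \<union> C)"
    using bs(4)[rule_format, of "A \<union> B"] AB bs(1,2) sub by auto
  moreover have "nrk cl (A \<union> B) (B \<union> C) = nrk cl A (B \<union> C) + nrk cl (A \<union> B) (B \<union> C \<union> set as)"
    using as(4)[rule_format, of "A \<union> B"] AB as(1,2) sub by auto
  moreover have "nrk cl (A \<union> B) (B \<union> C \<union> set as) = 0"
  proof -
    have V: "B \<union> C \<union> set as \<subseteq> V" using BC as(2) cl_V[OF assms(2)] by blast
    obtain xs where xs: "length xs = nrk cl (A \<union> B) (B \<union> C \<union> set as)" "set xs \<subseteq> cl (A \<union> B)"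
      "indep_seq cl (B \<union> C \<union> set as) xs" using nrk_attained[OF AB V] by blast
    have "A \<union> B \<subseteq> cl (B \<union> C \<union> set as)" using as(3) cl_ext[OF V] by blast
    then have "cl (A \<union> B) \<subseteq> cl (B \<union> C \<union> set as)" by (rule cl_subset_cl[OF _ V])
    then have "xs = []" using xs by (cases xs) auto
    then show ?thesis using xs(1) by simp
  qed
  ultimately show ?thesis by simp
qed

text \<open>Additivity computes the rank of \<open>A \<union> B\<close> over \<open>C\<close> in two
  orders; the terms are natural numbers and can be cancelled.\<close>

lemma nrk_symmetric:
  assumes "finite A" "A \<subseteq> V" "finite B" "B \<subseteq> V" "C \<subseteq> V" "sm C"
    and "sm (A \<union> C)" "sm (B \<union> C)" "nrk cl A (B \<union> C) = nrk cl A C"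
  shows "nrk cl B (A \<union> C) = nrk cl B C"
  using nrk_additive[of A B C] nrk_additive[of B A C] assms by (simp add: Un_commute)

text \<open>Additivity splits the rank of \<open>A\<close> into that of \<open>A'\<close> and that
  of \<open>A\<close> over \<open>A'\<close>. Enlarging the base can only lower each summand, so an
  unchanged sum leaves both unchanged.\<close>

lemma nrk_eq_subset:
  assumes "finite A" "A \<subseteq> V" "D \<subseteq> V" "C \<subseteq> D" "A' \<subseteq> A"
    and "sm C" "sm D" "sm (A' \<union> C)" "sm (A' \<union> D)" "nrk cl A D = nrk cl A C"
  shows "nrk cl A' D = nrk cl A' C"
proof -
  have A': "finite A'" "A' \<subseteq> V" "A \<union> A' = A" "C \<subseteq> V" "A' \<union> D \<subseteq> V"
    using assms finite_subset by auto
  have "nrk cl A C = nrk cl A' C + nrk cl A (A' \<union> C)" "nrk cl A D = nrk cl A' D + nrk cl A (A' \<union> D)"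
    using nrk_additive[of A A' C] nrk_additive[of A A' D] assms A' by auto
  moreover have "nrk cl A' D \<le> nrk cl A' C" "nrk cl A (A' \<union> D) \<le> nrk cl A (A' \<union> C)"
    using nrk_antimono[of A' D C] nrk_antimono[of A "A' \<union> D" "A' \<union> C"] assms A' by auto
  ultimately show ?thesis using assms(10) by simp
qed

end


section \<open>Types in the imaginary expansion\<close>

text \<open>The sort \<open>None\<close> is the home sort, and \<open>Some (k, E)\<close> is the sort of the classes of the
  relation \<open>E\<close> on \<open>k\<close>-tuples.\<close>

fun sort_arity :: "(nat \<times> 'm list rel) option \<Rightarrow> nat" where
  "sort_arity None = 1"
| "sort_arity (Some (k, E)) = k"

text \<open>Home elements are decoded from lists of length one, so that elements of all sorts have
  representatives in the same format.\<close>

fun dec :: "(nat \<times> 'm list rel) option \<Rightarrow> 'm list \<Rightarrow> 'm imag" where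
  "dec None as = Home (hd as)"
| "dec (Some (k, E)) as = Class E (E `` {as})"

fun valid_sort :: "('f, 'r) lang \<Rightarrow> ('f, 'r, 'm) struct \<Rightarrow> (nat \<times> 'm list rel) option \<Rightarrow> bool" where
  "valid_sort L M None \<longleftrightarrow> True"
| "valid_sort L M (Some (k, E)) \<longleftrightarrow> 1 \<le> k \<and> E \<in> def_equivs L M k"

definition sorts :: "('f, 'r) lang \<Rightarrow> ('f, 'r, 'm) struct \<Rightarrow> nat \<Rightarrow> (nat \<times> 'm list rel) option set" where
  "sorts L M n = {s. valid_sort L M s \<and> (\<forall>k E. s = Some (k, E) \<longrightarrow> k \<le> n)}"

section \<open>Sorts, their elements and the levels\<close>

definition elems :: "('f, 'r, 'm) struct \<Rightarrow> (nat \<times> 'm list rel) option \<Rightarrow> 'm imag set" where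
  "elems M s = dec s ` tuples (univ M) (sort_arity s)"

lemma elems_None: "elems M None = Home ` univ M"
proof -
  have "tuples (univ M) 1 = (\<lambda>x. [x]) ` univ M" by (auto simp: tuples_def length_Suc_conv)
  then show ?thesis by (auto simp: elems_def image_image)
qed

lemma imaginaries_elems: "imaginaries L M k = (\<Union>E \<in> def_equivs L M k. elems M (Some (k, E)))"
  by (auto simp: imaginaries_def elems_def quotient_def)

lemma univ_eq_elems: "univ_eq L M = (\<Union>s \<in> {s. valid_sort L M s}. elems M s)"
proof -
  have "(\<Union>s \<in> {s. valid_sort L M s}. elems M s) =
    elems M None \<union> (\<Union>k \<in> {1..}. \<Union>E \<in> def_equivs L M k. elems M (Some (k, E)))"
  proof (intro equalityI subsetI)
    fix x assume "x \<in> (\<Union>s \<in> {s. valid_sort L M s}. elems M s)"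
    then obtain s where "valid_sort L M s" "x \<in> elems M s" by blast
    then show "x \<in> elems M None \<union> (\<Union>k \<in> {1..}. \<Union>E \<in> def_equivs L M k. elems M (Some (k, E)))"
      by (cases s) (auto simp del: sort_arity.simps)
  next
    fix x assume "x \<in> elems M None \<union> (\<Union>k \<in> {1..}. \<Union>E \<in> def_equivs L M k. elems M (Some (k, E)))"
    then show "x \<in> (\<Union>s \<in> {s. valid_sort L M s}. elems M s)"
    proof
      assume "x \<in> elems M None"
      then show ?thesis by (intro UN_I[of None]) simp_all
    next
      assume "x \<in> (\<Union>k \<in> {1..}. \<Union>E \<in> def_equivs L M k. elems M (Some (k, E)))"
      then obtain k E where "1 \<le> k" "E \<in> def_equivs L M k" "x \<in> elems M (Some (k, E))" by auto
      then show ?thesis by (intro UN_I[of "Some (k, E)"]) simp_all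
    qed
  qed
  then show ?thesis by (simp add: eq_struct_def elems_None imaginaries_elems)
qed

lemma sorts_Suc: "sorts L M (Suc n) = sorts L M n \<union> (\<lambda>E. Some (Suc n, E)) ` def_equivs L M (Suc n)"
  by (auto simp: sorts_def le_Suc_eq)

lemma sorts_0: "sorts L M 0 = {None}"
proof -
  have "s = None" if "s \<in> sorts L M 0" for s using that by (cases s) (auto simp: sorts_def)
  then show ?thesis by (auto simp: sorts_def)
qed

lemma level_elems: "level L M n = (\<Union>s \<in> sorts L M n. elems M s)"
  by (induction n) (auto simp: sorts_0 sorts_Suc elems_None imaginaries_elems)

lemma sorts_valid: "s \<in> sorts L M n \<Longrightarrow> valid_sort L M s"
  by (simp add: sorts_def)

lemma level_univ_eq: "level L M n \<subseteq> univ_eq L M"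
  unfolding level_elems univ_eq_elems using sorts_valid by blast

lemma def_equivsD:
  assumes "E \<in> def_equivs L M k"
  shows "equiv (tuples (univ M) k) E"
  using assms by (simp add: def_equivs_def)

lemma def_equivs_eqtp:
  assumes "E \<in> def_equivs L M k" "eqtp L M (xs @ ys) (xs' @ ys')"
    "xs \<in> tuples (univ M) k" "ys \<in> tuples (univ M) k" "xs' \<in> tuples (univ M) k" "ys' \<in> tuples (univ M) k"
  shows "(xs, ys) \<in> E \<longleftrightarrow> (xs', ys') \<in> E"
proof -
  obtain \<phi> where \<phi>: "wf_fm L \<phi>" "fv \<phi> \<subseteq> {..<k + k}"
    "E = {(xs, ys). xs \<in> tuples (univ M) k \<and> ys \<in> tuples (univ M) k \<and> sat M ((!) (xs @ ys)) \<phi>}"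
    using assms(1) unfolding def_equivs_def mem_Collect_eq by (elim exE conjE) (rule that)
  have "fv \<phi> \<subseteq> {..<length (xs @ ys)}" using \<phi>(2) assms(3,4) by (simp add: tuples_def)
  then show ?thesis using eqtp_sat[OF assms(2) \<phi>(1)] assms(3-6) unfolding \<phi>(3) by simp
qed

locale omega_cat_model = saturated_model L M \<kappa>
  for L :: "('f, 'r) lang" and M :: "('f, 'r, 'm) struct" and \<kappa> :: "'k rel" +
  assumes finite_home_types: "finite ((\<lambda>as. tp L M as {}) ` tuples (univ M) k)"
begin

abbreviation U :: "'m set" where "U \<equiv> univ M"
abbreviation LE :: "(unit, ('f, 'r, 'm) eq_sym) lang" where "LE \<equiv> eq_lang L M"
abbreviation ME :: "(unit, ('f, 'r, 'm) eq_sym, 'm imag) struct" where "ME \<equiv> eq_struct L M"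

text \<open>The home sort of \<open>M\<close> is the whole universe, so a closed truth defines
  it.\<close>

sublocale home: finite_type_space L M "univ M" "Neg (Exi 0 (Neg (Eq (Var 0) (Var 0))))"
  by unfold_locales (auto simp: finite_home_types)

text \<open>\<open>Class E C\<close> does not record the arity. \<open>E\<close> determines it,
  because the universe is nonempty and so some tuple of length \<open>k\<close> is related to
  itself.\<close>

lemma def_equivs_arity:
  assumes "E \<in> def_equivs L M k" "E \<in> def_equivs L M k'"
  shows "k = k'"
proof -
  obtain u where "u \<in> U" using univ_nonempty by blast
  then have "replicate k u \<in> tuples U k" by (auto simp: tuples_def)
  then have "(replicate k u, replicate k u) \<in> E"
    using def_equivsD[OF assms(1)] by (auto simp: equiv_def refl_on_def)
  moreover have "E \<subseteq> tuples U k' \<times> tuples U k'" using assms(2) unfolding def_equivs_def by auto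
  ultimately have "replicate k u \<in> tuples U k'" by auto
  then show ?thesis by (simp add: tuples_def)
qed

lemma dec_eq_iff:
  assumes "valid_sort L M s" "valid_sort L M t"
    "as \<in> tuples U (sort_arity s)" "bs \<in> tuples U (sort_arity t)"
  shows "dec s as = dec t bs \<longleftrightarrow> s = t \<and> (case s of None \<Rightarrow> hd as = hd bs | Some (k, E) \<Rightarrow> (as, bs) \<in> E)"
proof (cases s)
  case None
  then show ?thesis by (cases t) auto
next
  case s: (Some p)
  obtain k E where p: "p = (k, E)" by force
  show ?thesis
  proof (cases t)
    case t: (Some q)
    obtain k' E' where q: "q = (k', E')" by force
    show ?thesis
    proof (cases "E = E'")
      case True
      then have "k = k'" using assms(1,2) s t p q def_equivs_arity[of E k k'] by simp
      then show ?thesis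
        using True assms s t p q eq_equiv_class_iff[OF def_equivsD[of E L M k], of as bs] by simp
    qed (use s t p q in auto)
  qed (use s p in auto)
qed

text \<open>Equality within a sort is a definable relation between representatives, hence part of
  their type; elements of different sorts are never equal.\<close>

lemma dec_eq_invariant:
  assumes "valid_sort L M s" "valid_sort L M t"
    "as \<in> tuples U (sort_arity s)" "bs \<in> tuples U (sort_arity t)"
    "as' \<in> tuples U (sort_arity s)" "bs' \<in> tuples U (sort_arity t)" "eqtp L M (as @ bs) (as' @ bs')"
  shows "dec s as = dec t bs \<longleftrightarrow> dec s as' = dec t bs'"
proof (cases "s = t")
  case True
  show ?thesis
  proof (cases s)
    case None
    then obtain a b a' b' where "as = [a]" "bs = [b]" "as' = [a']" "bs' = [b']"
      using assms(3-6) True by (auto simp: tuples_def length_Suc_conv)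
    then show ?thesis
      using eqtp_eq[OF assms(7), of 0 1] None True by simp
  next
    case (Some p)
    obtain k E where p: "p = (k, E)" by force
    then have st: "s = Some (k, E)" "t = Some (k, E)" using True Some by auto
    show ?thesis
      using dec_eq_iff[OF assms(1-4)] dec_eq_iff[OF assms(1,2,5,6)]
        def_equivs_eqtp[of E L M k as bs as' bs'] assms unfolding st by simp
  qed
next
  case False
  then show ?thesis using dec_eq_iff[OF assms(1-4)] dec_eq_iff[OF assms(1,2,5,6)] by simp
qed

text \<open>Both elements are decoded in the same sort from the same positions, once in
  \<open>ms\<close> and once in \<open>ms'\<close>. Sharing positions is what links the two
  sides.\<close>

definition rep_at :: "'m list \<Rightarrow> 'm list \<Rightarrow> 'm imag \<Rightarrow> 'm imag \<Rightarrow> bool" where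
  "rep_at ms ms' x x' \<longleftrightarrow> (\<exists>s is. valid_sort L M s \<and> length is = sort_arity s \<and>
     set is \<subseteq> {..<length ms} \<and> x = dec s (map ((!) ms) is) \<and> x' = dec s (map ((!) ms') is))"

text \<open>The back-and-forth system. It is restricted to the variables in \<open>F\<close>,
  because finitely many representatives need not cover a whole assignment.\<close>

definition rep_rel :: "nat set \<Rightarrow> (nat \<Rightarrow> 'm imag) \<Rightarrow> (nat \<Rightarrow> 'm imag) \<Rightarrow> bool" where
  "rep_rel F e e' \<longleftrightarrow> (\<exists>ms ms'. eqtp L M ms ms' \<and> set ms \<subseteq> U \<and> set ms' \<subseteq> U \<and>
     (\<forall>v \<in> F. rep_at ms ms' (e v) (e' v)))"

lemma rep_at_sym: "rep_at ms ms' x x' \<Longrightarrow> length ms = length ms' \<Longrightarrow> rep_at ms' ms x' x"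
  unfolding rep_at_def by (elim exE conjE) (intro exI conjI, auto)

lemma rep_rel_sym: "rep_rel F e e' \<Longrightarrow> rep_rel F e' e"
proof -
  assume "rep_rel F e e'"
  then obtain ms ms' where ms: "eqtp L M ms ms'" "set ms \<subseteq> U" "set ms' \<subseteq> U"
    "\<forall>v \<in> F. rep_at ms ms' (e v) (e' v)"
    unfolding rep_rel_def by (elim exE conjE) (rule that)
  then have "\<forall>v \<in> F. rep_at ms' ms (e' v) (e v)" using rep_at_sym eqtp_length[OF ms(1)] by blast
  then show ?thesis unfolding rep_rel_def using eqtp_sym[OF ms(1)] ms(2,3) by blast
qed

lemma rep_rel_mono:
  assumes "rep_rel F e e'" "G \<subseteq> F"
  shows "rep_rel G e e'"
proof -
  obtain ms ms' where ms: "eqtp L M ms ms'" "set ms \<subseteq> U" "set ms' \<subseteq> U"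
    "\<forall>v \<in> F. rep_at ms ms' (e v) (e' v)"
    using assms(1) unfolding rep_rel_def by (elim exE conjE) (rule that)
  then show ?thesis using assms(2) unfolding rep_rel_def by (intro exI[of _ ms] exI[of _ ms']) auto
qed

lemma tuples_select:
  assumes "set ms \<subseteq> A" "set is \<subseteq> {..<length ms}" "length is = k"
  shows "map ((!) ms) is \<in> tuples A k"
  using assms by (auto simp: tuples_def subset_iff)

lemma rep_at_Home:
  assumes "rep_at ms ms' (Home c) x'"
  shows "\<exists>i < length ms. c = ms ! i \<and> x' = Home (ms' ! i)"
proof -
  obtain s "is" where s: "valid_sort L M s" "length is = sort_arity s" "set is \<subseteq> {..<length ms}"
    "Home c = dec s (map ((!) ms) is)" "x' = dec s (map ((!) ms') is)"
    using assms unfolding rep_at_def by (elim exE conjE) (rule that)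
  then have "s = None" by (cases s) auto
  then obtain i where "is = [i]" using s(2) by (auto simp: length_Suc_conv)
  then show ?thesis using s \<open>s = None\<close> by auto
qed

lemma rep_at_Homes:
  assumes "map e vs = map Home cs" "\<And>v. v \<in> set vs \<Longrightarrow> rep_at ms ms' (e v) (e' v)"
  shows "\<exists>js. set js \<subseteq> {..<length ms} \<and> cs = map ((!) ms) js \<and> map e' vs = map Home (map ((!) ms') js)"
  using assms
proof (induction vs arbitrary: cs)
  case Nil
  then show ?case by (intro exI[of _ "[]"]) auto
next
  case (Cons v vs)
  then obtain c cs' where cs: "cs = c # cs'" "e v = Home c" "map e vs = map Home cs'" by auto
  obtain js where js: "set js \<subseteq> {..<length ms}" "cs' = map ((!) ms) js"
    "map e' vs = map Home (map ((!) ms') js)" using Cons.IH[OF cs(3)] Cons.prems(2) by auto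
  have "rep_at ms ms' (Home c) (e' v)" using Cons.prems(2)[of v] cs(2) by simp
  from rep_at_Home[OF this] obtain i where "i < length ms" "c = ms ! i" "e' v = Home (ms' ! i)" by blast
  then show ?case using js cs(1) by (intro exI[of _ "i # js"]) auto
qed

lemma rep_at_shift:
  assumes "rep_at ms ms' x x'" "length as = length as'"
  shows "rep_at (as @ ms) (as' @ ms') x x'"
proof -
  obtain s "is" where s: "valid_sort L M s" "length is = sort_arity s" "set is \<subseteq> {..<length ms}"
    "x = dec s (map ((!) ms) is)" "x' = dec s (map ((!) ms') is)"
    using assms unfolding rep_at_def by (elim exE conjE) (rule that)
  let ?is = "map (\<lambda>i. length as + i) is"
  have "map ((!) (as @ ms)) ?is = map ((!) ms) is" "map ((!) (as' @ ms')) ?is = map ((!) ms') is"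
    using assms(2) by (auto simp: nth_append)
  moreover have "set ?is \<subseteq> {..<length (as @ ms)}" using s(3) by auto
  moreover have "length ?is = sort_arity s" using s(2) by simp
  ultimately show ?thesis unfolding rep_at_def using s(1,4,5) by metis
qed

text \<open>The back-and-forth step takes place in the home sort: representatives of
  \<open>x\<close> are put in front of \<open>ms\<close> and matched by homogeneity. The old values
  at \<open>i\<close> are forgotten.\<close>

lemma rep_rel_extend:
  assumes "rep_rel (F - {i}) e e'" "x \<in> univ ME"
  shows "\<exists>y \<in> univ ME. rep_rel F (e(i := x)) (e'(i := y))"
proof -
  obtain s as where s: "valid_sort L M s" "as \<in> tuples U (sort_arity s)" "x = dec s as"
    using assms(2) unfolding univ_eq_elems elems_def by blast
  obtain ms ms' where ms: "eqtp L M ms ms'" "set ms \<subseteq> U" "set ms' \<subseteq> U"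
    "\<forall>v \<in> F - {i}. rep_at ms ms' (e v) (e' v)"
    using assms(1) unfolding rep_rel_def by (elim exE conjE) (rule that)
  obtain as' where as': "set as' \<subseteq> U" "length as' = length as" "eqtp L M (as @ ms) (as' @ ms')"
    using home.homogeneous_tuple[OF ms(1-3), of as] s(2) by (auto simp: tuples_def)
  let ?y = "dec s as'"
  have len: "length as = sort_arity s" using s(2) by (simp add: tuples_def)
  have "?y \<in> univ ME"
    unfolding univ_eq_elems elems_def using s(1) as'(1,2) len by (auto simp: tuples_def)
  moreover have "rep_at (as @ ms) (as' @ ms') x ?y"
  proof -
    have "map ((!) (as @ ms)) [0..<length as] = as" "map ((!) (as' @ ms')) [0..<length as] = as'"
      using as'(2) by (auto intro!: nth_equalityI simp: nth_append)
    moreover have "length [0..<length as] = sort_arity s" using len by simp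
    moreover have "set [0..<length as] \<subseteq> {..<length (as @ ms)}" by auto
    ultimately show ?thesis unfolding rep_at_def using s(1,3) by metis
  qed
  then have "\<forall>v \<in> F. rep_at (as @ ms) (as' @ ms') ((e(i := x)) v) ((e'(i := ?y)) v)"
    using ms(4) rep_at_shift as'(2) by simp
  moreover have "set (as @ ms) \<subseteq> U" "set (as' @ ms') \<subseteq> U" using s(2) ms as'(1) by (auto simp: tuples_def)
  ultimately show ?thesis unfolding rep_rel_def using as'(3) by blast
qed

text \<open>Every symbol of the expansion expresses something about representatives that their type
  in the home sort and their sorts decide. One direction is enough, since \<open>rep_rel\<close> is
  symmetric.\<close>

lemma rep_rel_rint:
  assumes wf: "wf_fm LE (Rel R (map Var vs))" and rep: "rep_rel (set vs) e e'"
    and R: "rint ME R (map e vs)"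
  shows "rint ME R (map e' vs)"
proof -
  obtain ms ms' where ms: "eqtp L M ms ms'" "set ms \<subseteq> U" "set ms' \<subseteq> U"
    "\<And>v. v \<in> set vs \<Longrightarrow> rep_at ms ms' (e v) (e' v)"
    using rep unfolding rep_rel_def by blast
  have lenm: "length ms = length ms'" using ms(1) by (rule eqtp_length)
  have R': "R \<in> rels LE" using wf by simp
  have select: "map ((!) ms') js \<in> tuples U (length js)" if "set js \<subseteq> {..<length ms}" for js
    using tuples_select[of ms' U js] ms(3) that lenm by simp
  show ?thesis
  proof (cases R)
    case (FunGraph f)
    let ?k = "farity L f"
    obtain as where as: "as \<in> tuples U ?k" "map e vs = map Home (as @ [fint M f as])"
      using R by (auto simp: eq_struct_def FunGraph)
    from rep_at_Homes[OF as(2) ms(4)] obtain js where js: "set js \<subseteq> {..<length ms}"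
      "as @ [fint M f as] = map ((!) ms) js" "map e' vs = map Home (map ((!) ms') js)" by blast
    let ?cs = "as @ [fint M f as]" and ?cs' = "map ((!) ms') js"
    have len: "length as = ?k" using as(1) by (simp add: tuples_def)
    have "length ?cs = length js" using js(2) by (metis length_map)
    then have lenj: "length js = Suc ?k" using len by simp
    have eq: "eqtp L M ?cs ?cs'" unfolding js(2) using eqtp_select[OF ms(1) js(1)] .
    \<comment> \<open>The graph of \<open>f\<close> in the original language, with the value in the
      last variable.\<close>
    let ?\<phi> = "Eq (App f (map Var [0..<?k])) (Var ?k) :: ('f, 'r) fm"
    have map_eval: "map (eval M ((!) (ds @ [d]))) (map Var [0..<?k]) = ds" if "length ds = ?k" for ds d
      using that by (auto intro!: nth_equalityI simp: nth_append)
    have sat: "sat M ((!) (ds @ [d])) ?\<phi> \<longleftrightarrow> d = fint M f ds" if "length ds = ?k" for ds d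
      using map_eval[OF that, of d] that by (simp only: sat.simps eval.simps) (auto simp: nth_append)
    have "f \<in> funs L" using R' FunGraph by (auto simp: eq_lang_def)
    then have wf\<phi>: "wf_fm L ?\<phi>" by (auto simp: list_all_iff)
    have fv\<phi>: "fv ?\<phi> \<subseteq> {..<length ?cs}" using len by auto
    obtain ds d where ds: "?cs' = ds @ [d]" using lenj by (cases ?cs' rule: rev_cases) auto
    have lds: "length ds = ?k" using arg_cong[OF ds, of length] lenj by simp
    have "sat M ((!) ?cs) ?\<phi>" using sat[OF len] by simp
    then have "sat M ((!) (ds @ [d])) ?\<phi>" using eqtp_sat[OF eq wf\<phi> fv\<phi>] unfolding ds by simp
    then have "d = fint M f ds" using sat[OF lds] by simp
    moreover have "ds \<in> tuples U ?k" using select[OF js(1)] ds lds by (auto simp: tuples_def)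
    ultimately show ?thesis using js(3) ds by (auto simp: eq_struct_def FunGraph)
  next
    case (OldRel r)
    let ?k = "rarity L r"
    obtain as where as: "as \<in> tuples U ?k" "rint M r as" "map e vs = map Home as"
      using R by (auto simp: eq_struct_def OldRel)
    from rep_at_Homes[OF as(3) ms(4)] obtain js where js: "set js \<subseteq> {..<length ms}"
      "as = map ((!) ms) js" "map e' vs = map Home (map ((!) ms') js)" by blast
    have len: "length as = ?k" "length js = ?k" using as(1) js(2) by (auto simp: tuples_def)
    have eq: "eqtp L M as (map ((!) ms') js)" unfolding js(2) using eqtp_select[OF ms(1) js(1)] .
    let ?\<phi> = "Rel r (map Var [0..<?k]) :: ('f, 'r) fm"
    have map_eval: "map (eval M ((!) ds)) (map Var [0..<?k]) = ds" if "length ds = ?k" for ds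
      using that by (auto intro!: nth_equalityI)
    have sat: "sat M ((!) ds) ?\<phi> \<longleftrightarrow> rint M r ds" if "length ds = ?k" for ds
      using map_eval[OF that] by (simp only: sat.simps)
    have "r \<in> rels L" using R' OldRel by (auto simp: eq_lang_def)
    then have wf\<phi>: "wf_fm L ?\<phi>" by (auto simp: list_all_iff)
    have fv\<phi>: "fv ?\<phi> \<subseteq> {..<length as}" using len by auto
    have "rint M r (map ((!) ms') js)"
      using eqtp_sat[OF eq wf\<phi> fv\<phi>] sat[of as] sat[of "map ((!) ms') js"] as(2) len by simp
    then show ?thesis using js(3) select[OF js(1)] len by (auto simp: eq_struct_def OldRel)
  next
    case (SortOf E)
    obtain C where C: "map e vs = [Class E C]" using R by (auto simp: eq_struct_def SortOf)
    then obtain v where v: "vs = [v]" "e v = Class E C" by auto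
    obtain s "is" where "e v = dec s (map ((!) ms) is)" "e' v = dec s (map ((!) ms') is)"
      using ms(4)[of v] v(1) unfolding rep_at_def by auto
    \<comment> \<open>The two sides share the sort \<open>s\<close>, so both are classes of the same
      relation.\<close>
    then have "\<exists>C. e' v = Class E C" using v(2) by (cases s) auto
    then show ?thesis using v(1) by (auto simp: eq_struct_def SortOf)
  next
    case (Proj k E)
    obtain as where as: "as \<in> tuples U k" "map e vs = map Home as @ [Class E (E `` {as})]"
      using R by (auto simp: eq_struct_def Proj)
    then obtain ws v where vs: "vs = ws @ [v]" by (cases vs rule: rev_cases) auto
    have e: "map e ws = map Home as" "e v = dec (Some (k, E)) as" using as(2) vs by auto
    have "\<exists>js. set js \<subseteq> {..<length ms} \<and> as = map ((!) ms) js \<and> map e' ws = map Home (map ((!) ms') js)"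
      by (rule rep_at_Homes[OF e(1)]) (use ms(4) vs in auto)
    then obtain js where js: "set js \<subseteq> {..<length ms}"
      "as = map ((!) ms) js" "map e' ws = map Home (map ((!) ms') js)" by blast
    have "rep_at ms ms' (e v) (e' v)" using ms(4) vs by simp
    then obtain s "is" where s: "valid_sort L M s" "length is = sort_arity s" "set is \<subseteq> {..<length ms}"
      "e v = dec s (map ((!) ms) is)" "e' v = dec s (map ((!) ms') is)"
      unfolding rep_at_def by (elim exE conjE) (rule that)
    have len: "length js = k" using as(1) js(2) by (simp add: tuples_def)
    have valid: "valid_sort L M (Some (k, E))" using R' Proj by (auto simp: eq_lang_def)
    \<comment> \<open>The projection graph amounts to an equation between two imaginaries,
      represented at the positions \<open>is\<close> and \<open>js\<close>, and such equations are
      invariant.\<close>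
    have "eqtp L M (map ((!) ms) is @ map ((!) ms) js) (map ((!) ms') is @ map ((!) ms') js)"
      using eqtp_select[OF ms(1), of "is @ js"] js(1) s(3) by simp
    then have "dec s (map ((!) ms) is) = dec (Some (k, E)) (map ((!) ms) js) \<longleftrightarrow>
      dec s (map ((!) ms') is) = dec (Some (k, E)) (map ((!) ms') js)"
      using s len lenm js(1) ms(2,3) valid
      by (intro dec_eq_invariant) (auto intro!: tuples_select)
    then have "e' v = Class E (E `` {map ((!) ms') js})" using e(2) s(4,5) js(2) by simp
    moreover have "map ((!) ms') js \<in> tuples U k" using select[OF js(1)] len by simp
    ultimately show ?thesis using js(3) vs by (auto simp: eq_struct_def Proj intro!: bexI[of _ "map ((!) ms') js"])
  qed
qed

lemma wf_tm_LE: "wf_tm LE t \<Longrightarrow> \<exists>v. t = Var v"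
  by (cases t) (auto simp: eq_lang_def)

lemma wf_tms_LE: "list_all (wf_tm LE) ts \<Longrightarrow> \<exists>vs. ts = map Var vs"
  using wf_tm_LE by (metis ex_map_conv list_all_iff)

text \<open>The expansion has no function symbols, so atomic formulas concern variables only. The
  quantifier case is the back-and-forth step, applied in both directions.\<close>

lemma rep_rel_sat:
  assumes "wf_fm LE \<phi>" "rep_rel (fv \<phi>) e e'"
  shows "sat ME e \<phi> = sat ME e' \<phi>"
  using assms
proof (induction \<phi> arbitrary: e e')
  case (Eq t1 t2)
  then obtain u v where t: "t1 = Var u" "t2 = Var v" using wf_tm_LE by (metis wf_fm.simps(1))
  obtain ms ms' where ms: "eqtp L M ms ms'" "set ms \<subseteq> U" "set ms' \<subseteq> U"
    "rep_at ms ms' (e u) (e' u)" "rep_at ms ms' (e v) (e' v)"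
    using Eq.prems(2) t unfolding rep_rel_def by auto
  have lenm: "length ms = length ms'" using ms(1) by (rule eqtp_length)
  from ms(4) obtain s "is" where s: "valid_sort L M s" "length is = sort_arity s" "set is \<subseteq> {..<length ms}"
    "e u = dec s (map ((!) ms) is)" "e' u = dec s (map ((!) ms') is)"
    unfolding rep_at_def by (elim exE conjE) (rule that)
  from ms(5) obtain t js where t': "valid_sort L M t" "length js = sort_arity t" "set js \<subseteq> {..<length ms}"
    "e v = dec t (map ((!) ms) js)" "e' v = dec t (map ((!) ms') js)"
    unfolding rep_at_def by (elim exE conjE) (rule that)
  have "eqtp L M (map ((!) ms) is @ map ((!) ms) js) (map ((!) ms') is @ map ((!) ms') js)"
    using eqtp_select[OF ms(1), of "is @ js"] t'(3) s(3) by simp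
  then have "dec s (map ((!) ms) is) = dec t (map ((!) ms) js) \<longleftrightarrow>
    dec s (map ((!) ms') is) = dec t (map ((!) ms') js)"
    using s(1-3) t'(1-3) lenm ms(2,3)
    by (intro dec_eq_invariant) (auto intro!: tuples_select)
  then show ?case using t s(4,5) t'(4,5) by simp
next
  case (Rel R ts)
  then obtain vs where ts: "ts = map Var vs" using wf_tms_LE by (metis wf_fm.simps(2))
  have rep: "rep_rel (set vs) e e'" using Rel.prems(2) ts by simp
  have "rint ME R (map e vs) = rint ME R (map e' vs)"
    using rep_rel_rint[OF _ rep] rep_rel_rint[OF _ rep_rel_sym[OF rep]] Rel.prems(1) ts by blast
  then show ?case using ts by (simp add: comp_def)
next
  case (Exi i \<phi>)
  have wf: "wf_fm LE \<phi>" using Exi.prems by simp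
  have "sat ME e' (Exi i \<phi>)" if "sat ME e (Exi i \<phi>)" "rep_rel (fv \<phi> - {i}) e e'" for e e'
  proof -
    from that(1) obtain x where x: "x \<in> univ ME" "sat ME (e(i := x)) \<phi>" by auto
    from rep_rel_extend[OF that(2) x(1)] obtain y where "y \<in> univ ME" "rep_rel (fv \<phi>) (e(i := x)) (e'(i := y))"
      by blast
    then show ?thesis using Exi.IH[OF wf] x(2) by auto
  qed
  from this[of e e'] this[of e' e] show ?case
    using Exi.prems(2) rep_rel_sym[OF Exi.prems(2)] by (simp only: fv.simps) blast
next
  case (Conj \<phi> \<psi>)
  have "rep_rel (fv \<phi>) e e'" "rep_rel (fv \<psi>) e e'"
    by (rule rep_rel_mono[OF Conj.prems(2)]; simp)+
  then show ?case using Conj.IH Conj.prems(1) by simp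
qed auto

section \<open>Tuples of imaginaries coded by home tuples\<close>

fun decs :: "(nat \<times> 'm list rel) option list \<Rightarrow> 'm list \<Rightarrow> 'm imag list" where
  "decs [] ms = []"
| "decs (s # ss) ms = dec s (take (sort_arity s) ms) # decs ss (drop (sort_arity s) ms)"

abbreviation arity :: "(nat \<times> 'm list rel) option list \<Rightarrow> nat" where
  "arity ss \<equiv> sum_list (map sort_arity ss)"

lemma length_decs: "length (decs ss ms) = length ss"
  by (induction ss arbitrary: ms) auto

lemma decs_append: "length ms = arity ss \<Longrightarrow> decs (ss @ ss') (ms @ ms') = decs ss ms @ decs ss' ms'"
  by (induction ss arbitrary: ms) auto

text \<open>The positions \<open>is\<close> do not depend on \<open>ms\<close>; this makes the
  entries of two decoded tuples comparable by \<open>rep_at\<close>.\<close>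

lemma decs_nth:
  "v < length ss \<Longrightarrow> \<exists>is. length is = sort_arity (ss ! v) \<and> set is \<subseteq> {..<arity ss} \<and>
    (\<forall>ms. length ms = arity ss \<longrightarrow> decs ss ms ! v = dec (ss ! v) (map ((!) ms) is))"
proof (induction ss arbitrary: v)
  case (Cons s ss)
  let ?k = "sort_arity s"
  show ?case
  proof (cases v)
    case 0
    have "take ?k ms = map ((!) ms) [0..<?k]" if "length ms = ?k + arity ss" for ms :: "'m list"
      using that by (auto intro!: nth_equalityI)
    then show ?thesis using 0 by (intro exI[of _ "[0..<?k]"]) auto
  next
    case (Suc w)
    from Cons.IH[of w] Cons.prems Suc obtain "is" where "is": "length is = sort_arity (ss ! w)"
      "set is \<subseteq> {..<arity ss}"
      "\<And>ms. length ms = arity ss \<Longrightarrow> decs ss ms ! w = dec (ss ! w) (map ((!) ms) is)" by auto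
    let ?is = "map (\<lambda>i. ?k + i) is"
    have "decs (s # ss) ms ! v = dec ((s # ss) ! v) (map ((!) ms) ?is)"
      if "length ms = arity (s # ss)" for ms
    proof -
      have "map ((!) (drop ?k ms)) is = map ((!) ms) ?is"
        using that "is"(2) by auto
      then show ?thesis using "is"(3)[of "drop ?k ms"] that Suc by (simp only:) simp
    qed
    moreover have "length ?is = sort_arity ((s # ss) ! v)" "set ?is \<subseteq> {..<arity (s # ss)}"
      using "is"(1,2) Suc by auto
    ultimately show ?thesis by blast
  qed
qed simp

lemma decs_eqtp:
  assumes "list_all (valid_sort L M) ss" "eqtp L M ms ms'" "ms \<in> tuples U (arity ss)"
    "ms' \<in> tuples U (arity ss)"
  shows "eqtp LE ME (decs ss ms) (decs ss ms')"
  unfolding eqtp_def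
proof (intro conjI allI impI)
  fix \<phi> assume \<phi>: "wf_fm LE \<phi> \<and> fv \<phi> \<subseteq> {..<length (decs ss ms)}"
  have len: "length ms = arity ss" "length ms' = arity ss" using assms(3,4) by (auto simp: tuples_def)
  have "rep_at ms ms' (decs ss ms ! v) (decs ss ms' ! v)" if "v \<in> fv \<phi>" for v
  proof -
    have v: "v < length ss" using that \<phi> by (auto simp: length_decs)
    obtain "is" where "is": "length is = sort_arity (ss ! v)" "set is \<subseteq> {..<arity ss}"
      "\<And>ms. length ms = arity ss \<Longrightarrow> decs ss ms ! v = dec (ss ! v) (map ((!) ms) is)"
      using decs_nth[OF v] by blast
    have "valid_sort L M (ss ! v)" using assms(1) v by (auto simp: list_all_length)
    then show ?thesis unfolding rep_at_def using "is"(1,2) "is"(3)[OF len(1)] "is"(3)[OF len(2)] len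
      by (intro exI[of _ "ss ! v"] exI[of _ "is"]) auto
  qed
  then have "rep_rel (fv \<phi>) ((!) (decs ss ms)) ((!) (decs ss ms'))"
    unfolding rep_rel_def using assms(2-4) by (intro exI[of _ ms] exI[of _ ms']) (auto simp: tuples_def)
  then show "sat ME ((!) (decs ss ms)) \<phi> = sat ME ((!) (decs ss ms')) \<phi>"
    using rep_rel_sat \<phi> by blast
qed (simp add: length_decs)

lemma decs_surj:
  assumes "list_all2 (\<lambda>s g. g \<in> elems M s) ss gs"
  shows "\<exists>ms \<in> tuples U (arity ss). gs = decs ss ms"
  using assms
proof (induction rule: list_all2_induct)
  case Nil
  show ?case by (auto simp: tuples_def)
next
  case (Cons s ss g gs)
  then obtain ms as where "ms \<in> tuples U (arity ss)" "gs = decs ss ms"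
    "as \<in> tuples U (sort_arity s)" "g = dec s as" by (auto simp: elems_def)
  then show ?case by (intro bexI[of _ "as @ ms"]) (auto simp: tuples_def)
qed

lemma decs_elems:
  assumes "ms \<in> tuples U (arity ss)"
  shows "list_all2 (\<lambda>s g. g \<in> elems M s) ss (decs ss ms)"
  using assms
proof (induction ss arbitrary: ms)
  case (Cons s ss)
  have "set (drop (sort_arity s) ms) \<subseteq> U" "set (take (sort_arity s) ms) \<subseteq> U"
    using Cons.prems set_drop_subset[of "sort_arity s" ms] set_take_subset[of "sort_arity s" ms]
    by (auto simp: tuples_def)
  then have "drop (sort_arity s) ms \<in> tuples U (arity ss)"
    "take (sort_arity s) ms \<in> tuples U (sort_arity s)"
    using Cons.prems by (auto simp: tuples_def)
  then show ?case using Cons.IH by (auto simp: elems_def)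
qed simp

text \<open>A relation definable without parameters is determined by the set of types of the pairs
  in it, and a finite set of types has finitely many subsets. Hence a level consists of finitely
  many sorts.\<close>

lemma finite_def_equivs: "finite (def_equivs L M k)"
proof -
  let ?t = "\<lambda>E. (\<lambda>(xs, ys). tp L M (xs @ ys) {}) ` E"
  have sub: "E \<subseteq> tuples U k \<times> tuples U k" if "E \<in> def_equivs L M k" for E
    using that by (auto simp: def_equivs_def)
  have "?t ` def_equivs L M k \<subseteq> Pow ((\<lambda>as. tp L M as {}) ` tuples U (k + k))"
    using sub by (fastforce simp: tuples_def)
  then have "finite (?t ` def_equivs L M k)"
    by (rule finite_subset) (simp add: finite_home_types)
  moreover have "inj_on ?t (def_equivs L M k)"
  proof (rule inj_onI)
    have "E \<subseteq> F" if E: "E \<in> def_equivs L M k" and F: "F \<in> def_equivs L M k" and eq: "?t E = ?t F" for E F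
    proof
      fix p assume p: "p \<in> E"
      obtain xs ys where xy: "p = (xs, ys)" by force
      have "tp L M (xs @ ys) {} \<in> ?t E" using p xy by (intro image_eqI[of _ _ "(xs, ys)"]) simp_all
      then have "tp L M (xs @ ys) {} \<in> ?t F" by (simp only: eq)
      then obtain xs' ys' where xy': "(xs', ys') \<in> F" "tp L M (xs @ ys) {} = tp L M (xs' @ ys') {}" by auto
      have T: "xs \<in> tuples U k" "ys \<in> tuples U k" "xs' \<in> tuples U k" "ys' \<in> tuples U k"
        using sub[OF E] sub[OF F] p xy xy'(1) by auto
      then have "eqtp L M (xs @ ys) (xs' @ ys')"
        using xy'(2) tp_eq_iff[of "xs @ ys" "xs' @ ys'" L M] by (simp add: tuples_def)
      then show "p \<in> F" using def_equivs_eqtp[OF F _ T] xy xy'(1) by simp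
    qed
    then show "E = F" if "E \<in> def_equivs L M k" "F \<in> def_equivs L M k" "?t E = ?t F" for E F
      using that by (metis subset_antisym)
  qed
  ultimately show ?thesis by (rule finite_imageD)
qed

lemma finite_sorts: "finite (sorts L M n)"
  by (induction n) (auto simp: sorts_0 sorts_Suc finite_def_equivs)

text \<open>The language of the expansion has no predicate for the home sort. The sort is recovered
  as the set of elements that have a projection to the quotient of the 1-tuples by equality.\<close>

lemma home_formula_ex:
  "\<exists>\<phi>. wf_fm LE \<phi> \<and> fv \<phi> \<subseteq> {0} \<and> (\<forall>e. e 0 \<in> univ ME \<longrightarrow> (sat ME e \<phi> \<longleftrightarrow> e 0 \<in> elems M None))"
proof -
  define E where "E = {(xs, ys). xs \<in> tuples U 1 \<and> ys \<in> tuples U 1 \<and>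
    sat M ((!) (xs @ ys)) (Eq (Var 0) (Var 1))}"
  have E_eq: "E = Id_on (tuples U 1)"
    unfolding E_def by (auto simp: tuples_def length_Suc_conv)
  have "equiv (tuples U 1) E"
    unfolding E_eq by (auto simp: equiv_def refl_on_def sym_def trans_def)
  then have E: "E \<in> def_equivs L M 1"
    unfolding def_equivs_def mem_Collect_eq
    by (intro conjI exI[of _ "Eq (Var 0) (Var 1)"] E_def) auto
  let ?\<phi> = "Exi 1 (Rel (Proj 1 E) [Var 0, Var 1]) :: (unit, ('f, 'r, 'm) eq_sym) fm"
  have "Proj 1 E \<in> rels LE" using E unfolding eq_lang_def by (simp del: One_nat_def)
  then have "wf_fm LE ?\<phi>" by (simp add: eq_lang_def del: One_nat_def)
  moreover have "sat ME e ?\<phi> \<longleftrightarrow> e 0 \<in> elems M None" for e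
  proof
    assume "sat ME e ?\<phi>"
    then obtain y as where "as \<in> tuples U 1" "[e 0, y] = map Home as @ [Class E (E `` {as})]"
      by (auto simp: eq_struct_def simp del: One_nat_def)
    then show "e 0 \<in> elems M None" unfolding elems_None by (auto simp: tuples_def length_Suc_conv)
  next
    assume "e 0 \<in> elems M None"
    then obtain a where a: "a \<in> U" "e 0 = Home a" unfolding elems_None by blast
    let ?y = "dec (Some (1, E)) [a]"
    have a1: "[a] \<in> tuples U 1" using a(1) by (simp add: tuples_def)
    have "?y \<in> elems M (Some (1, E))" unfolding elems_def using a1 by simp
    moreover have "valid_sort L M (Some (1, E))" using E by simp
    ultimately have "?y \<in> univ ME" unfolding univ_eq_elems by blast
    moreover have "rint ME (Proj 1 E) [Home a, ?y]"
      using a1 by (auto simp: eq_struct_def simp del: One_nat_def intro!: bexI[of _ "[a]"])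
    ultimately show "sat ME e ?\<phi>" using a(2) by (auto simp del: One_nat_def intro!: bexI[of _ ?y])
  qed
  moreover have "fv ?\<phi> \<subseteq> {0}" by auto
  ultimately show ?thesis by blast
qed

lemma sort_formula_ex:
  assumes "valid_sort L M s"
  shows "\<exists>\<phi>. wf_fm LE \<phi> \<and> fv \<phi> \<subseteq> {0} \<and> (\<forall>e. e 0 \<in> univ ME \<longrightarrow> (sat ME e \<phi> \<longleftrightarrow> e 0 \<in> elems M s))"
proof (cases s)
  case None
  then show ?thesis using home_formula_ex by simp
next
  case (Some p)
  obtain k E where p: "p = (k, E)" by force
  have kE: "1 \<le> k" "E \<in> def_equivs L M k" using assms Some p by auto
  let ?\<phi> = "Rel (SortOf E) [Var 0] :: (unit, ('f, 'r, 'm) eq_sym) fm"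
  have "SortOf E \<in> rels LE" using kE unfolding eq_lang_def by auto
  then have "wf_fm LE ?\<phi>" by (simp add: eq_lang_def)
  moreover have "sat ME e ?\<phi> \<longleftrightarrow> e 0 \<in> elems M s" if e0: "e 0 \<in> univ ME" for e
  proof
    assume "sat ME e ?\<phi>"
    then obtain C where C: "e 0 = Class E C" by (auto simp: eq_struct_def)
    \<comment> \<open>The predicate names only \<open>E\<close>; the arity of the sort has to be
      recovered from it.\<close>
    obtain t where t: "valid_sort L M t" "e 0 \<in> elems M t" using e0 unfolding univ_eq_elems by blast
    then obtain k' where "t = Some (k', E)" using C by (cases t) (auto simp: elems_def)
    then have "t = s" using t(1) def_equivs_arity[OF kE(2)] Some p by auto
    then show "e 0 \<in> elems M s" using t by simp
  next
    assume "e 0 \<in> elems M s"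
    then show "sat ME e ?\<phi>" using Some p by (auto simp: elems_def eq_struct_def)
  qed
  ultimately show ?thesis by (intro exI[of _ ?\<phi>]) auto
qed

text \<open>Every sort is defined by a formula without parameters, so the sorts of the entries are
  part of the type of a tuple.\<close>

lemma eqtp_elems:
  assumes "eqtp LE ME gs fs" "list_all2 (\<lambda>s g. g \<in> elems M s) ss fs" "list_all (valid_sort L M) ss"
    "set gs \<subseteq> univ ME"
  shows "list_all2 (\<lambda>s g. g \<in> elems M s) ss gs"
proof (rule list_all2_all_nthI)
  have len: "length ss = length fs" "length gs = length fs"
    using assms(1,2) eqtp_length list_all2_lengthD by blast+
  then show "length ss = length gs" by simp
  fix i assume i: "i < length ss"
  have s: "valid_sort L M (ss ! i)" using assms(3) i by (auto simp: list_all_length)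
  have f: "fs ! i \<in> elems M (ss ! i)" using assms(2) i by (auto simp: list_all2_conv_all_nth)
  from sort_formula_ex[OF s] obtain \<phi> where \<phi>: "wf_fm LE \<phi>" "fv \<phi> \<subseteq> {0}"
    "\<And>e. e 0 \<in> univ ME \<Longrightarrow> sat ME e \<phi> \<longleftrightarrow> e 0 \<in> elems M (ss ! i)" by blast
  have "eqtp LE ME [gs ! i] [fs ! i]"
    using eqtp_select[OF assms(1), of "[i]"] len i by simp
  from eqtp_sat[OF this \<phi>(1)] have "sat ME ((!) [gs ! i]) \<phi> = sat ME ((!) [fs ! i]) \<phi>" using \<phi>(2) by auto
  moreover have "gs ! i \<in> univ ME" using assms(4) len i by auto
  moreover have "fs ! i \<in> univ ME" using f s unfolding univ_eq_elems by blast
  ultimately show "gs ! i \<in> elems M (ss ! i)" using \<phi>(3)[of "(!) [gs ! i]"] \<phi>(3)[of "(!) [fs ! i]"] f by simp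
qed

lemma level_sorts_ex:
  assumes "set gs \<subseteq> level L M n"
  shows "\<exists>ss. set ss \<subseteq> sorts L M n \<and> length ss = length gs \<and> list_all2 (\<lambda>s g. g \<in> elems M s) ss gs"
  using assms
proof (induction gs)
  case (Cons g gs)
  then obtain ss where ss: "set ss \<subseteq> sorts L M n" "length ss = length gs"
    "list_all2 (\<lambda>s g. g \<in> elems M s) ss gs" by auto
  obtain s where "s \<in> sorts L M n" "g \<in> elems M s" using Cons.prems by (auto simp: level_elems)
  then show ?case using ss by (intro exI[of _ "s # ss"]) auto
qed simp

lemma eqtp_level:
  assumes "eqtp LE ME gs fs" "set fs \<subseteq> level L M n" "set gs \<subseteq> univ ME"
  shows "set gs \<subseteq> level L M n"
proof -
  obtain ss where ss: "set ss \<subseteq> sorts L M n" "list_all2 (\<lambda>s g. g \<in> elems M s) ss fs"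
    using level_sorts_ex[OF assms(2)] by blast
  have "list_all (valid_sort L M) ss" using ss(1) sorts_valid[of _ L M n] by (auto simp: list_all_iff)
  from eqtp_elems[OF assms(1) ss(2) this assms(3)]
  show ?thesis unfolding level_elems using ss(1) by (fastforce simp: list_all2_conv_all_nth in_set_conv_nth)
qed

lemma finite_image_factor:
  assumes "finite (f ` X)" "\<And>x y. x \<in> X \<Longrightarrow> y \<in> X \<Longrightarrow> f x = f y \<Longrightarrow> g x = g y"
  shows "finite (g ` X)"
proof -
  have "g x = g (inv_into X f (f x))" if "x \<in> X" for x
    using that by (intro assms(2)) (auto simp: inv_into_into f_inv_into_f)
  then have "g ` X \<subseteq> (\<lambda>t. g (inv_into X f t)) ` f ` X" by auto
  then show ?thesis using assms(1) finite_subset by blast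
qed

text \<open>There are finitely many lists of sorts, and for each list the type of the decoded tuple
  factors through one of the finitely many types of home tuples.\<close>

lemma finite_level_types: "finite ((\<lambda>as. tp_eq L M as {}) ` tuples (level L M n) k)"
proof -
  let ?S = "{ss. set ss \<subseteq> sorts L M n \<and> length ss = k}"
  have "finite ((\<lambda>ms. tp_eq L M (decs ss ms) {}) ` tuples U (arity ss))" if "ss \<in> ?S" for ss
  proof (rule finite_image_factor[OF finite_home_types])
    fix ms ms' assume ms: "ms \<in> tuples U (arity ss)" "ms' \<in> tuples U (arity ss)" "tp L M ms {} = tp L M ms' {}"
    then have "eqtp L M ms ms'" using tp_eq_iff[of ms ms' L M] by (simp add: tuples_def)
    moreover have "list_all (valid_sort L M) ss" using that sorts_valid[of _ L M n] by (auto simp: list_all_iff)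
    ultimately show "tp_eq L M (decs ss ms) {} = tp_eq L M (decs ss ms') {}"
      using decs_eqtp ms tp_eq_iff[of "decs ss ms" "decs ss ms'" LE ME] by (simp add: length_decs)
  qed
  moreover have "finite ?S" using finite_lists_length_eq[OF finite_sorts] .
  ultimately have "finite (\<Union>ss \<in> ?S. (\<lambda>ms. tp_eq L M (decs ss ms) {}) ` tuples U (arity ss))" by blast
  moreover have "(\<lambda>as. tp_eq L M as {}) ` tuples (level L M n) k \<subseteq>
    (\<Union>ss \<in> ?S. (\<lambda>ms. tp_eq L M (decs ss ms) {}) ` tuples U (arity ss))"
  proof
    fix t assume "t \<in> (\<lambda>as. tp_eq L M as {}) ` tuples (level L M n) k"
    then obtain gs where gs: "set gs \<subseteq> level L M n" "length gs = k" "t = tp_eq L M gs {}"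
      by (auto simp: tuples_def)
    from level_sorts_ex[OF gs(1)] obtain ss where ss: "set ss \<subseteq> sorts L M n" "length ss = k"
      "list_all2 (\<lambda>s g. g \<in> elems M s) ss gs" using gs(2) by auto
    from decs_surj[OF ss(3)] obtain ms where "ms \<in> tuples U (arity ss)" "gs = decs ss ms" by blast
    then show "t \<in> (\<Union>ss \<in> ?S. (\<lambda>ms. tp_eq L M (decs ss ms) {}) ` tuples U (arity ss))"
      using gs(3) ss by blast
  qed
  ultimately show ?thesis by (rule finite_subset[rotated])
qed

lemma level_type_space: "\<exists>\<delta>. finite_type_space LE ME (level L M n) \<delta>"
proof -
  have "\<forall>s \<in> sorts L M n. \<exists>\<phi>. wf_fm LE \<phi> \<and> fv \<phi> \<subseteq> {0} \<and>
    (\<forall>e. e 0 \<in> univ ME \<longrightarrow> (sat ME e \<phi> \<longleftrightarrow> e 0 \<in> elems M s))"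
    using sort_formula_ex sorts_valid by blast
  from bchoice[OF this] obtain \<phi> where \<phi>: "\<forall>s \<in> sorts L M n. wf_fm LE (\<phi> s) \<and> fv (\<phi> s) \<subseteq> {0} \<and>
    (\<forall>e. e 0 \<in> univ ME \<longrightarrow> (sat ME e (\<phi> s) \<longleftrightarrow> e 0 \<in> elems M s))" by (elim exE) (rule that)
  let ?F = "\<phi> ` sorts L M n"
  have "\<exists>\<delta>. wf_fm LE \<delta> \<and> fv \<delta> \<subseteq> \<Union> (fv ` ?F) \<and>
    (\<forall>(N :: (unit, ('f, 'r, 'm) eq_sym, 'm imag) struct) e. sat N e \<delta> \<longleftrightarrow> (\<exists>\<psi> \<in> ?F. sat N e \<psi>))"
    using \<phi> finite_sorts[of n] by (intro disj_ex) auto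
  then obtain \<delta> where \<delta>: "wf_fm LE \<delta>" "fv \<delta> \<subseteq> \<Union> (fv ` ?F)"
    "\<And>e. sat ME e \<delta> \<longleftrightarrow> (\<exists>\<psi> \<in> ?F. sat ME e \<psi>)"
    by (elim exE conjE) (rule that; (assumption | erule spec | erule allE, erule spec))
  have "finite_type_space LE ME (level L M n) \<delta>"
  proof
    show "level L M n \<subseteq> univ ME" by (rule level_univ_eq)
    show "wf_fm LE \<delta>" by (rule \<delta>(1))
    show "fv \<delta> \<subseteq> {0}" using \<delta>(2) \<phi> by blast
    show "finite ((\<lambda>as. tp LE ME as {}) ` tuples (level L M n) k)" for k by (rule finite_level_types)
    show "sat ME (\<lambda>_. x) \<delta> \<longleftrightarrow> x \<in> level L M n" if "x \<in> univ ME" for x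
    proof -
      have "sat ME (\<lambda>_. x) (\<phi> s) \<longleftrightarrow> x \<in> elems M s" if "s \<in> sorts L M n" for s
        using bspec[OF \<phi> that] \<open>x \<in> univ ME\<close> by simp
      then show ?thesis unfolding level_elems \<delta>(3) by simp
    qed
  qed
  then show ?thesis ..
qed

end


section \<open>Independence in a level\<close>

context omega_cat_model
begin

text \<open>An invariant property is a finite union of types over \<open>rs\<close>, each isolated
  by a formula. This is how conditions on types and independence in the expansion come under
  saturation of the home structure without formulas being exhibited.\<close>

lemma pdef_invariant:
  assumes "set rs \<subseteq> U"
    and inv: "\<And>xs xs'. xs \<in> tuples U N \<Longrightarrow> xs' \<in> tuples U N \<Longrightarrow> eqtp L M (xs @ rs) (xs' @ rs) \<Longrightarrow> P xs \<Longrightarrow> P xs'"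
  shows "pdef L M (set rs) N P"
proof -
  let ?t = "\<lambda>xs. tp L M (xs @ rs) {}"
  let ?X = "{xs \<in> tuples U N. P xs}"
  have "?t ` ?X \<subseteq> (\<lambda>as. tp L M as {}) ` tuples U (N + length rs)"
    using assms(1) by (auto simp: tuples_def intro!: imageI)
  then have "finite (?t ` ?X)" using finite_home_types by (rule finite_subset)
  have "\<exists>A. finite A \<and> A \<subseteq> ?X \<and> ?t ` ?X = ?t ` A"
    using finite_subset_image[OF \<open>finite (?t ` ?X)\<close> order_refl] by blast
  then obtain A where A: "finite A" "A \<subseteq> ?X" "?t ` ?X = ?t ` A" by blast
  let ?Q = "\<lambda>a xs. eqtp L M (a @ rs) (xs @ rs)"
  have "pdef L M (set rs) N (?Q a)" if "a \<in> A" for a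
  proof -
    have a: "a \<in> tuples U N" using that A(2) by blast
    then have "set (a @ rs) \<subseteq> U" using assms(1) by (auto simp: tuples_def)
    from home.isolating_formula_V[OF this] obtain \<chi> where \<chi>: "wf_fm L \<chi>" "fv \<chi> \<subseteq> {..<length (a @ rs)}"
      "sat M ((!) (a @ rs)) \<chi>"
      "\<forall>bs. length bs = length (a @ rs) \<and> set bs \<subseteq> U \<and> sat M ((!) bs) \<chi> \<longrightarrow> eqtp L M (a @ rs) bs"
      by (elim exE conjE) (rule that)
    show ?thesis
    proof (rule pdefI[OF \<chi>(1) order_refl])
      show "fv \<chi> \<subseteq> {..<N + length rs}" using \<chi>(2) a by (simp add: tuples_def)
      fix xs assume xs: "xs \<in> tuples U N"
      show "?Q a xs \<longleftrightarrow> sat M ((!) (xs @ rs)) \<chi>"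
      proof
        assume "?Q a xs"
        then show "sat M ((!) (xs @ rs)) \<chi>" using eqtp_sat[OF _ \<chi>(1,2)] \<chi>(3) by blast
      next
        assume "sat M ((!) (xs @ rs)) \<chi>"
        then show "?Q a xs" using \<chi>(4)[rule_format, of "xs @ rs"] xs a assms(1) by (auto simp: tuples_def)
      qed
    qed
  qed
  then have "pdef L M (set rs) N (\<lambda>xs. \<exists>Q \<in> ?Q ` A. Q xs)"
    using A(1) by (intro pdef_Bex) auto
  then have "pdef L M (set rs) N (\<lambda>xs. \<exists>a \<in> A. ?Q a xs)" by simp
  moreover have "P xs \<longleftrightarrow> (\<exists>a \<in> A. ?Q a xs)" if xs: "xs \<in> tuples U N" for xs
  proof
    assume "P xs"
    then have "?t xs \<in> ?t ` A" using xs A(3) by blast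
    then obtain a where a: "a \<in> A" "tp L M (a @ rs) {} = tp L M (xs @ rs) {}" by auto
    have "length a = length xs" using a(1) A(2) xs by (auto simp: tuples_def)
    then have "?Q a xs" using a(2) tp_eq_iff[of "a @ rs" "xs @ rs" L M] by simp
    then show "\<exists>a \<in> A. ?Q a xs" using a(1) by blast
  next
    assume "\<exists>a \<in> A. ?Q a xs"
    then obtain a where "a \<in> A" "?Q a xs" by blast
    then show "P xs" using inv[of a xs] A(2) xs by blast
  qed
  ultimately show ?thesis unfolding pdef_def by simp
qed

end

locale level_model = omega_cat_model L M \<kappa>
  for L :: "('f, 'r) lang" and M :: "('f, 'r, 'm) struct" and \<kappa> :: "'k rel" +
  fixes n :: nat and \<delta> :: "(unit, ('f, 'r, 'm) eq_sym) fm"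
  assumes level_space: "finite_type_space (eq_lang L M) (eq_struct L M) (level L M n) \<delta>"
begin

abbreviation V :: "'m imag set" where "V \<equiv> level L M n"
abbreviation cl :: "'m imag set \<Rightarrow> 'm imag set" where "cl \<equiv> acl_level L M n"

sublocale lev: finite_type_space "eq_lang L M" "eq_struct L M" "level L M n" \<delta>
  by (rule level_space)

lemma cl_eq: "cl = lev.cl"
  by (rule ext) (simp add: acl_level_def)

sublocale lfc: locally_finite_closure "level L M n" "acl_level L M n"
proof
  show "cl A \<subseteq> V" for A by (simp add: acl_level_def)
  show "A \<subseteq> cl A" if "A \<subseteq> V" for A
    using that acl_extensive[of A ME LE] level_univ_eq[of L M n] by (auto simp: acl_level_def)
  show "cl A \<subseteq> cl B" if "A \<subseteq> B" for A B
    using acl_mono[OF that, of LE ME] by (auto simp: acl_level_def)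
  show "cl (cl A) \<subseteq> cl A" if "A \<subseteq> V" for A
    unfolding cl_eq by (rule lev.cl_idem[OF that])
  show "finite (cl A)" if "finite A" "A \<subseteq> V" for A
    unfolding cl_eq by (rule lev.finite_cl[OF that])
  show "\<exists>B. finite B \<and> B \<subseteq> A \<and> x \<in> cl B" if "x \<in> cl A" for x A
    using acl_finitary[of x LE ME A] that by (auto simp: acl_level_def)
qed

section \<open>Rank and independence in a level in terms of natural numbers\<close>

lemma has_rank_iff:
  assumes "finite A" "A \<subseteq> V" "B \<subseteq> V"
  shows "has_rank L M n A B \<alpha> \<longleftrightarrow> \<alpha> = fin_ord (nrk cl A B)"
  unfolding has_rank_def by (rule lfc.rank_iff[OF assms])

lemma rk_eq:
  assumes "finite A" "A \<subseteq> V" "B \<subseteq> V"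
  shows "rk L M n A B = Some (fin_ord (nrk cl A B))"
  unfolding rk_def has_rank_iff[OF assms] by simp

lemma n_indep_iff:
  assumes "A \<subseteq> V" "B \<subseteq> V" "C \<subseteq> V"
  shows "n_indep L M n A B C \<longleftrightarrow> (\<forall>A'. finite A' \<and> A' \<subseteq> A \<longrightarrow> nrk cl A' (B \<union> C) = nrk cl A' C)"
proof -
  have "rk L M n A' (B \<union> C) = rk L M n A' C \<longleftrightarrow> nrk cl A' (B \<union> C) = nrk cl A' C"
    if "finite A'" "A' \<subseteq> A" for A'
    using that assms rk_eq[of A' "B \<union> C"] rk_eq[of A' C] by (simp add: fin_ord_inject)
  then show ?thesis unfolding n_indep_def by blast
qed

lemma n_indep_nrkI:
  assumes "A \<subseteq> V" "B \<subseteq> V" "C \<subseteq> V"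
    "\<And>A'. finite A' \<Longrightarrow> A' \<subseteq> A \<Longrightarrow> nrk cl A' (B \<union> C) = nrk cl A' C"
  shows "n_indep L M n A B C"
  unfolding n_indep_iff[OF assms(1-3)] by (intro allI impI, elim conjE) (rule assms(4))

lemma n_indep_nrkD:
  assumes "n_indep L M n A B C" "A \<subseteq> V" "B \<subseteq> V" "C \<subseteq> V" "finite A'" "A' \<subseteq> A"
  shows "nrk cl A' (B \<union> C) = nrk cl A' C"
  using assms(1)[unfolded n_indep_iff[OF assms(2-4)], rule_format, of A'] assms(5,6) by simp

text \<open>Homogeneity carries a longest independent sequence along; membership in the closure and
  independence are preserved with the type.\<close>

lemma nrk_eqtp_le:
  assumes "eqtp LE ME (as @ cs) (as' @ cs')" "length as = length as'"
    "set (as @ cs) \<subseteq> V" "set (as' @ cs') \<subseteq> V"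
  shows "nrk cl (set as) (set cs) \<le> nrk cl (set as') (set cs')"
proof -
  obtain ds where ds: "length ds = nrk cl (set as) (set cs)" "set ds \<subseteq> cl (set as)" "indep_seq cl (set cs) ds"
    using lfc.nrk_attained[of "set as" "set cs"] assms(3) by auto
  have dsV: "set ds \<subseteq> V" using ds(2) by (auto simp: acl_level_def)
  from lev.homogeneous_tuple[OF assms(1,3,4) dsV] obtain ds' where
    ds': "set ds' \<subseteq> V" "length ds' = length ds" "eqtp LE ME (ds @ as @ cs) (ds' @ as' @ cs')" by blast
  have len: "length cs = length cs'" using eqtp_length[OF assms(1)] assms(2) by simp
  have "ds' ! i \<in> cl (set as')" if "i < length ds'" for i
  proof -
    have "eqtp LE ME (ds ! i # as @ cs) (ds' ! i # as' @ cs')"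
      using eqtp_nth_Cons[OF ds'(3)] ds'(2) that by simp
    then have "eqtp LE ME (ds ! i # as) (ds' ! i # as')"
      by (rule eqtp_zip) (use assms(2) in auto)
    moreover have "ds ! i \<in> cl (set as)" "ds' ! i \<in> V" using ds(2) ds'(1,2) that by auto
    ultimately show ?thesis
      using lev.acl_invariant[of "ds ! i" as "ds' ! i" as'] assms(3,4) by (auto simp: acl_level_def)
  qed
  then have "set ds' \<subseteq> cl (set as')" by (auto simp: in_set_conv_nth)
  moreover have "eqtp LE ME (ds @ cs) (ds' @ cs')"
    by (rule eqtp_zip[OF ds'(3)]) (use assms(2) len ds'(2) in auto)
  then have "indep_seq cl (set cs') ds'"
    unfolding cl_eq
    by (rule lev.indep_seq_invariant) (use ds(3) ds' dsV assms(3,4) in \<open>auto simp: cl_eq\<close>)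
  ultimately show ?thesis
    using lfc.nrk_ge[of "set as'" "set cs'" ds'] assms(4) ds(1) ds'(2) by simp
qed

text \<open>For an infinite base, both ranks are attained over finite parts, one found in
  \<open>C\<close> and one in its image under \<open>F\<close>. Each part gives one of the two
  inequalities.\<close>

lemma nrk_eqtp:
  assumes eq: "\<And>cs. set cs \<subseteq> C \<Longrightarrow> eqtp LE ME (as @ cs) (as' @ map F cs)"
    and V: "set as \<subseteq> V" "set as' \<subseteq> V" "C \<subseteq> V" "F ` C \<subseteq> V"
  shows "nrk cl (set as) C = nrk cl (set as') (F ` C)"
proof -
  have len: "length as = length as'" using eqtp_length[OF eq[of "[]"]] by simp
  have fin: "nrk cl (set as) C0 = nrk cl (set as') (F ` C0)" if "finite C0" "C0 \<subseteq> C" for C0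
  proof -
    obtain cs where cs: "set cs = C0" using finite_list[OF \<open>finite C0\<close>] by blast
    have e: "eqtp LE ME (as @ cs) (as' @ map F cs)" using eq cs that by blast
    have "F ` C0 \<subseteq> V" using V(4) that(2) by blast
    then have W: "set (as @ cs) \<subseteq> V" "set (as' @ map F cs) \<subseteq> V" using V(1-3) cs that by auto
    show ?thesis
      using nrk_eqtp_le[OF e len W] nrk_eqtp_le[OF eqtp_sym[OF e] len[symmetric] W(2,1)] cs by simp
  qed
  obtain C0 where C0: "finite C0" "C0 \<subseteq> C" "nrk cl (set as) C0 = nrk cl (set as) C"
    using lfc.nrk_finite_base[of "set as" C] V by auto
  obtain D0 where D0: "finite D0" "D0 \<subseteq> F ` C" "nrk cl (set as') D0 = nrk cl (set as') (F ` C)"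
    using lfc.nrk_finite_base[of "set as'" "F ` C"] V by auto
  obtain C1 where C1: "C1 \<subseteq> C" "finite C1" "D0 = F ` C1" using finite_subset_image[OF D0(1,2)] by blast
  have "nrk cl (set as') (F ` C) \<le> nrk cl (set as') (F ` C0)"
    using lfc.nrk_antimono[of "set as'" "F ` C" "F ` C0"] V image_mono[OF C0(2), of F] by simp
  moreover have "nrk cl (set as) C \<le> nrk cl (set as) C1"
    using lfc.nrk_antimono[of "set as" C C1] V C1 by auto
  ultimately show ?thesis using fin[OF C0(1,2)] fin[OF C1(2,1)] C0(3) D0(3) C1(3) by simp
qed

section \<open>Invariance, local and finite character, monotonicity, transitivity\<close>

lemma invariance: "ind_invariance L M \<kappa> n (n_indep L M n)"
  unfolding ind_invariance_def
proof (intro allI impI, elim conjE)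
  fix A B C S \<sigma>
  assume A: "finite A" "small_in_level L M \<kappa> n A" "small_in_level L M \<kappa> n B" "small_in_level L M \<kappa> n C"
    and \<sigma>: "elementary_map LE ME S \<sigma>" and S: "A \<union> B \<union> C \<subseteq> S"
  have V: "A \<subseteq> V" "B \<subseteq> V" "C \<subseteq> V" using A by (auto simp: small_in_level_def)
  have eq: "eqtp LE ME as (map \<sigma> as)" if "set as \<subseteq> S" for as
    using \<sigma> that tp_eq_iff[of as "map \<sigma> as" LE ME] by (simp add: elementary_map_def)
  \<comment> \<open>An elementary map takes its values in the whole expansion; elements of the level
    stay in it because membership in a sort is part of the type.\<close>
  have \<sigma>V: "\<sigma> x \<in> V" if "x \<in> S" "x \<in> V" for x
  proof -
    have "eqtp LE ME [\<sigma> x] [x]" using eqtp_sym[OF eq[of "[x]"]] that by simp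
    moreover have "\<sigma> x \<in> univ ME" using \<sigma> that by (auto simp: elementary_map_def)
    ultimately show ?thesis using eqtp_level[of "[\<sigma> x]" "[x]" n] that by simp
  qed
  have \<sigma>ABC: "\<sigma> ` (A \<union> B \<union> C) \<subseteq> V"
  proof (rule image_subsetI)
    fix x assume "x \<in> A \<union> B \<union> C"
    then have "x \<in> S" "x \<in> V" using V S by auto
    then show "\<sigma> x \<in> V" by (rule \<sigma>V)
  qed
  have nrk: "nrk cl A' D = nrk cl (\<sigma> ` A') (\<sigma> ` D)"
    if "finite A'" "A' \<subseteq> A" "D \<subseteq> B \<union> C" for A' D
  proof -
    obtain as where as: "set as = A'" using finite_list[OF \<open>finite A'\<close>] by blast
    have "nrk cl (set as) D = nrk cl (set (map \<sigma> as)) (\<sigma> ` D)"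
    proof (rule nrk_eqtp)
      show "eqtp LE ME (as @ cs) (map \<sigma> as @ map \<sigma> cs)" if "set cs \<subseteq> D" for cs
      proof -
        have "set (as @ cs) \<subseteq> S" unfolding set_append using as S \<open>A' \<subseteq> A\<close> \<open>D \<subseteq> _\<close> that by blast
        from eq[OF this] show ?thesis by simp
      qed
      show "set (map \<sigma> as) \<subseteq> V" "\<sigma> ` D \<subseteq> V" "set as \<subseteq> V" "D \<subseteq> V"
        using as \<open>A' \<subseteq> A\<close> \<open>D \<subseteq> _\<close> V \<sigma>ABC unfolding set_map by blast+
    qed
    then show ?thesis using as by simp
  qed
  have \<sigma>V': "\<sigma> ` A \<subseteq> V" "\<sigma> ` B \<subseteq> V" "\<sigma> ` C \<subseteq> V" using \<sigma>ABC unfolding image_Un by blast+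
  have "(\<forall>A'. finite A' \<and> A' \<subseteq> A \<longrightarrow> nrk cl A' (B \<union> C) = nrk cl A' C) \<longleftrightarrow>
    (\<forall>A''. finite A'' \<and> A'' \<subseteq> \<sigma> ` A \<longrightarrow> nrk cl A'' (\<sigma> ` B \<union> \<sigma> ` C) = nrk cl A'' (\<sigma> ` C))"
  proof (intro iffI allI impI)
    fix A'' assume *: "\<forall>A'. finite A' \<and> A' \<subseteq> A \<longrightarrow> nrk cl A' (B \<union> C) = nrk cl A' C"
      and A'': "finite A'' \<and> A'' \<subseteq> \<sigma> ` A"
    then obtain A' where A': "A' \<subseteq> A" "finite A'" "A'' = \<sigma> ` A'" using finite_subset_image[of A'' \<sigma> A] by blast
    then show "nrk cl A'' (\<sigma> ` B \<union> \<sigma> ` C) = nrk cl A'' (\<sigma> ` C)"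
      using * nrk[OF A'(2,1), of "B \<union> C"] nrk[OF A'(2,1), of C] by (simp add: image_Un)
  next
    fix A' assume *: "\<forall>A''. finite A'' \<and> A'' \<subseteq> \<sigma> ` A \<longrightarrow> nrk cl A'' (\<sigma> ` B \<union> \<sigma> ` C) = nrk cl A'' (\<sigma> ` C)"
      and A': "finite A' \<and> A' \<subseteq> A"
    then have "nrk cl (\<sigma> ` A') (\<sigma> ` B \<union> \<sigma> ` C) = nrk cl (\<sigma> ` A') (\<sigma> ` C)" by blast
    then show "nrk cl A' (B \<union> C) = nrk cl A' C"
      using A' nrk[of A' "B \<union> C"] nrk[of A' C] by (simp add: image_Un)
  qed
  then show "n_indep L M n A B C \<longleftrightarrow> n_indep L M n (\<sigma> ` A) (\<sigma> ` B) (\<sigma> ` C)"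
    unfolding n_indep_iff[OF V] n_indep_iff[OF \<sigma>V'] .
qed

text \<open>Each of the finitely many subsets of \<open>A\<close> attains its rank over a finite
  part of \<open>B\<close>; the union of these parts is a base that is even finite.\<close>

lemma local_character: "ind_local_character L M \<kappa> n (n_indep L M n)"
  unfolding ind_local_character_def
proof (intro allI impI, elim conjE)
  fix A B assume "finite A" "small_in_level L M \<kappa> n A" "small_in_level L M \<kappa> n B"
  then have A: "finite A" "A \<subseteq> V" "B \<subseteq> V" by (auto simp: small_in_level_def)
  have "\<exists>B0. finite B0 \<and> B0 \<subseteq> B \<and> nrk cl A' B0 = nrk cl A' B" if "A' \<subseteq> A" for A'
  proof (rule lfc.nrk_finite_base[OF _ _ A(3)])
    show "finite A'" by (rule finite_subset[OF that A(1)])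
    show "A' \<subseteq> V" by (rule order_trans[OF that A(2)])
  qed
  then obtain f where f: "\<And>A'. A' \<subseteq> A \<Longrightarrow> finite (f A') \<and> f A' \<subseteq> B \<and> nrk cl A' (f A') = nrk cl A' B"
    by metis
  let ?C = "\<Union>A' \<in> Pow A. f A'"
  have C: "?C \<subseteq> B" "finite ?C" using f A(1) by auto
  have "nrk cl A' (B \<union> ?C) = nrk cl A' ?C" if "finite A'" "A' \<subseteq> A" for A'
  proof (rule antisym)
    have A': "A' \<subseteq> V" "?C \<subseteq> V" "B \<union> ?C \<subseteq> V" using that A C by auto
    show "nrk cl A' (B \<union> ?C) \<le> nrk cl A' ?C" using lfc.nrk_antimono[OF that(1) A'(1,3)] by simp
    have "nrk cl A' ?C \<le> nrk cl A' (f A')"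
      by (rule lfc.nrk_antimono[OF that(1) A'(1,2)]) (use that in blast)
    then show "nrk cl A' ?C \<le> nrk cl A' (B \<union> ?C)" using f[OF that(2)] C(1) by (simp add: Un_absorb2)
  qed
  moreover have "?C \<subseteq> V" by (rule order_trans[OF C(1) A(3)])
  ultimately have "n_indep L M n A B ?C" by (intro n_indep_nrkI[OF A(2,3)])
  then show "\<exists>C \<subseteq> B. countable C \<and> n_indep L M n A B C"
    using C by (intro exI[of _ ?C]) (auto intro: countable_finite)
qed

text \<open>For the converse, the rank over \<open>B \<union> C\<close> is attained over some finite
  \<open>D\<close>. Independence from \<open>D \<inter> B\<close> over \<open>C\<close> then bounds
  it from below.\<close>

lemma finite_character: "ind_finite_character L M \<kappa> n (n_indep L M n)"
  unfolding ind_finite_character_def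
proof (intro allI impI, elim conjE)
  fix A B C assume "finite A" "small_in_level L M \<kappa> n A" "small_in_level L M \<kappa> n B" "small_in_level L M \<kappa> n C"
  then have A: "finite A" "A \<subseteq> V" "B \<subseteq> V" "C \<subseteq> V" by (auto simp: small_in_level_def)
  show "n_indep L M n A B C \<longleftrightarrow> (\<forall>B'. finite B' \<and> B' \<subseteq> B \<longrightarrow> n_indep L M n A B' C)"
  proof (intro iffI allI impI)
    fix B' assume ind: "n_indep L M n A B C" and B': "finite B' \<and> B' \<subseteq> B"
    have "nrk cl A' (B' \<union> C) = nrk cl A' C" if "finite A'" "A' \<subseteq> A" for A'
    proof (rule antisym)
      have A': "A' \<subseteq> V" "B' \<union> C \<subseteq> V" "B \<union> C \<subseteq> V" using that A B' by auto
      show "nrk cl A' (B' \<union> C) \<le> nrk cl A' C" using lfc.nrk_antimono[OF that(1) A'(1,2)] by simp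
      have "nrk cl A' (B \<union> C) = nrk cl A' C" by (rule n_indep_nrkD[OF ind A(2-4) that])
      moreover have "nrk cl A' (B \<union> C) \<le> nrk cl A' (B' \<union> C)"
        by (rule lfc.nrk_antimono[OF that(1) A'(1,3)]) (use B' in blast)
      ultimately show "nrk cl A' C \<le> nrk cl A' (B' \<union> C)" by simp
    qed
    moreover have "B' \<subseteq> V" using B' A by blast
    ultimately show "n_indep L M n A B' C" by (intro n_indep_nrkI[OF A(2) _ A(4)])
  next
    assume ind: "\<forall>B'. finite B' \<and> B' \<subseteq> B \<longrightarrow> n_indep L M n A B' C"
    have "nrk cl A' (B \<union> C) = nrk cl A' C" if "finite A'" "A' \<subseteq> A" for A'
    proof (rule antisym)
      have A': "A' \<subseteq> V" "B \<union> C \<subseteq> V" using that A by auto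
      show "nrk cl A' (B \<union> C) \<le> nrk cl A' C" using lfc.nrk_antimono[OF that(1) A'] by simp
      from lfc.nrk_finite_base[OF that(1) A'] obtain D where
        D: "finite D" "D \<subseteq> B \<union> C" "nrk cl A' D = nrk cl A' (B \<union> C)" by blast
      have DB: "D \<inter> B \<subseteq> V" "(D \<inter> B) \<union> C \<subseteq> V" using A by auto
      have "n_indep L M n A (D \<inter> B) C" using ind D(1) by blast
      then have "nrk cl A' ((D \<inter> B) \<union> C) = nrk cl A' C"
        by (rule n_indep_nrkD[OF _ A(2) DB(1) A(4) that])
      moreover have "nrk cl A' ((D \<inter> B) \<union> C) \<le> nrk cl A' D"
        by (rule lfc.nrk_antimono[OF that(1) A'(1) DB(2)]) (use D(2) in blast)
      ultimately show "nrk cl A' C \<le> nrk cl A' (B \<union> C)" using D(3) by simp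
    qed
    then show "n_indep L M n A B C" by (intro n_indep_nrkI[OF A(2-4)])
  qed
qed

text \<open>The rank over \<open>C\<close> lies between the ranks over \<open>D\<close> and over
  \<open>B\<close>, which agree.\<close>

lemma monotonicity: "ind_monotonicity L M \<kappa> n (n_indep L M n)"
  unfolding ind_monotonicity_def
proof (intro allI impI, elim conjE)
  fix A B C D assume "small_in_level L M \<kappa> n A" "small_in_level L M \<kappa> n D"
    and sub: "B \<subseteq> C" "C \<subseteq> D" and ind: "n_indep L M n A D B"
  then have A: "A \<subseteq> V" "B \<subseteq> V" "C \<subseteq> V" "D \<subseteq> V" by (auto simp: small_in_level_def)
  have "nrk cl A' C = nrk cl A' B \<and> nrk cl A' D = nrk cl A' C" if "finite A'" "A' \<subseteq> A" for A'
  proof -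
    have A': "A' \<subseteq> V" using that A by auto
    have "nrk cl A' (D \<union> B) = nrk cl A' B" by (rule n_indep_nrkD[OF ind A(1,4,2) that])
    then show ?thesis
      using lfc.nrk_antimono[OF that(1) A' A(4) sub(2)] lfc.nrk_antimono[OF that(1) A' A(3) sub(1)] sub
      by (simp add: Un_absorb2)
  qed
  then show "n_indep L M n A C B \<and> n_indep L M n A D C"
    unfolding n_indep_iff[OF A(1,3,2)] n_indep_iff[OF A(1,4,3)] using sub by (simp add: Un_absorb2)
qed

lemma transitivity: "ind_transitivity L M \<kappa> n (n_indep L M n)"
  unfolding ind_transitivity_def
proof (intro allI impI, elim conjE)
  fix A B C D assume sub: "B \<subseteq> C" "C \<subseteq> D" and ind: "n_indep L M n A C B" "n_indep L M n A D C"
  have "C \<union> B = C" "D \<union> C = D" "D \<union> B = D" using sub by auto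
  then show "n_indep L M n A D B" using ind unfolding n_indep_def by simp
qed

section \<open>Realizing a type without loss of rank\<close>

lemma level_reps_ex:
  assumes "B \<subseteq> V"
  shows "\<exists>st rep. \<forall>b \<in> B. valid_sort L M (st b) \<and> rep b \<in> tuples U (sort_arity (st b)) \<and> b = dec (st b) (rep b)"
proof -
  have "\<forall>b \<in> B. \<exists>p. valid_sort L M (fst p) \<and> snd p \<in> tuples U (sort_arity (fst p)) \<and> b = dec (fst p) (snd p)"
  proof
    fix b assume "b \<in> B"
    then obtain s where "s \<in> sorts L M n" "b \<in> elems M s" using assms level_elems[of L M n] by blast
    then show "\<exists>p. valid_sort L M (fst p) \<and> snd p \<in> tuples U (sort_arity (fst p)) \<and> b = dec (fst p) (snd p)"
      using sorts_valid[of s L M n] by (auto simp: elems_def)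
  qed
  from bchoice[OF this] obtain p where "\<forall>b \<in> B. valid_sort L M (fst (p b)) \<and>
    snd (p b) \<in> tuples U (sort_arity (fst (p b))) \<and> b = dec (fst (p b)) (snd (p b))" by (elim exE) (rule that)
  then show ?thesis by (intro exI[of _ "\<lambda>b. fst (p b)"] exI[of _ "\<lambda>b. snd (p b)"])
qed

lemma decs_reps:
  assumes "\<And>b. b \<in> set bs \<Longrightarrow> rep b \<in> tuples U (sort_arity (st b)) \<and> b = dec (st b) (rep b)"
  shows "concat (map rep bs) \<in> tuples U (arity (map st bs)) \<and> decs (map st bs) (concat (map rep bs)) = bs"
  using assms by (induction bs) (auto simp: tuples_def)

text \<open>The conditions on a realization that involve only the finitely many parameters \<open>bs\<close> are
  definable over representatives of \<open>bs\<close> in the home sort, because there are only finitely many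
  types. So saturation of the home structure applies.\<close>

lemma free_extension:
  assumes B: "B \<subseteq> V" "small \<kappa> B" and CB: "C \<subseteq> B" and as: "set as \<subseteq> V"
  shows "\<exists>as'. length as' = length as \<and> set as' \<subseteq> V \<and>
    (\<forall>cs. set cs \<subseteq> C \<longrightarrow> eqtp LE ME (as' @ cs) (as @ cs)) \<and> nrk cl (set as') B = nrk cl (set as') C"
proof -
  let ?a = "length as"
  have CV: "C \<subseteq> V" using B CB by blast
  \<comment> \<open>A longest independent sequence over \<open>C\<close> is realized together with
    the tuple, because its copy will witness that the rank does not drop over
    \<open>B\<close>.\<close>
  obtain ds where ds: "length ds = nrk cl (set as) C" "set ds \<subseteq> cl (set as)" "indep_seq cl C ds"
    using lfc.nrk_attained[of "set as" C] as CV by auto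
  have dsV: "set ds \<subseteq> V" using ds(2) by (auto simp: acl_level_def)
  define fs where "fs = as @ ds"
  have fsV: "set fs \<subseteq> V" using as dsV by (simp add: fs_def)
  obtain ss where ss: "set ss \<subseteq> sorts L M n" "length ss = length fs" "list_all2 (\<lambda>s g. g \<in> elems M s) ss fs"
    using level_sorts_ex[OF fsV] by blast
  have ssv: "list_all (valid_sort L M) ss" using ss(1) sorts_valid[of _ L M n] by (auto simp: list_all_iff)
  obtain st rep where rep: "\<forall>b \<in> B. valid_sort L M (st b) \<and> rep b \<in> tuples U (sort_arity (st b)) \<and> b = dec (st b) (rep b)"
    using level_reps_ex[OF B(1)] by (elim exE) (rule that)
  define R where "R = (\<Union>b \<in> B. set (rep b))"
  have RU: "R \<subseteq> U" using rep by (auto simp: R_def tuples_def)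
  have Rsm: "small \<kappa> R" unfolding R_def by (rule small_UN_finite[OF B(2)]) simp
  \<comment> \<open>What a finite list \<open>bs\<close> of parameters demands of \<open>gs\<close>:
    the type of \<open>fs\<close> over those parameters that lie in \<open>C\<close>, and
    independence over all of them for the part of \<open>gs\<close> that copies
    \<open>ds\<close>.\<close>
  define G where "G bs gs \<longleftrightarrow> eqtp LE ME (gs @ filter (\<lambda>c. c \<in> C) bs) (fs @ filter (\<lambda>c. c \<in> C) bs) \<and>
    indep_seq cl (set bs) (drop ?a gs)" for bs gs
  have decsV: "set (decs ss xs) \<subseteq> V" "length (decs ss xs) = length fs" if "xs \<in> tuples U (arity ss)" for xs
  proof -
    show "length (decs ss xs) = length fs" using ss(2) by (simp add: length_decs)
    show "set (decs ss xs) \<subseteq> V"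
      unfolding level_elems using decs_elems[OF that] ss(1)
      by (fastforce simp: list_all2_conv_all_nth in_set_conv_nth)
  qed
  have def: "pdef L M R (arity ss) (\<lambda>xs. G bs (decs ss xs))" if bs: "set bs \<subseteq> B" for bs
  proof -
    let ?rs = "concat (map rep bs)"
    have rs: "?rs \<in> tuples U (arity (map st bs))" "decs (map st bs) ?rs = bs"
      using decs_reps[of bs rep st] rep bs by auto
    have "pdef L M (set ?rs) (arity ss) (\<lambda>xs. G bs (decs ss xs))"
    proof (rule pdef_invariant)
      show "set ?rs \<subseteq> U" using rs(1) by (simp add: tuples_def)
      fix xs xs' assume xs: "xs \<in> tuples U (arity ss)" "xs' \<in> tuples U (arity ss)"
        and eq: "eqtp L M (xs @ ?rs) (xs' @ ?rs)" and G: "G bs (decs ss xs)"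
      have "list_all (valid_sort L M) (ss @ map st bs)"
        using ssv rep bs by (auto simp: list_all_iff)
      then have "eqtp LE ME (decs (ss @ map st bs) (xs @ ?rs)) (decs (ss @ map st bs) (xs' @ ?rs))"
        by (rule decs_eqtp[OF _ eq]) (use xs rs(1) in \<open>auto simp: tuples_def\<close>)
      then have e: "eqtp LE ME (decs ss xs @ bs) (decs ss xs' @ bs)"
        using xs rs(2) by (simp add: decs_append tuples_def)
      have len: "length (decs ss xs) = length (decs ss xs')" by (simp add: length_decs)
      have "eqtp LE ME (decs ss xs' @ filter (\<lambda>c. c \<in> C) bs) (decs ss xs @ filter (\<lambda>c. c \<in> C) bs)"
        by (rule eqtp_zip[OF eqtp_sym[OF e]]) (use len in \<open>auto simp: set_zip_same\<close>)
      from eqtp_trans[OF this] have "eqtp LE ME (decs ss xs' @ filter (\<lambda>c. c \<in> C) bs) (fs @ filter (\<lambda>c. c \<in> C) bs)"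
        using G by (simp add: G_def)
      moreover have "indep_seq cl (set bs) (drop ?a (decs ss xs'))"
        unfolding cl_eq
      proof (rule lev.indep_seq_invariant)
        have "set (zip (drop ?a (decs ss xs)) (drop ?a (decs ss xs'))) \<subseteq> set (zip (decs ss xs) (decs ss xs'))"
          unfolding drop_zip[symmetric] by (rule set_drop_subset)
        then show "eqtp LE ME (drop ?a (decs ss xs) @ bs) (drop ?a (decs ss xs') @ bs)"
          by (intro eqtp_zip[OF e]) (use len in auto)
        show "length (drop ?a (decs ss xs)) = length (drop ?a (decs ss xs'))" using len by simp
        show "set (drop ?a (decs ss xs) @ bs) \<subseteq> V" "set (drop ?a (decs ss xs') @ bs) \<subseteq> V"
          using decsV[OF xs(1)] decsV[OF xs(2)] bs B(1)
            set_drop_subset[of ?a "decs ss xs"] set_drop_subset[of ?a "decs ss xs'"] by auto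
        show "indep_seq lev.cl (set bs) (drop ?a (decs ss xs))" using G by (simp add: G_def cl_eq)
      qed
      ultimately show "G bs (decs ss xs')" by (simp add: G_def)
    qed
    then show ?thesis by (rule pdef_mono) (use bs in \<open>auto simp: R_def\<close>)
  qed
  \<comment> \<open>The sequence is moved off the closure of \<open>bs\<close> before the tuple
    \<open>as\<close> follows by homogeneity.\<close>
  have ex: "\<exists>xs \<in> tuples U (arity ss). G bs (decs ss xs)" if bs: "set bs \<subseteq> B" for bs
  proof -
    let ?cs = "filter (\<lambda>c. c \<in> C) bs"
    have cV: "set ?cs \<subseteq> V" "set bs \<subseteq> V" using bs B by auto
    have "indep_seq cl (set ?cs) ds"
      by (rule lfc.indep_seq_antimono[OF ds(3)]) (use CV dsV in auto)
    then have "indep_seq lev.cl (set ?cs) ds" by (simp add: cl_eq)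
    from lev.indep_seq_extension[OF eqtp_refl cV(1,1,2) dsV this] obtain ds' where
      ds': "set ds' \<subseteq> V" "length ds' = length ds" "eqtp LE ME (ds @ ?cs) (ds' @ ?cs)"
        "indep_seq lev.cl (set bs) ds'" by blast
    from lev.homogeneous_tuple[OF ds'(3) _ _ as] obtain as' where
      as': "set as' \<subseteq> V" "length as' = ?a" "eqtp LE ME (as @ ds @ ?cs) (as' @ ds' @ ?cs)"
      using dsV ds'(1) cV by auto
    let ?gs = "as' @ ds'"
    have gs: "eqtp LE ME (?gs @ ?cs) (fs @ ?cs)" using eqtp_sym[OF as'(3)] by (simp add: fs_def)
    have "eqtp LE ME ?gs fs" using eqtp_appendD(1)[OF gs] as'(2) ds'(2) by (simp add: fs_def)
    moreover have "set ?gs \<subseteq> univ ME" using as'(1) ds'(1) level_univ_eq[of L M n] by auto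
    ultimately have "list_all2 (\<lambda>s g. g \<in> elems M s) ss ?gs" using eqtp_elems ss(3) ssv by blast
    from decs_surj[OF this] obtain xs where "xs \<in> tuples U (arity ss)" "?gs = decs ss xs" by blast
    moreover have "G bs ?gs" unfolding G_def using gs ds'(4) as'(2) by (simp add: cl_eq)
    ultimately show ?thesis by auto
  qed
  let ?P = "\<lambda>bs xs. G bs (decs ss xs)"
  have "\<exists>xs \<in> tuples U (arity ss). \<forall>P \<in> ?P ` lists B. P xs"
  proof (rule saturation[OF RU Rsm])
    show "pdef L M R (arity ss) P" if "P \<in> ?P ` lists B" for P using that def by auto
    fix F assume "finite F" "F \<subseteq> ?P ` lists B"
    from finite_subset_image[OF this] obtain BS where BS: "BS \<subseteq> lists B" "finite BS" "F = ?P ` BS"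
      by (elim exE conjE) (rule that)
    \<comment> \<open>The condition for one list containing all parameters of a finite family
      implies every condition of the family.\<close>
    obtain bss where bss: "set bss = BS" using finite_list[OF BS(2)] by blast
    have "set (concat bss) \<subseteq> B" using BS(1) bss by auto
    from ex[OF this] obtain xs where xs: "xs \<in> tuples U (arity ss)" "G (concat bss) (decs ss xs)" by blast
    have "G bs (decs ss xs)" if "bs \<in> BS" for bs
    proof -
      have sub: "set bs \<subseteq> set (concat bss)" using that bss by auto
      have "eqtp LE ME (decs ss xs @ filter (\<lambda>c. c \<in> C) bs) (fs @ filter (\<lambda>c. c \<in> C) bs)"
      proof (rule eqtp_zip)
        show "eqtp LE ME (decs ss xs @ filter (\<lambda>c. c \<in> C) (concat bss)) (fs @ filter (\<lambda>c. c \<in> C) (concat bss))"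
          using xs(2) by (simp add: G_def)
      qed (use decsV(2)[OF xs(1)] sub in \<open>auto simp: set_zip_same\<close>)
      moreover have "indep_seq cl (set bs) (drop ?a (decs ss xs))"
      proof (rule lfc.indep_seq_antimono)
        show "indep_seq cl (set (concat bss)) (drop ?a (decs ss xs))" using xs(2) by (simp add: G_def)
        show "set (concat bss) \<union> set (drop ?a (decs ss xs)) \<subseteq> V"
          using decsV(1)[OF xs(1)] set_drop_subset[of ?a "decs ss xs"] \<open>set (concat bss) \<subseteq> B\<close> B(1) by blast
      qed (use sub in auto)
      ultimately show ?thesis by (simp add: G_def)
    qed
    then show "\<exists>xs \<in> tuples U (arity ss). \<forall>P \<in> F. P xs" unfolding BS(3) using xs(1) by (intro bexI[of _ xs]) auto
  qed
  then obtain xs where xs: "xs \<in> tuples U (arity ss)" "\<forall>P \<in> ?P ` lists B. P xs" by (elim bexE) (rule that)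
  have G: "G bs (decs ss xs)" if "set bs \<subseteq> B" for bs
    by (rule bspec[OF xs(2), of "?P bs"]) (use that in auto)
  define as' where "as' = take ?a (decs ss xs)"
  define ds' where "ds' = drop ?a (decs ss xs)"
  have gs: "decs ss xs = as' @ ds'" by (simp add: as'_def ds'_def)
  have len: "length as' = ?a" "length ds' = length ds"
    using decsV(2)[OF xs(1)] by (auto simp: as'_def ds'_def fs_def)
  have V': "set as' \<subseteq> V" "set ds' \<subseteq> V" using decsV(1)[OF xs(1)] gs by auto
  have eq: "eqtp LE ME (as' @ cs) (as @ cs)" if cs: "set cs \<subseteq> C" for cs
  proof -
    have "filter (\<lambda>c. c \<in> C) cs = cs" using cs by (auto simp: filter_id_conv)
    then have "eqtp LE ME ((as' @ ds') @ cs) (fs @ cs)" using G[of cs] cs CB gs by (simp add: G_def)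
    then show ?thesis by (rule eqtp_zip) (use len in \<open>auto simp: fs_def\<close>)
  qed
  have eq0: "eqtp LE ME (as' @ ds') (as @ ds)" using G[of "[]"] gs by (simp add: G_def fs_def)
  have "ds' ! i \<in> cl (set as')" if "i < length ds'" for i
  proof -
    have "eqtp LE ME (ds @ as) (ds' @ as')"
      by (rule eqtp_zip[OF eqtp_sym[OF eq0]]) (use len in auto)
    then have "eqtp LE ME (ds ! i # as) (ds' ! i # as')" using eqtp_nth_Cons len(2) that by metis
    moreover have "ds ! i \<in> cl (set as)" "ds' ! i \<in> V" using ds(2) len(2) V'(2) that by auto
    ultimately show ?thesis
      using lev.acl_invariant[of "ds ! i" as "ds' ! i" as'] as V'(1) by (auto simp: acl_level_def)
  qed
  then have "set ds' \<subseteq> cl (set as')" by (auto simp: in_set_conv_nth)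
  \<comment> \<open>The conditions gave independence over finite lists of parameters only; the
    finitary character of closure extends it to \<open>B\<close>.\<close>
  moreover have "indep_seq cl B ds'"
  proof (rule lfc.indep_seq_finitary[OF _ B(1) V'(2)])
    fix B0 assume B0: "finite B0" "B0 \<subseteq> B"
    obtain bs where "set bs = B0" using finite_list[OF B0(1)] by blast
    then show "indep_seq cl B0 ds'" using G[of bs] B0(2) by (simp add: G_def ds'_def)
  qed
  \<comment> \<open>The copied sequence gives the lower bound on the rank over \<open>B\<close>; the
    upper bound is antitonicity in the base.\<close>
  ultimately have "nrk cl (set as) C \<le> nrk cl (set as') B"
    using lfc.nrk_ge[of "set as'" B ds'] V'(1) B(1) len(2) ds(1) by simp
  moreover have "nrk cl (set as') C = nrk cl (set as) C"
    using nrk_eqtp[of C as' as "\<lambda>x. x"] eq V'(1) as CV by simp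
  moreover have "nrk cl (set as') B \<le> nrk cl (set as') C"
    using lfc.nrk_antimono[of "set as'" B C] V'(1) B(1) CB by simp
  ultimately have "nrk cl (set as') B = nrk cl (set as') C" by simp
  then show ?thesis using len(1) V'(1) eq by blast
qed

end

section \<open>Symmetry and extension from exchange\<close>

locale exchange_level_model = level_model +
  assumes exchange_property: "exchange_property L M \<kappa> n"
begin

sublocale exc: exchange_closure "level L M n" "acl_level L M n" "small \<kappa>"
proof
  show "small \<kappa> (insert x B)" if "small \<kappa> B" for x B by (rule small_insert[OF that])
  fix B x y
  assume B: "B \<subseteq> V" "small \<kappa> B" and x: "x \<in> V" "y \<in> V"
    and one: "nrk cl {x} B = 1" "nrk cl {y} B = 1" and y: "y \<in> cl (insert x B)" "y \<notin> cl B"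
  \<comment> \<open>The case \<open>k = 2\<close> of exchange. The range from 2 to 1 is empty, so
    that \<open>y\<close> has to avoid just the closure of \<open>B\<close>.\<close>
  let ?a = "\<lambda>i::nat. if i = 1 then x else y"
  have im: "?a ` {1..2} = {x, y}" "?a ` {1..2 - 1} = {x}" "?a ` {2..2 - 1} = {}" "?a ` {2..2} = {y}"
    by (auto simp: numeral_2_eq_2 atLeastAtMostSuc_conv)
  have rk: "rk L M n {z} B = Some (ord_succ ord_zero)" if "z \<in> {x, y}" for z
    using rk_eq[of "{z}" B] that x B(1) one by (auto simp: fin_ord_simps)
  have "?a 1 \<in> acl_eq L M (?a ` {2..2} \<union> B)"
  proof (rule exchange_property[unfolded exchange_property_def, rule_format, of B 2 ?a], intro conjI)
    show "B \<subseteq> univ ME" using B(1) level_univ_eq[of L M n] by blast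
    show "small \<kappa> B" by (rule B(2))
    show "(2::nat) \<le> 2" by simp
    show "?a ` {1..2} \<subseteq> V" unfolding im using x by simp
    show "\<forall>i \<in> {1..2}. rk L M n {?a i} B = Some (ord_succ ord_zero)" using rk by simp
    show "?a 2 \<in> acl_eq L M (?a ` {1..2 - 1} \<union> B) - acl_eq L M (?a ` {2..2 - 1} \<union> B)"
      unfolding im using y x by (simp add: acl_level_def)
  qed
  then show "x \<in> cl (insert y B)" unfolding im using x by (simp add: acl_level_def)
qed

text \<open>Independence concerns all finite subsets of \<open>A\<close>; additivity reduces it to
  the equality for \<open>A\<close> itself.\<close>

lemma n_indepI:
  assumes "finite A" "A \<subseteq> V" "B \<subseteq> V" "C \<subseteq> V" "small \<kappa> C" "small \<kappa> (B \<union> C)"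
    "nrk cl A (B \<union> C) = nrk cl A C"
  shows "n_indep L M n A B C"
  unfolding n_indep_iff[OF assms(2-4)]
proof (intro allI impI)
  fix A' assume A': "finite A' \<and> A' \<subseteq> A"
  show "nrk cl A' (B \<union> C) = nrk cl A' C"
    by (rule exc.nrk_eq_subset[OF assms(1,2)]) (use assms A' small_Un_finite in auto)
qed

lemma symmetry: "ind_symmetry L M \<kappa> n (n_indep L M n)"
proof -
  have "n_indep L M n B A C"
    if "finite A" "finite B" "A \<subseteq> V" "B \<subseteq> V" "C \<subseteq> V" "small \<kappa> C" "n_indep L M n A B C" for A B C
  proof (rule n_indepI)
    have "nrk cl A (B \<union> C) = nrk cl A C" 
      by (rule n_indep_nrkD[OF that(7,3,4,5,1) order_refl])
    then show "nrk cl B (A \<union> C) = nrk cl B C"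
      by (rule exc.nrk_symmetric[OF that(1,3,2,4,5,6) small_Un_finite[OF that(1,6)] small_Un_finite[OF that(2,6)]])
  qed (use that small_Un_finite[OF that(1,6)] in simp_all)
  note sym = this
  show ?thesis
    unfolding ind_symmetry_def
  proof (intro allI impI, elim conjE)
    fix A B C assume fin: "finite A" "finite B"
      and "small_in_level L M \<kappa> n A" "small_in_level L M \<kappa> n B" "small_in_level L M \<kappa> n C"
    then have V: "A \<subseteq> V" "B \<subseteq> V" "C \<subseteq> V" "small \<kappa> C" by (simp_all add: small_in_level_def)
    show "n_indep L M n A B C \<longleftrightarrow> n_indep L M n B A C"
      using sym[OF fin V] sym[OF fin(2,1) V(2,1,3,4)] by (rule iffI)
  qed
qed

lemma extension: "ind_extension L M \<kappa> n (n_indep L M n)"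
  unfolding ind_extension_def
proof (intro allI impI, elim conjE)
  fix as B C assume "small_in_level L M \<kappa> n (set as)" "small_in_level L M \<kappa> n B" and CB: "C \<subseteq> B"
  then have as: "set as \<subseteq> V" "B \<subseteq> V" "small \<kappa> B" by (auto simp: small_in_level_def)
  obtain as' where as': "length as' = length as" "set as' \<subseteq> V"
    "\<forall>cs. set cs \<subseteq> C \<longrightarrow> eqtp LE ME (as' @ cs) (as @ cs)" "nrk cl (set as') B = nrk cl (set as') C"
    using free_extension[OF as(2,3) CB as(1)] by (elim exE conjE) (rule that)
  have "B \<union> C = B" using CB by blast
  then have "n_indep L M n (set as') B C"
    using as as' CB small_mono[OF as(3) CB] by (intro n_indepI) auto
  moreover have "tp_eq L M as' C = tp_eq L M as C"
    using as'(1,3) by (intro tp_over_eqI) auto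
  moreover have "set as' \<subseteq> univ_eq L M" using as'(2) level_univ_eq[of L M n] by blast
  ultimately show "\<exists>as'. length as' = length as \<and> set as' \<subseteq> univ_eq L M \<and>
    tp_eq L M as' C = tp_eq L M as C \<and> n_indep L M n (set as') B C" using as'(1) by blast
qed

end

theorem theorem5p10:
  fixes L :: "('f, 'r) lang" and T :: "('f, 'r) fm set"
    and M :: "('f, 'r, 'm) struct" and \<kappa> :: "'k rel" and n :: nat
  assumes "countable_lang L"
    and "complete_theory L T"
    and "omega_categorical L T"
    and "is_model L M T"
    and "Cinfinite \<kappa>"
    and "saturated L \<kappa> M"
    and "exchange_property L M \<kappa> n"
  shows "independence_relation L M \<kappa> n (n_indep L M n)"
proof -
  have "is_struct L M" "T \<subseteq> sentences L"
    using assms(2,4) by (auto simp: is_model_def complete_theory_def)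
  interpret saturated_model L M \<kappa>
    by unfold_locales (use \<open>is_struct L M\<close> assms in auto)
  interpret omega_cat_model L M \<kappa>
    by unfold_locales (rule finite_types[OF assms(1) \<open>T \<subseteq> sentences L\<close> assms(3,4)])
  \<comment> \<open>A single formula defines the level because the level has finitely many sorts,
    which rests on the finiteness of types just established.\<close>
  obtain \<delta> where "finite_type_space (eq_lang L M) (eq_struct L M) (level L M n) \<delta>"
    using level_type_space by blast
  then interpret exchange_level_model L M \<kappa> n \<delta>
    using assms(7)
    by (intro exchange_level_model.intro level_model.intro exchange_level_model_axioms.intro
        level_model_axioms.intro omega_cat_model_axioms)
  show ?thesis
    unfolding independence_relation_def
    using invariance local_character finite_character extension monotonicity transitivity symmetry
    by blast
qed

end
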